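(* Assume (A1)--(A3) (stated in the context), let $x_0\in\Delta$, and let $\{x_k\}_{k\in\mathbb N}$ be defined by the OS-EM iteration $$x_{k+1}(t)=x_k(t)\int_\Sigma \frac{a_{[k]}(s,t)\,y_{[k]}(s)}{(\mathcal A_{[k]}x_k)(s)}\,ds ,\qquad [k]:=k \bmod N .$$ Then: (i) $f_{[k]}(x_{k+1})\le f_{[k]}(x_k)$ for every $k\in\mathbb N$. Moreover, if also (A4) is satisfied, with $x^*$ the solution appearing there, then the following assertions hold: (ii) the sequence $\{d(x^*,x_k)\}$ is nonincreasing; (iii) $\lim_{k\to\infty} f_{[k]}(x_k)=0$; (iv) $\lim_{k\to\infty} d(x_{k+1},x_k)=0$; (v) for each $0\le j\le N-1$ and each $p\in[1,\infty)$, $\lim_{l\to\infty}\|\mathcal A_j x_{j+lN}-y_j\|_{L^p(\Sigma)}=0$; (vi) if $\{x_k\}$ is bounded in $L^p(\Omega)$ for some $p\in(1,\infty)$, then it has a subsequence which converges weakly in $L^p(\Omega)$ to a solution of the system $\mathcal A_j x=y_j$, $j=0,\dots,N-1$.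
   Context: $\Omega$ and $\Sigma$ are open bounded subsets of $\mathbb R^d$, $d\ge1$, and $N\ge1$ is an integer. For $j=0,\dots,N-1$, $a_j:\Sigma\times\Omega\to\mathbb R$ are measurable kernels, $y_j\in L^1(\Sigma)$ with $y_j\ge0$ a.e., and $(\mathcal A_jx)(s)=\int_\Omega a_j(s,t)x(t)\,dt$ defines $\mathcal A_j:L^1(\Omega)\to L^1(\Sigma)$. The system under consideration is $\mathcal A_jx=y_j$, $j=0,\dots,N-1$. The Kullback--Leibler distance of nonnegative $L^1$ functions $v,u$ (both on $\Omega$ or both on $\Sigma$) is $d(v,u)=\int\big[v\ln\frac{v}{u}-v+u\big]\in[0,\infty]$ (with the usual convention $0\ln 0=0$). Set $f_j(x)=d(y_j,\mathcal A_jx)$, i.e. $f_j(x)=\int_\Sigma\big[y_j\ln\frac{y_j}{\mathcal A_jx}-y_j+\mathcal A_jx\big]ds$. $\Delta=\{x\in L^1(\Omega): x\ge0,\ \int_\Omega x(t)\,dt=1\}$. Assumptions: (A1) $\int_\Sigma a_j(s,t)\,ds=1$ for a.e. $t\in\Omega$, $j=0,\dots,N-1$. (A2) There are positive constants $m,M$ with $m\le a_j(s,t)\le M$ a.e. in $\Sigma\times\Omega$, for all $j$. (A3) $\int_\Sigma y_j(s)\,ds=1$ for all $j$, and there is $M'>0$ with $y_j\le M'$ a.e. in $\Sigma$ for all $j$. (A4) The system $\mathcal A_jx=y_j$, $j=0,\dots,N-1$, has a nonnegative solution $x^*\in L^1(\Omega)$ which does not vanish a.e. in $\Omega$ (i.e.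 $x^*$ is not a.e. equal to zero), and $d(x^*,x_0)<\infty$. *)

theory Defs
  imports "HOL-Analysis.Analysis"
begin

text \<open>
  Elements of Lebesgue spaces are represented by functions; equalities and inequalities
  between them are always required almost everywhere only.
\<close>

text \<open>
  For nonnegative arguments the integrand \<open>v ln (v/u) - v + u\<close> is nonnegative, so the
  distance is a nonnegative Lebesgue integral with values in \<open>[0,\<infinity>]\<close>. The integrand is
  \<open>\<infinity>\<close> where \<open>u = 0 < v\<close>; where \<open>v = 0\<close> the product \<open>v * ln (v / u)\<close> is \<open>0\<close> in HOL, which is
  the convention \<open>0 ln 0 = 0\<close>.
\<close>

definition KL_integrand :: "real \<Rightarrow> real \<Rightarrow> ennreal" where
  "KL_integrand v u = (if u = 0 \<and> v > 0 then \<infinity> else ennreal (v * ln (v / u) - v + u))"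

definition KL_dist :: "'a measure \<Rightarrow> ('a \<Rightarrow> real) \<Rightarrow> ('a \<Rightarrow> real) \<Rightarrow> ennreal" where
  "KL_dist M v u = (\<integral>\<^sup>+ t. KL_integrand (v t) (u t) \<partial>M)"

definition integral_op ::
  "'a::euclidean_space set \<Rightarrow> ('a \<Rightarrow> 'a \<Rightarrow> real) \<Rightarrow> ('a \<Rightarrow> real) \<Rightarrow> 'a \<Rightarrow> real" where
  "integral_op \<Omega> a x s = (\<integral>t. a s t * x t \<partial>lebesgue_on \<Omega>)"

definition KL_residual ::
  "'a::euclidean_space set \<Rightarrow> 'a set \<Rightarrow> ('a \<Rightarrow> 'a \<Rightarrow> real) \<Rightarrow> ('a \<Rightarrow> real) \<Rightarrow> ('a \<Rightarrow> real) \<Rightarrow> ennreal"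
  where
  "KL_residual \<Omega> \<Sigma> a y x = KL_dist (lebesgue_on \<Sigma>) y (integral_op \<Omega> a x)"

definition prob_densities :: "'a::euclidean_space set \<Rightarrow> ('a \<Rightarrow> real) set" where
  "prob_densities \<Omega> = {x. integrable (lebesgue_on \<Omega>) x \<and> (AE t in lebesgue_on \<Omega>. x t \<ge> 0) \<and>
     (\<integral>t. x t \<partial>lebesgue_on \<Omega>) = 1}"

definition solves_system ::
  "'a::euclidean_space set \<Rightarrow> 'a set \<Rightarrow> nat \<Rightarrow> (nat \<Rightarrow> 'a \<Rightarrow> 'a \<Rightarrow> real) \<Rightarrow> (nat \<Rightarrow> 'a \<Rightarrow> real) \<Rightarrow>
    ('a \<Rightarrow> real) \<Rightarrow> bool" where
  "solves_system \<Omega> \<Sigma> N a y x \<longleftrightarrow> integrable (lebesgue_on \<Omega>) x \<and>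
     (\<forall>j<N. AE s in lebesgue_on \<Sigma>. integral_op \<Omega> (a j) x s = y j s)"

definition EM_step ::
  "'a::euclidean_space set \<Rightarrow> 'a set \<Rightarrow> ('a \<Rightarrow> 'a \<Rightarrow> real) \<Rightarrow> ('a \<Rightarrow> real) \<Rightarrow> ('a \<Rightarrow> real) \<Rightarrow> 'a \<Rightarrow> real"
  where
  "EM_step \<Omega> \<Sigma> a y x t = x t * (\<integral>s. a s t * y s / integral_op \<Omega> a x s \<partial>lebesgue_on \<Sigma>)"

definition Lp_space :: "real \<Rightarrow> 'a measure \<Rightarrow> ('a \<Rightarrow> real) set" where
  "Lp_space p M = {f \<in> borel_measurable M. integrable M (\<lambda>t. \<bar>f t\<bar> powr p)}"

definition Lp_norm :: "real \<Rightarrow> 'a measure \<Rightarrow> ('a \<Rightarrow> real) \<Rightarrow> real" where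
  "Lp_norm p M f = (\<integral>t. \<bar>f t\<bar> powr p \<partial>M) powr (1 / p)"

text \<open>
  Boundedness makes such a functional respect equality almost everywhere, so restricted to
  \<open>Lp_space p M\<close> these are
  exactly the elements of the dual space; their values elsewhere are irrelevant.
\<close>

definition Lp_dual :: "real \<Rightarrow> 'a measure \<Rightarrow> (('a \<Rightarrow> real) \<Rightarrow> real) set" where
  "Lp_dual p M = {\<phi>.
     (\<forall>f\<in>Lp_space p M. \<forall>g\<in>Lp_space p M. \<phi> (\<lambda>t. f t + g t) = \<phi> f + \<phi> g) \<and>
     (\<forall>c. \<forall>f\<in>Lp_space p M. \<phi> (\<lambda>t. c * f t) = c * \<phi> f) \<and>
     (\<exists>C. \<forall>f\<in>Lp_space p M. \<bar>\<phi> f\<bar> \<le> C * Lp_norm p M f)}"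

definition Lp_weakly_converges ::
  "real \<Rightarrow> 'a measure \<Rightarrow> (nat \<Rightarrow> 'a \<Rightarrow> real) \<Rightarrow> ('a \<Rightarrow> real) \<Rightarrow> bool" where
  "Lp_weakly_converges p M f g \<longleftrightarrow> (\<forall>n. f n \<in> Lp_space p M) \<and> g \<in> Lp_space p M \<and>
     (\<forall>\<phi>\<in>Lp_dual p M. (\<lambda>n. \<phi> (f n)) \<longlonglongrightarrow> \<phi> g)"

definition Lp_bounded :: "real \<Rightarrow> 'a measure \<Rightarrow> (nat \<Rightarrow> 'a \<Rightarrow> real) \<Rightarrow> bool" where
  "Lp_bounded p M f \<longleftrightarrow> (\<exists>C. \<forall>n. f n \<in> Lp_space p M \<and> Lp_norm p M (f n) \<le> C)"

end

theory Submission
  imports Defs "HOL-Library.Diagonal_Subsequence"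
begin

text \<open>
  Write \<open>x'\<close> for the result of one EM step with kernel \<open>a\<close> and data \<open>y\<close> applied to a probability
  density \<open>x\<close>; thus \<open>x' = w x\<close> with \<open>w = A\<^sup>*(y / A x)\<close>. Every quantitative statement follows from two
  inequalities, and both of these are the concavity of the logarithm:

  \<^item> \<open>f(x') + d(x', x) \<le> f(x)\<close> (lemma \<open>descent\<close>). For fixed \<open>s\<close> the function \<open>a(s, \<cdot>) x / (A x)(s)\<close> is a
    probability density in \<open>t\<close>, and the mean of \<open>w\<close> with respect to it is \<open>(A x' / A x)(s)\<close>.

  \<^item> \<open>d(x\<^sup>*, x') + f(x) \<le> d(x\<^sup>*, x)\<close> for every nonnegative solution \<open>x\<^sup>*\<close> of \<open>A x = y\<close> (lemma
    \<open>solution_descent\<close>). For fixed \<open>t\<close> the function \<open>a(\<cdot>, t)\<close> is a probability density in \<open>s\<close>, and the mean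
    of \<open>y / A x\<close> with respect to it is \<open>w(t)\<close>.

  The first inequality shows that a step does not increase its own residual. For a common solution
  \<open>x\<^sup>*\<close> the second shows that the distance to \<open>x\<^sup>*\<close> decreases and, after telescoping, that the residuals
  \<open>f\<^bsub>[k]\<^esub>(x\<^sub>k)\<close> are summable, so they tend to \<open>0\<close>; by the first inequality so does \<open>d(x\<^bsub>k+1\<^esub>, x\<^sub>k)\<close>.

  The Kullback--Leibler integrand dominates \<open>(\<surd>v - \<surd>u)\<^sup>2\<close>. Since data and images are bounded, vanishing
  residuals give convergence of the images in \<open>L\<^sup>2\<close>, and then in every \<open>L\<^sup>p\<close>; and vanishing
  distances \<open>d(x\<^bsub>k+1\<^esub>, x\<^sub>k)\<close> give \<open>x\<^bsub>k+1\<^esub> - x\<^sub>k \<rightarrow> 0\<close> in \<open>L\<^sup>1\<close>. The latter links the \<open>N\<close> equations: along the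
  full cycles \<open>k = l N\<close> all the images \<open>A\<^sub>j x\<^sub>k\<close>, not only the one with \<open>j = 0\<close>, converge to \<open>y\<^sub>j\<close>. If the
  iterates are bounded in \<open>L\<^sup>p\<close>, some subsequence of \<open>x\<^bsub>l N\<^esub>\<close> converges weakly. Sections of the kernels
  are bounded functions, so the images converge pointwise along that subsequence, and its limit solves
  the system.

  Weak sequential compactness is derived from the Radon--Nikodym theorem. It represents the
  functionals on \<open>L\<^sup>p\<close> by functions in \<open>L\<^sup>q\<close> (lemma \<open>Lp_dual_representation\<close>), and it turns the limits
  of the integrals over measurable sets, which exist along a diagonal subsequence, into the weak limit
  (lemma \<open>Lp_weakly_convergent_subsequence\<close>).

  The given kernels are measurable for the completed product measure only, so Fubini's theorem does
  not apply to them directly. Borel kernels with values in \<open>[m, M]\<close> everywhere take their place; the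
  operators and the iteration change on null sets only.
\<close>

section \<open>Densities of additive set functions\<close>

text \<open>
  Absolute continuity in the \<open>\<epsilon>\<close>-\<open>\<delta>\<close> form makes up for the missing countable additivity: it gives
  continuity at the empty set, hence a measure, to which the Radon--Nikodym theorem applies.
\<close>

lemma (in finite_measure) density_of_nonneg_additive:
  fixes \<nu> :: "'a set \<Rightarrow> real"
  assumes nonneg: "\<And>A. A \<in> sets M \<Longrightarrow> \<nu> A \<ge> 0"
    and add: "\<And>A B. A \<in> sets M \<Longrightarrow> B \<in> sets M \<Longrightarrow> A \<inter> B = {} \<Longrightarrow> \<nu> (A \<union> B) = \<nu> A + \<nu> B"
    and ac: "\<And>e. e > 0 \<Longrightarrow> \<exists>d>0. \<forall>A\<in>sets M. measure M A < d \<longrightarrow> \<nu> A \<le> e"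
  shows "\<exists>g. integrable M g \<and> (\<forall>A\<in>sets M. \<nu> A = (\<integral>t. indicator A t * g t \<partial>M))"
proof -
  have null: "\<nu> {} = 0"
    using add[of "{}" "{}"] by simp
  have "countably_additive (sets M) (\<lambda>A. ennreal (\<nu> A))"
  proof (rule sets.empty_continuous_imp_countably_additive)
    show "positive (sets M) (\<lambda>A. ennreal (\<nu> A))"
      by (simp add: positive_def null)
    show "additive (sets M) (\<lambda>A. ennreal (\<nu> A))"
      by (auto simp: additive_def add nonneg)
    fix A :: "nat \<Rightarrow> 'a set"
    assume A: "range A \<subseteq> sets M" "decseq A" "(\<Inter>i. A i) = {}"
    have mA: "(\<lambda>i. measure M (A i)) \<longlonglongrightarrow> 0"
      using finite_Lim_measure_decseq[OF A(1,2)] A(3) by simp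
    have "(\<lambda>i. \<nu> (A i)) \<longlonglongrightarrow> 0"
    proof (rule tendstoI)
      fix e :: real assume "e > 0"
      then obtain d where d: "d > 0" "\<And>A. A \<in> sets M \<Longrightarrow> measure M A < d \<Longrightarrow> \<nu> A \<le> e/2"
        using ac[of "e/2"] by auto
      have "eventually (\<lambda>i. measure M (A i) < d) sequentially"
        using order_tendstoD(2)[OF mA d(1)] .
      then show "eventually (\<lambda>i. dist (\<nu> (A i)) 0 < e) sequentially"
      proof eventually_elim
        case (elim i)
        have "A i \<in> sets M" using A(1) by auto
        with d(2)[OF this elim] nonneg[OF this] \<open>e > 0\<close> show ?case by simp
      qed
    qed
    then show "(\<lambda>i. ennreal (\<nu> (A i))) \<longlonglongrightarrow> 0"
      using tendsto_ennrealI by fastforce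
  qed simp
  moreover define N where "N = measure_of (space M) (sets M) (\<lambda>A. ennreal (\<nu> A))"
  ultimately have N: "emeasure N A = ennreal (\<nu> A)" if "A \<in> sets M" for A
    unfolding N_def
    by (intro emeasure_measure_of_sigma that sets.sigma_algebra_axioms)
       (auto simp: positive_def null)
  have sN: "sets N = sets M" unfolding N_def by simp
  have "absolutely_continuous M N"
    unfolding absolutely_continuous_def
  proof
    fix A assume A: "A \<in> null_sets M"
    then have "A \<in> sets M" "measure M A = 0" by (auto simp: measure_def)
    have "\<nu> A \<le> 0"
    proof (rule field_le_epsilon)
      fix e :: real assume "e > 0"
      from ac[OF this] \<open>A \<in> sets M\<close> \<open>measure M A = 0\<close> show "\<nu> A \<le> 0 + e" by auto
    qed
    then show "A \<in> null_sets N"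
      using N[OF \<open>A \<in> sets M\<close>] \<open>A \<in> sets M\<close> sN by (auto simp: null_sets_def ennreal_neg)
  qed
  from Radon_Nikodym[OF this sN] obtain f where f[measurable]: "f \<in> borel_measurable M"
    and dens: "density M f = N" by auto
  have int_f: "(\<integral>\<^sup>+t. f t * indicator A t \<partial>M) = ennreal (\<nu> A)" if "A \<in> sets M" for A
    using N[OF that] emeasure_density[OF f that] by (simp add: dens)
  have "(\<integral>\<^sup>+t. f t \<partial>M) = (\<integral>\<^sup>+t. f t * indicator (space M) t \<partial>M)"
    by (intro nn_integral_cong) auto
  then have fin: "(\<integral>\<^sup>+t. f t \<partial>M) \<noteq> \<infinity>"
    by (simp only: int_f[OF sets.top]) simp
  then have fin_AE: "AE t in M. f t \<noteq> \<infinity>"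
    using nn_integral_PInf_AE[OF f] by simp
  define g where "g t = enn2real (f t)" for t
  have g[measurable]: "g \<in> borel_measurable M" unfolding g_def by measurable
  have gf: "AE t in M. ennreal (g t) = f t"
    using fin_AE by eventually_elim (simp add: g_def top.not_eq_extremum)
  have "integrable M g"
  proof (rule integrableI_nonneg)
    have "(\<integral>\<^sup>+t. ennreal (g t) \<partial>M) = (\<integral>\<^sup>+t. f t \<partial>M)"
      using gf by (rule nn_integral_cong_AE)
    then show "(\<integral>\<^sup>+t. ennreal (g t) \<partial>M) < \<infinity>" using fin by (simp add: top.not_eq_extremum)
  qed (auto simp: g_def)
  moreover have "\<nu> A = (\<integral>t. indicator A t * g t \<partial>M)" if [measurable]: "A \<in> sets M" for A
  proof -
    have "(\<integral>\<^sup>+t. ennreal (indicator A t * g t) \<partial>M) = (\<integral>\<^sup>+t. f t * indicator A t \<partial>M)"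
      using gf by (intro nn_integral_cong_AE, eventually_elim) (auto split: split_indicator)
    then show ?thesis
      using int_f[OF that] nonneg[OF that]
      by (subst integral_eq_nn_integral) (auto simp: g_def)
  qed
  ultimately show ?thesis by blast
qed

text \<open>
  The Jordan decomposition. The positive part of \<open>\<nu>\<close> at \<open>A\<close> is the supremum of \<open>\<nu>\<close> over the measurable
  subsets of \<open>A\<close>; it is additive again and inherits absolute continuity.
\<close>

lemma (in finite_measure) density_of_additive:
  fixes \<nu> :: "'a set \<Rightarrow> real"
  assumes bdd: "\<And>A. A \<in> sets M \<Longrightarrow> \<bar>\<nu> A\<bar> \<le> C"
    and add: "\<And>A B. A \<in> sets M \<Longrightarrow> B \<in> sets M \<Longrightarrow> A \<inter> B = {} \<Longrightarrow> \<nu> (A \<union> B) = \<nu> A + \<nu> B"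
    and ac: "\<And>e. e > 0 \<Longrightarrow> \<exists>d>0. \<forall>A\<in>sets M. measure M A < d \<longrightarrow> \<bar>\<nu> A\<bar> \<le> e"
  shows "\<exists>g. integrable M g \<and> (\<forall>A\<in>sets M. \<nu> A = (\<integral>t. indicator A t * g t \<partial>M))"
proof -
  define P where "P A = (SUP B\<in>{B\<in>sets M. B \<subseteq> A}. \<nu> B)" for A
  have null: "\<nu> {} = 0"
    using add[of "{}" "{}"] by simp
  have bd: "bdd_above (\<nu> ` {B\<in>sets M. B \<subseteq> A})" for A
    using bdd by (intro bdd_aboveI[of _ C]) (auto simp: abs_le_iff)
  have upper: "\<nu> B \<le> P A" if "B \<in> sets M" "B \<subseteq> A" for A B
    unfolding P_def using that by (intro cSUP_upper bd) auto
  have least: "P A \<le> c" if "\<And>B. B \<in> sets M \<Longrightarrow> B \<subseteq> A \<Longrightarrow> \<nu> B \<le> c" for A c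
    unfolding P_def using that by (intro cSUP_least) auto
  have P0: "0 \<le> P A" for A
    using upper[of "{}" A] null by simp
  have P_add: "P (A \<union> A') = P A + P A'"
    if A: "A \<in> sets M" "A' \<in> sets M" "A \<inter> A' = {}" for A A'
  proof (rule antisym)
    show "P (A \<union> A') \<le> P A + P A'"
    proof (rule least)
      fix B assume B: "B \<in> sets M" "B \<subseteq> A \<union> A'"
      then have "\<nu> B = \<nu> ((B \<inter> A) \<union> (B \<inter> A'))" by (intro arg_cong[of _ _ \<nu>]) auto
      also have "\<dots> = \<nu> (B \<inter> A) + \<nu> (B \<inter> A')" using A B by (intro add) auto
      also have "\<dots> \<le> P A + P A'" using A B by (intro add_mono upper) auto
      finally show "\<nu> B \<le> P A + P A'" .
    qed
    have *: "\<nu> B + \<nu> B' \<le> P (A \<union> A')"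
      if "B \<in> sets M" "B \<subseteq> A" "B' \<in> sets M" "B' \<subseteq> A'" for B B'
      using add[of B B'] upper[of "B \<union> B'" "A \<union> A'"] that A(3) by fastforce
    have "P A \<le> P (A \<union> A') - P A'"
    proof (rule least)
      fix B assume B: "B \<in> sets M" "B \<subseteq> A"
      have "P A' \<le> P (A \<union> A') - \<nu> B"
        by (rule least) (use *[OF B] in \<open>simp add: algebra_simps\<close>)
      then show "\<nu> B \<le> P (A \<union> A') - P A'" by simp
    qed
    then show "P A + P A' \<le> P (A \<union> A')" by simp
  qed
  have P_ac: "\<exists>d>0. \<forall>A\<in>sets M. measure M A < d \<longrightarrow> P A \<le> e" if e: "e > 0" for e
  proof -
    obtain d where d: "d > 0" "\<And>A. A \<in> sets M \<Longrightarrow> measure M A < d \<Longrightarrow> \<bar>\<nu> A\<bar> \<le> e"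
      using ac[OF e] by auto
    have "P A \<le> e" if "A \<in> sets M" "measure M A < d" for A
    proof (rule least)
      fix B assume B: "B \<in> sets M" "B \<subseteq> A"
      have "measure M B < d" using finite_measure_mono[OF B(2) that(1)] that(2) by simp
      from d(2)[OF B(1) this] show "\<nu> B \<le> e" by simp
    qed
    with d(1) show ?thesis by blast
  qed
  obtain g1 where g1: "integrable M g1" "\<And>A. A \<in> sets M \<Longrightarrow> P A = (\<integral>t. indicator A t * g1 t \<partial>M)"
    using density_of_nonneg_additive[of P, OF P0 P_add P_ac] by metis
  have "\<exists>d>0. \<forall>A\<in>sets M. measure M A < d \<longrightarrow> P A - \<nu> A \<le> e" if e: "e > 0" for e
  proof -
    obtain d where d: "d > 0" "\<And>A. A \<in> sets M \<Longrightarrow> measure M A < d \<Longrightarrow> \<bar>\<nu> A\<bar> \<le> e/2"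
      using ac[of "e/2"] e by auto
    obtain d' where d': "d' > 0" "\<And>A. A \<in> sets M \<Longrightarrow> measure M A < d' \<Longrightarrow> P A \<le> e/2"
      using P_ac[of "e/2"] e by auto
    have "P A - \<nu> A \<le> e" if "A \<in> sets M" "measure M A < min d d'" for A
      using d(2)[of A] d'(2)[of A] that by linarith
    with d(1) d'(1) show ?thesis by (intro exI[of _ "min d d'"]) auto
  qed
  note Q_ac = this
  have Q0: "0 \<le> P A - \<nu> A" if "A \<in> sets M" for A
    using upper[OF that order_refl] by simp
  have Q_add: "P (A \<union> A') - \<nu> (A \<union> A') = (P A - \<nu> A) + (P A' - \<nu> A')"
    if "A \<in> sets M" "A' \<in> sets M" "A \<inter> A' = {}" for A A'
    using P_add[OF that] add[OF that] by simp
  obtain g2 where g2: "integrable M g2"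
    "\<And>A. A \<in> sets M \<Longrightarrow> P A - \<nu> A = (\<integral>t. indicator A t * g2 t \<partial>M)"
    using density_of_nonneg_additive[of "\<lambda>A. P A - \<nu> A", OF Q0 Q_add Q_ac] by metis
  have "\<nu> A = (\<integral>t. indicator A t * (g1 t - g2 t) \<partial>M)" if A: "A \<in> sets M" for A
    using g1(2)[OF A] g2(2)[OF A] integrable_mult_indicator[OF A g1(1)]
      integrable_mult_indicator[OF A g2(1)]
    by (simp add: algebra_simps)
  with g1(1) g2(1) show ?thesis by (intro exI[of _ "\<lambda>t. g1 t - g2 t"]) auto
qed

section \<open>Lebesgue spaces on finite measure spaces and their duals\<close>

lemma Lp_spaceI_bounded:
  assumes "finite_measure M" "f \<in> borel_measurable M" "AE t in M. \<bar>f t\<bar> \<le> K" "p \<ge> 0"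
  shows "f \<in> Lp_space p M"
  unfolding Lp_space_def
proof safe
  show "integrable M (\<lambda>t. \<bar>f t\<bar> powr p)"
    using assms(1)
  proof (rule finite_measure.integrable_const_bound[of _ _ "K powr p"])
    show "AE t in M. norm (\<bar>f t\<bar> powr p) \<le> K powr p"
      using assms(3) by eventually_elim (auto intro: powr_mono2 assms(4))
  qed (use assms(2) in measurable)
qed (use assms in auto)

lemma Lp_space_dominated:
  assumes "f \<in> Lp_space p M" "h \<in> borel_measurable M" "AE t in M. \<bar>h t\<bar> \<le> c * \<bar>f t\<bar>"
    "c \<ge> 0" "p \<ge> 0"
  shows "h \<in> Lp_space p M"
  unfolding Lp_space_def
proof safe
  have "integrable M (\<lambda>t. c powr p * \<bar>f t\<bar> powr p)"
    using assms(1) by (auto simp: Lp_space_def)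
  then show "integrable M (\<lambda>t. \<bar>h t\<bar> powr p)"
  proof (rule Bochner_Integration.integrable_bound)
    show "AE t in M. norm (\<bar>h t\<bar> powr p) \<le> norm (c powr p * \<bar>f t\<bar> powr p)"
      using assms(3)
      by eventually_elim (auto simp: powr_mult[symmetric] assms intro: powr_mono2)
  qed (use assms(2) in measurable)
qed (use assms in auto)

lemma Lp_space_scale:
  assumes "f \<in> Lp_space p M" "p \<ge> 0"
  shows "(\<lambda>t. c * f t) \<in> Lp_space p M"
  by (rule Lp_space_dominated[OF assms(1), of _ "\<bar>c\<bar>"])
     (use assms in \<open>auto simp: Lp_space_def abs_mult\<close>)

lemma Lp_space_add:
  assumes f: "f \<in> Lp_space p M" and g: "g \<in> Lp_space p M" and "p \<ge> 0"
  shows "(\<lambda>t. f t + g t) \<in> Lp_space p M"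
proof -
  have [measurable]: "f \<in> borel_measurable M" "g \<in> borel_measurable M"
    using f g by (auto simp: Lp_space_def)
  have "integrable M (\<lambda>t. \<bar>f t + g t\<bar> powr p)"
  proof (rule Bochner_Integration.integrable_bound)
    show "integrable M (\<lambda>t. 2 powr p * (\<bar>f t\<bar> powr p + \<bar>g t\<bar> powr p))"
      using f g by (auto simp: Lp_space_def)
    show "AE t in M. norm (\<bar>f t + g t\<bar> powr p) \<le> norm (2 powr p * (\<bar>f t\<bar> powr p + \<bar>g t\<bar> powr p))"
    proof (rule AE_I2)
      fix t
      have "\<bar>f t + g t\<bar> powr p \<le> (2 * max \<bar>f t\<bar> \<bar>g t\<bar>) powr p"
        using \<open>p \<ge> 0\<close> by (intro powr_mono2) auto
      also have "\<dots> = 2 powr p * max \<bar>f t\<bar> \<bar>g t\<bar> powr p"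
        by (simp add: powr_mult)
      also have "\<dots> \<le> 2 powr p * (\<bar>f t\<bar> powr p + \<bar>g t\<bar> powr p)"
        by (intro mult_left_mono) (auto simp: max_def)
      finally show "norm (\<bar>f t + g t\<bar> powr p) \<le> norm (2 powr p * (\<bar>f t\<bar> powr p + \<bar>g t\<bar> powr p))"
        by simp
    qed
  qed measurable
  then show ?thesis by (auto simp: Lp_space_def)
qed

lemma Lp_space_sum:
  assumes "finite I" "\<And>i. i \<in> I \<Longrightarrow> f i \<in> Lp_space p M" "p \<ge> 0"
  shows "(\<lambda>t. \<Sum>i\<in>I. f i t) \<in> Lp_space p M"
  using assms
proof (induction I rule: finite_induct)
  case empty
  then show ?case by (simp add: Lp_space_def)
next
  case (insert i I)
  then show ?case by (simp add: Lp_space_add)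
qed

context
  fixes \<phi> :: "('a \<Rightarrow> real) \<Rightarrow> real" and M :: "'a measure" and p :: real
  assumes dual: "\<phi> \<in> Lp_dual p M" and p: "p \<ge> 1"
begin

lemma dual_add: "f \<in> Lp_space p M \<Longrightarrow> g \<in> Lp_space p M \<Longrightarrow> \<phi> (\<lambda>t. f t + g t) = \<phi> f + \<phi> g"
  and dual_scale: "f \<in> Lp_space p M \<Longrightarrow> \<phi> (\<lambda>t. c * f t) = c * \<phi> f"
  using dual by (auto simp: Lp_dual_def)

lemma dual_bound:
  "\<exists>C\<ge>0. \<forall>f\<in>Lp_space p M. \<bar>\<phi> f\<bar> \<le> C * (\<integral>t. \<bar>f t\<bar> powr p \<partial>M) powr (1/p)"
proof -
  obtain C where C: "\<And>f. f \<in> Lp_space p M \<Longrightarrow> \<bar>\<phi> f\<bar> \<le> C * Lp_norm p M f"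
    using dual unfolding Lp_dual_def by blast
  have "\<bar>\<phi> f\<bar> \<le> max 0 C * (\<integral>t. \<bar>f t\<bar> powr p \<partial>M) powr (1/p)" if "f \<in> Lp_space p M" for f
  proof -
    have "\<bar>\<phi> f\<bar> \<le> C * Lp_norm p M f" using that by (rule C)
    also have "\<dots> \<le> max 0 C * Lp_norm p M f"
      by (intro mult_right_mono) (auto simp: Lp_norm_def)
    finally show ?thesis by (simp add: Lp_norm_def)
  qed
  then show ?thesis by (intro exI[of _ "max 0 C"]) auto
qed

lemma dual_diff:
  assumes "f \<in> Lp_space p M" "g \<in> Lp_space p M"
  shows "\<phi> (\<lambda>t. f t - g t) = \<phi> f - \<phi> g"
  using dual_add[OF assms(1) Lp_space_scale[OF assms(2), of "-1"]] dual_scale[OF assms(2), of "-1"] p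
  by simp

lemma dual_sum:
  assumes "finite I" "\<And>i. i \<in> I \<Longrightarrow> f i \<in> Lp_space p M"
  shows "\<phi> (\<lambda>t. \<Sum>i\<in>I. c i * f i t) = (\<Sum>i\<in>I. c i * \<phi> (f i))"
  using assms
proof (induction I rule: finite_induct)
  case empty
  have "(\<lambda>t. 0) \<in> Lp_space p M" by (simp add: Lp_space_def)
  from dual_scale[OF this, of 0] show ?case by simp
next
  case (insert i I)
  then show ?case
    using p by (simp add: dual_add dual_scale Lp_space_scale Lp_space_sum)
qed

lemma dual_cong_AE:
  assumes "f \<in> Lp_space p M" "g \<in> Lp_space p M" "AE t in M. f t = g t"
  shows "\<phi> f = \<phi> g"
proof -
  obtain C where C: "C \<ge> 0"
    "\<And>f. f \<in> Lp_space p M \<Longrightarrow> \<bar>\<phi> f\<bar> \<le> C * (\<integral>t. \<bar>f t\<bar> powr p \<partial>M) powr (1/p)"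
    using dual_bound by blast
  have "(\<lambda>t. f t - g t) \<in> Lp_space p M"
    using Lp_space_add[OF assms(1) Lp_space_scale[OF assms(2), of "-1"]] p by simp
  moreover have "(\<integral>t. \<bar>f t - g t\<bar> powr p \<partial>M) = 0"
    using assms(3) by (intro integral_eq_zero_AE) (auto elim!: eventually_mono)
  ultimately have "\<bar>\<phi> (\<lambda>t. f t - g t)\<bar> \<le> 0"
    using C(2)[of "\<lambda>t. f t - g t"] by simp
  then show ?thesis using dual_diff[OF assms(1,2)] by simp
qed

text \<open>
  Dominated convergence in \<open>L\<^sup>p\<close>: the differences are dominated by \<open>3 \<bar>f\<bar>\<close>.
\<close>

lemma dual_tendsto:
  assumes s: "\<And>n. s n \<in> Lp_space p M" and f: "f \<in> Lp_space p M"
    and lim: "AE t in M. (\<lambda>n. s n t) \<longlonglongrightarrow> f t"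
    and bound: "\<And>n. AE t in M. \<bar>s n t\<bar> \<le> 2 * \<bar>f t\<bar>"
  shows "(\<lambda>n. \<phi> (s n)) \<longlonglongrightarrow> \<phi> f"
proof -
  obtain C where C: "C \<ge> 0"
    "\<And>f. f \<in> Lp_space p M \<Longrightarrow> \<bar>\<phi> f\<bar> \<le> C * (\<integral>t. \<bar>f t\<bar> powr p \<partial>M) powr (1/p)"
    using dual_bound by blast
  have [measurable]: "f \<in> borel_measurable M" "\<And>n. s n \<in> borel_measurable M"
    using s f by (auto simp: Lp_space_def)
  have diff: "(\<lambda>t. s n t - f t) \<in> Lp_space p M" for n
    using Lp_space_add[OF s[of n] Lp_space_scale[OF f, of "-1"]] p by simp
  have "(\<lambda>n. \<integral>t. \<bar>s n t - f t\<bar> powr p \<partial>M) \<longlonglongrightarrow> (\<integral>t. 0 \<partial>M)"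
  proof (rule integral_dominated_convergence)
    show "integrable M (\<lambda>t. 3 powr p * \<bar>f t\<bar> powr p)"
      using f by (auto simp: Lp_space_def)
    show "AE t in M. (\<lambda>n. \<bar>s n t - f t\<bar> powr p) \<longlonglongrightarrow> 0"
      using lim
    proof eventually_elim
      case (elim t)
      then have "(\<lambda>n. \<bar>s n t - f t\<bar>) \<longlonglongrightarrow> 0"
        by (simp add: LIM_zero_iff tendsto_rabs_zero)
      from tendsto_powr'[OF this tendsto_const[of p]] p show ?case by simp
    qed
    show "AE t in M. norm (\<bar>s n t - f t\<bar> powr p) \<le> 3 powr p * \<bar>f t\<bar> powr p" for n
      using bound[of n]
    proof eventually_elim
      case (elim t)
      then have "\<bar>s n t - f t\<bar> powr p \<le> (3 * \<bar>f t\<bar>) powr p"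
        using p by (intro powr_mono2) auto
      then show ?case by (simp add: powr_mult)
    qed
  qed measurable
  then have "(\<lambda>n. \<integral>t. \<bar>s n t - f t\<bar> powr p \<partial>M) \<longlonglongrightarrow> 0" by simp
  from tendsto_powr'[OF this tendsto_const[of "1/p"]] p
  have "(\<lambda>n. (\<integral>t. \<bar>s n t - f t\<bar> powr p \<partial>M) powr (1/p)) \<longlonglongrightarrow> 0" by simp
  then have "(\<lambda>n. C * (\<integral>t. \<bar>s n t - f t\<bar> powr p \<partial>M) powr (1/p)) \<longlonglongrightarrow> 0"
    using tendsto_mult_right_zero by blast
  then have "(\<lambda>n. \<phi> (\<lambda>t. s n t - f t)) \<longlonglongrightarrow> 0"
    by (rule Lim_null_comparison[rotated]) (use C(2)[OF diff] in auto)
  then show ?thesis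
    by (simp add: dual_diff[OF s f] LIM_zero_iff)
qed

text \<open>
  The identity extends from indicators to simple functions by linearity, and to \<open>f\<close> because simple
  functions dominated by \<open>2 \<bar>f\<bar>\<close> converge to \<open>f\<close> both for \<open>\<phi>\<close> and under the integral.
\<close>

lemma dual_eq_integral:
  assumes fin: "finite_measure M" and g: "integrable M g"
    and rep: "\<And>A. A \<in> sets M \<Longrightarrow> \<phi> (indicator A) = (\<integral>t. indicator A t * g t \<partial>M)"
    and f: "f \<in> Lp_space p M" and fg: "integrable M (\<lambda>t. f t * g t)"
  shows "\<phi> f = (\<integral>t. f t * g t \<partial>M)"
proof -
  interpret finite_measure M by fact
  have [measurable]: "f \<in> borel_measurable M" "g \<in> borel_measurable M"
    using f g by (auto simp: Lp_space_def)
  obtain s where "\<forall>i. simple_function M (s i)"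
    "\<forall>t\<in>space M. (\<lambda>i. s i t) \<longlonglongrightarrow> f t"
    "\<forall>i. \<forall>t\<in>space M. dist (s i t) 0 \<le> 2 * dist (f t) 0"
    using borel_measurable_implies_sequence_metric[of f M 0] by auto
  then have s: "\<And>i. simple_function M (s i)"
    "\<And>t. t \<in> space M \<Longrightarrow> (\<lambda>i. s i t) \<longlonglongrightarrow> f t"
    "\<And>i t. t \<in> space M \<Longrightarrow> \<bar>s i t\<bar> \<le> 2 * \<bar>f t\<bar>"
    by (auto simp: dist_real_def)
  have [measurable]: "s i \<in> borel_measurable M" for i
    using s(1) by (rule borel_measurable_simple_function)
  have sLp: "s i \<in> Lp_space p M" for i
    by (rule Lp_space_dominated[OF f, of _ 2]) (use s(3) p in auto)
  have indLp: "indicator A \<in> Lp_space p M" if "A \<in> sets M" for A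
    by (rule Lp_spaceI_bounded[of _ _ 1]) (use that p in \<open>auto split: split_indicator intro: finite_measure_axioms\<close>)
  have ind_int: "integrable M (\<lambda>t. indicator A t * g t)" if "A \<in> sets M" for A
    using integrable_mult_indicator[OF that g] by simp
  have simple: "\<phi> (s i) = (\<integral>t. s i t * g t \<partial>M)" for i
  proof -
    let ?V = "s i ` space M" and ?E = "\<lambda>c. s i -` {c} \<inter> space M"
    have V: "finite ?V" using s(1)[of i] by (simp add: simple_function_def)
    have E: "?E c \<in> sets M" for c by measurable
    have eq: "s i t = (\<Sum>c\<in>?V. c * indicator (?E c) t)" if "t \<in> space M" for t
    proof -
      have "(\<Sum>c\<in>?V. c * indicator (?E c) t) = (\<Sum>c\<in>{s i t}. c * indicator (?E c) t)"
        using V that by (intro sum.mono_neutral_right) (auto split: split_indicator)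
      then show ?thesis using that by simp
    qed
    have "\<phi> (s i) = \<phi> (\<lambda>t. \<Sum>c\<in>?V. c * indicator (?E c) t)"
    proof (rule dual_cong_AE[OF sLp])
      show "(\<lambda>t. \<Sum>c\<in>?V. c * indicator (?E c) t) \<in> Lp_space p M"
        using p by (intro Lp_space_sum V Lp_space_scale indLp E) auto
      show "AE t in M. s i t = (\<Sum>c\<in>?V. c * indicator (?E c) t)"
        by (rule AE_I2) (rule eq)
    qed
    also have "\<dots> = (\<Sum>c\<in>?V. c * \<phi> (indicator (?E c)))"
      using dual_sum[of ?V "\<lambda>c. indicator (?E c)" "\<lambda>c. c"] V indLp E by simp
    also have "\<dots> = (\<Sum>c\<in>?V. \<integral>t. c * (indicator (?E c) t * g t) \<partial>M)"
      using rep[OF E] by simp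
    also have "\<dots> = (\<integral>t. (\<Sum>c\<in>?V. c * (indicator (?E c) t * g t)) \<partial>M)"
      by (intro Bochner_Integration.integral_sum[symmetric] integrable_mult_right ind_int E)
    also have "\<dots> = (\<integral>t. s i t * g t \<partial>M)"
      by (intro Bochner_Integration.integral_cong refl)
         (subst eq, auto simp: sum_distrib_right mult.assoc)
    finally show ?thesis .
  qed
  have "(\<lambda>i. \<integral>t. s i t * g t \<partial>M) \<longlonglongrightarrow> (\<integral>t. f t * g t \<partial>M)"
  proof (rule integral_dominated_convergence)
    show "integrable M (\<lambda>t. 2 * norm (f t * g t))" using fg by auto
    show "AE t in M. norm (s i t * g t) \<le> 2 * norm (f t * g t)" for i
      using mult_right_mono[OF s(3) abs_ge_zero] by (intro AE_I2) (simp add: abs_mult mult.assoc)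
  qed (use s(2) in \<open>auto intro!: tendsto_mult_right\<close>)
  moreover have "(\<lambda>i. \<phi> (s i)) \<longlonglongrightarrow> \<phi> f"
    by (rule dual_tendsto[OF sLp f]) (use s in auto)
  ultimately show ?thesis
    using LIMSEQ_unique simple by auto
qed

end

lemma abs_integral_le:
  fixes f g :: "'a \<Rightarrow> real"
  assumes "integrable M f" "integrable M g" "\<And>t. t \<in> space M \<Longrightarrow> \<bar>f t\<bar> \<le> g t"
  shows "\<bar>\<integral>t. f t \<partial>M\<bar> \<le> (\<integral>t. g t \<partial>M)"
proof -
  have "\<bar>\<integral>t. f t \<partial>M\<bar> \<le> (\<integral>t. \<bar>f t\<bar> \<partial>M)" by (rule integral_abs_bound)
  also have "\<dots> \<le> (\<integral>t. g t \<partial>M)" using assms by (intro integral_mono) auto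
  finally show ?thesis .
qed

text \<open>
  A coarse form of Young's inequality. Applied pointwise and after rescaling the factors it does the
  work of Hoelder's inequality below.
\<close>

lemma powr_product_le_add:
  fixes x y :: real
  assumes "x \<ge> 0" "y \<ge> 0" "p > 1"
  shows "x * y \<le> x powr p + y powr (p / (p - 1))"
proof -
  define q where "q = p / (p - 1)"
  have q: "q > 1" "1 / p + 1 / q = 1"
    using assms(3) by (auto simp: q_def field_simps)
  have "x * y \<le> x powr p / p + y powr q / q"
    using assms q by (intro Youngs_inequality)
  also have "\<dots> \<le> x powr p + y powr q"
    using assms(3) q(1) by (intro add_mono) (simp_all add: divide_le_eq mult_le_cancel_left1)
  finally show ?thesis by (simp add: q_def)
qed

lemma integrable_mult_Lp:
  assumes f: "f \<in> Lp_space p M" and g: "g \<in> Lp_space (p / (p - 1)) M" and p: "p > 1"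
  shows "integrable M (\<lambda>t. f t * g t)"
proof (rule Bochner_Integration.integrable_bound)
  show "integrable M (\<lambda>t. \<bar>f t\<bar> powr p + \<bar>g t\<bar> powr (p / (p - 1)))"
    using f g by (auto simp: Lp_space_def)
  show "(\<lambda>t. f t * g t) \<in> borel_measurable M"
    using f g by (auto simp: Lp_space_def)
  show "AE t in M. norm (f t * g t) \<le> norm (\<bar>f t\<bar> powr p + \<bar>g t\<bar> powr (p / (p - 1)))"
    using powr_product_le_add[OF abs_ge_zero abs_ge_zero p]
    by (intro AE_I2) (simp add: abs_mult)
qed

text \<open>
  Monotone convergence of the truncated powers.
\<close>

lemma (in finite_measure) Lp_spaceI_truncated:
  fixes g :: "'a \<Rightarrow> real"
  assumes [measurable]: "g \<in> borel_measurable M" and p: "p > 0"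
    and le: "\<And>n::nat. (\<integral>t. (if \<bar>g t\<bar> \<le> real n then 1 else 0) * \<bar>g t\<bar> powr p \<partial>M) \<le> B"
  shows "g \<in> Lp_space p M"
proof -
  define E where "E n t = (if \<bar>g t\<bar> \<le> real n then 1 else 0::real)" for n t
  have [measurable]: "E n \<in> borel_measurable M" for n unfolding E_def by measurable
  define I where "I n = (\<integral>t. E n t * \<bar>g t\<bar> powr p \<partial>M)" for n
  have int_I: "integrable M (\<lambda>t. E n t * \<bar>g t\<bar> powr p)" for n
  proof (rule integrable_const_bound[of _ "real n powr p"])
    show "AE t in M. norm (E n t * \<bar>g t\<bar> powr p) \<le> real n powr p"
      using p by (intro AE_I2) (auto simp: E_def intro: powr_mono2)
  qed measurable
  have "incseq I"
    unfolding I_def incseq_def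
    by (intro allI impI integral_mono int_I) (auto simp: E_def)
  moreover have "\<forall>n. I n \<le> B" using le by (simp add: I_def E_def)
  ultimately obtain L where L: "I \<longlonglongrightarrow> L"
    using incseq_convergent[of I B] by metis
  have "integrable M (\<lambda>t. \<bar>g t\<bar> powr p)"
  proof (rule integrable_monotone_convergence[of _ "\<lambda>n t. E n t * \<bar>g t\<bar> powr p", OF int_I])
    show "AE t in M. mono (\<lambda>n. E n t * \<bar>g t\<bar> powr p)"
      by (intro AE_I2 monoI mult_right_mono) (auto simp: E_def)
    show "AE t in M. (\<lambda>n. E n t * \<bar>g t\<bar> powr p) \<longlonglongrightarrow> \<bar>g t\<bar> powr p"
    proof (rule AE_I2)
      fix t
      have "eventually (\<lambda>n. \<bar>g t\<bar> \<le> real n) sequentially"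
        using filterlim_real_sequentially by (simp add: filterlim_at_top)
      then have "eventually (\<lambda>n. E n t * \<bar>g t\<bar> powr p = \<bar>g t\<bar> powr p) sequentially"
        by eventually_elim (simp add: E_def)
      then show "(\<lambda>n. E n t * \<bar>g t\<bar> powr p) \<longlonglongrightarrow> \<bar>g t\<bar> powr p" by (rule tendsto_eventually)
    qed
    show "(\<lambda>n. \<integral>t. E n t * \<bar>g t\<bar> powr p \<partial>M) \<longlonglongrightarrow> L" using L by (simp add: I_def[abs_def])
  qed measurable
  then show ?thesis by (simp add: Lp_space_def)
qed

text \<open>
  The Riesz representation of the dual of \<open>L\<^sup>p\<close>. The set function \<open>\<phi>(1\<^sub>A)\<close> is absolutely continuous
  because \<open>\<phi>\<close> is bounded, so it has a density \<open>g\<close>. Testing \<open>\<phi>\<close> with truncations of \<open>sgn g \<bar>g\<bar>\<^sup>q\<^sup>-\<^sup>1\<close> bounds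
  the \<open>q\<close>-th moment of \<open>g\<close>.
\<close>

lemma Lp_dual_representation:
  assumes fin: "finite_measure M" and p: "p > 1" and dual: "\<phi> \<in> Lp_dual p M"
  defines "q \<equiv> p / (p - 1)"
  obtains g where "g \<in> Lp_space q M"
    "\<And>f. f \<in> Lp_space p M \<Longrightarrow> integrable M (\<lambda>t. f t * g t) \<and> \<phi> f = (\<integral>t. f t * g t \<partial>M)"
proof -
  interpret finite_measure M by fact
  have p1: "p \<ge> 1" using p by simp
  have q: "q > 1" "(q - 1) * p = q" "q * (1 - 1/p) = 1"
    using p by (auto simp: q_def field_simps)
  obtain C where C: "C \<ge> 0"
    "\<And>f. f \<in> Lp_space p M \<Longrightarrow> \<bar>\<phi> f\<bar> \<le> C * (\<integral>t. \<bar>f t\<bar> powr p \<partial>M) powr (1/p)"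
    using dual_bound[OF dual p1] by blast
  have indLp: "indicator A \<in> Lp_space p M" if "A \<in> sets M" for A
    by (rule Lp_spaceI_bounded[of _ _ 1]) (use that p in \<open>auto split: split_indicator intro: finite_measure_axioms\<close>)
  define \<nu> where "\<nu> A = \<phi> (indicator A)" for A
  have \<nu>_le: "\<bar>\<nu> A\<bar> \<le> C * measure M A powr (1/p)" if "A \<in> sets M" for A
  proof -
    have "(\<integral>t. \<bar>indicator A t\<bar> powr p \<partial>M) = (\<integral>t. indicator A t \<partial>M)"
      using p by (intro Bochner_Integration.integral_cong) (auto split: split_indicator)
    also have "\<dots> = measure M A" using that by simp
    finally show ?thesis using C(2)[OF indLp[OF that]] by (simp add: \<nu>_def)
  qed
  have "\<exists>g. integrable M g \<and> (\<forall>A\<in>sets M. \<nu> A = (\<integral>t. indicator A t * g t \<partial>M))"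
  proof (rule density_of_additive)
    fix A assume A: "A \<in> sets M"
    have "C * measure M A powr (1/p) \<le> C * measure M (space M) powr (1/p)"
      using p C(1) by (intro mult_left_mono powr_mono2 bounded_measure) auto
    with \<nu>_le[OF A] show "\<bar>\<nu> A\<bar> \<le> C * measure M (space M) powr (1/p)" by simp
  next
    fix A B assume AB: "A \<in> sets M" "B \<in> sets M" "A \<inter> B = {}"
    have "(indicator (A \<union> B) :: 'a \<Rightarrow> real) = (\<lambda>t. indicator A t + indicator B t)"
      using AB(3) by (auto simp: fun_eq_iff split: split_indicator)
    then show "\<nu> (A \<union> B) = \<nu> A + \<nu> B"
      using dual_add[OF dual p1 indLp[OF AB(1)] indLp[OF AB(2)]] by (simp add: \<nu>_def)
  next
    fix e :: real assume e: "e > 0"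
    \<comment> \<open>\<open>C + 1\<close> instead of \<open>C\<close> since the functional may vanish\<close>
    define d where "d = (e / (C + 1)) powr p"
    have "\<bar>\<nu> A\<bar> \<le> e" if A: "A \<in> sets M" "measure M A < d" for A
    proof -
      have "measure M A powr (1/p) \<le> d powr (1/p)"
        using A(2) p by (intro powr_mono2) auto
      also have "\<dots> = e / (C + 1)"
        using p e C(1) by (simp add: d_def powr_powr)
      finally have "C * measure M A powr (1/p) \<le> C * (e / (C + 1))"
        using C(1) by (rule mult_left_mono)
      also have "\<dots> \<le> e" using C(1) e by (simp add: field_simps)
      finally show ?thesis using \<nu>_le[OF A(1)] by simp
    qed
    moreover have "d > 0" using e C(1) by (simp add: d_def)
    ultimately show "\<exists>d>0. \<forall>A\<in>sets M. measure M A < d \<longrightarrow> \<bar>\<nu> A\<bar> \<le> e" by blast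
  qed
  then obtain g where g: "integrable M g"
    and rep: "\<And>A. A \<in> sets M \<Longrightarrow> \<phi> (indicator A) = (\<integral>t. indicator A t * g t \<partial>M)"
    unfolding \<nu>_def by metis
  have [measurable]: "g \<in> borel_measurable M" using g by auto
  define E where "E n t = (if \<bar>g t\<bar> \<le> real n then 1 else 0::real)" for n t
  have [measurable]: "E n \<in> borel_measurable M" for n unfolding E_def by measurable
  define I where "I n = (\<integral>t. E n t * \<bar>g t\<bar> powr q \<partial>M)" for n
  have int_I: "integrable M (\<lambda>t. E n t * \<bar>g t\<bar> powr q)" for n
  proof (rule integrable_const_bound[of _ "real n powr q"])
    show "AE t in M. norm (E n t * \<bar>g t\<bar> powr q) \<le> real n powr q"
      using q(1) by (intro AE_I2) (auto simp: E_def intro: powr_mono2)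
  qed measurable
  have I_nonneg: "I n \<ge> 0" for n
    unfolding I_def by (intro integral_nonneg_AE AE_I2) (simp add: E_def)
  have I_le: "I n \<le> C powr q" for n
  proof -
    define h where "h t = E n t * (sgn (g t) * \<bar>g t\<bar> powr (q - 1))" for t
    have [measurable]: "h \<in> borel_measurable M" unfolding h_def by measurable
    have h_bd: "\<bar>h t\<bar> \<le> real n powr (q - 1)" for t
      using q(1) by (auto simp: h_def E_def abs_mult sgn_if intro: powr_mono2)
    have hLp: "h \<in> Lp_space p M"
      using h_bd p by (intro Lp_spaceI_bounded fin AE_I2) auto
    have hg: "h t * g t = E n t * \<bar>g t\<bar> powr q" for t
    proof (cases "g t = 0")
      case False
      have "sgn (g t) * g t = \<bar>g t\<bar>" by (simp add: abs_sgn mult.commute)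
      then have "h t * g t = E n t * (\<bar>g t\<bar> powr (q - 1) * \<bar>g t\<bar> powr 1)"
        by (simp add: h_def mult_ac)
      also have "\<dots> = E n t * \<bar>g t\<bar> powr q" by (simp only: powr_add[symmetric]) simp
      finally show ?thesis .
    qed (simp add: h_def)
    have hp: "\<bar>h t\<bar> powr p = E n t * \<bar>g t\<bar> powr q" for t
      using p q by (auto simp: h_def E_def abs_mult sgn_if powr_powr)
    have "\<phi> h = (\<integral>t. h t * g t \<partial>M)"
      by (rule dual_eq_integral[OF dual p1 fin g rep hLp]) (simp_all only: hg int_I)
    then have "I n \<le> C * I n powr (1/p)"
      using C(2)[OF hLp] by (simp only: hg hp I_def)
    show ?thesis
    proof (cases "I n = 0")
      case False
      then have pos: "I n > 0" using I_nonneg[of n] by simp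
      have "I n powr (1 - 1/p) * I n powr (1/p) = I n"
        using pos by (simp add: powr_add[symmetric])
      with \<open>I n \<le> C * I n powr (1/p)\<close> have "I n powr (1 - 1/p) * I n powr (1/p) \<le> C * I n powr (1/p)"
        by simp
      then have "I n powr (1 - 1/p) \<le> C" using pos by simp
      then have "(I n powr (1 - 1/p)) powr q \<le> C powr q"
        using q(1) by (intro powr_mono2) auto
      then show ?thesis using q(3) pos by (simp add: powr_powr mult.commute)
    qed simp
  qed
  have gLq: "g \<in> Lp_space q M"
    by (rule Lp_spaceI_truncated[of _ _ "C powr q"]) (use I_le q in \<open>simp_all add: I_def E_def\<close>)
  show ?thesis
  proof (rule that[OF gLq], intro conjI)
    fix f assume f: "f \<in> Lp_space p M"
    then show fg: "integrable M (\<lambda>t. f t * g t)"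
      using integrable_mult_Lp gLq p unfolding q_def by blast
    show "\<phi> f = (\<integral>t. f t * g t \<partial>M)"
      by (rule dual_eq_integral[OF dual p1 fin g rep f fg])
  qed
qed


lemma Lp_bounded_moment:
  assumes "Lp_bounded p M f" "p > 0"
  shows "\<exists>B. \<forall>n. f n \<in> Lp_space p M \<and> (\<integral>t. \<bar>f n t\<bar> powr p \<partial>M) \<le> B"
proof -
  obtain C where C: "\<And>n. f n \<in> Lp_space p M" "\<And>n. Lp_norm p M (f n) \<le> C"
    using assms(1) unfolding Lp_bounded_def by blast
  have "(\<integral>t. \<bar>f n t\<bar> powr p \<partial>M) \<le> C powr p" for n
  proof -
    let ?I = "\<integral>t. \<bar>f n t\<bar> powr p \<partial>M"
    have I: "?I \<ge> 0" by (intro integral_nonneg_AE AE_I2) simp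
    have "?I = (?I powr (1/p)) powr p" using I assms(2) by (simp add: powr_powr)
    also have "\<dots> \<le> C powr p"
      using C(2)[of n] assms(2) by (intro powr_mono2) (auto simp: Lp_norm_def)
    finally show ?thesis .
  qed
  with C(1) show ?thesis by blast
qed

lemma abs_le_add_powr:
  fixes x :: real
  assumes "K > 0" "p > 1"
  shows "\<bar>x\<bar> \<le> K + K powr (1 - p) * \<bar>x\<bar> powr p"
proof (cases "\<bar>x\<bar> \<le> K")
  case False
  have "\<bar>x\<bar> = \<bar>x\<bar> powr ((1 - p) + p)" using False assms by simp
  also have "\<dots> = \<bar>x\<bar> powr (1 - p) * \<bar>x\<bar> powr p" by (rule powr_add)
  also have "\<dots> \<le> K powr (1 - p) * \<bar>x\<bar> powr p"
    using False assms by (intro mult_right_mono powr_mono2') auto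
  finally show ?thesis using assms by simp
qed (simp add: add_increasing2)

lemma (in finite_measure) Lp_space_integrable:
  assumes "f \<in> Lp_space p M" "p > 1"
  shows "integrable M f"
proof (rule Bochner_Integration.integrable_bound)
  show "integrable M (\<lambda>t. 1 + 1 powr (1 - p) * \<bar>f t\<bar> powr p)"
    using assms by (auto simp: Lp_space_def)
  show "AE t in M. norm (f t) \<le> norm (1 + 1 powr (1 - p) * \<bar>f t\<bar> powr p)"
    using abs_le_add_powr[of 1 p] assms(2) by (intro AE_I2) simp
qed (use assms in \<open>auto simp: Lp_space_def\<close>)

text \<open>
  Where \<open>\<bar>f n\<bar>\<close> exceeds \<open>K\<close> it is at most \<open>K\<^sup>1\<^sup>-\<^sup>p \<bar>f n\<bar>\<^sup>p\<close>, whose integral is small for large \<open>K\<close> uniformly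
  in \<open>n\<close>; the rest contributes at most \<open>K\<close> times the measure of \<open>A\<close>.
\<close>

lemma (in finite_measure) Lp_uniformly_integrable:
  fixes f :: "nat \<Rightarrow> 'a \<Rightarrow> real"
  assumes p: "p > 1" and f: "\<And>n. f n \<in> Lp_space p M"
    and B: "\<And>n. (\<integral>t. \<bar>f n t\<bar> powr p \<partial>M) \<le> B" and e: "e > 0"
  shows "\<exists>d>0. \<forall>A\<in>sets M. measure M A < d \<longrightarrow> (\<forall>n. (\<integral>t. indicator A t * \<bar>f n t\<bar> \<partial>M) \<le> e)"
proof -
  have "0 \<le> (\<integral>t. \<bar>f 0 t\<bar> powr p \<partial>M)" by (intro integral_nonneg_AE AE_I2) simp
  from this B[of 0] have B0: "B \<ge> 0" by (rule order_trans)
  \<comment> \<open>chosen so that \<open>K powr (1 - p) * B \<le> e / 2\<close>\<close>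
  define K where "K = (e / (2 * (B + 1))) powr (1 / (1 - p))"
  have K: "K > 0" using e B0 by (simp add: K_def)
  have Kp: "K powr (1 - p) = e / (2 * (B + 1))"
    using e B0 p by (simp add: K_def powr_powr)
  have "(\<integral>t. indicator A t * \<bar>f n t\<bar> \<partial>M) \<le> e" if A: "A \<in> sets M" "measure M A < e / (2 * K)" for A n
  proof -
    have int: "integrable M (\<lambda>t. \<bar>f n t\<bar> powr p)" using f by (auto simp: Lp_space_def)
    have "(\<integral>t. indicator A t * \<bar>f n t\<bar> \<partial>M)
        \<le> (\<integral>t. K * indicator A t + K powr (1 - p) * \<bar>f n t\<bar> powr p \<partial>M)"
    proof (rule integral_mono)
      show "integrable M (\<lambda>t. indicator A t * \<bar>f n t\<bar>)"
        using integrable_mult_indicator[OF A(1) integrable_abs[OF Lp_space_integrable[OF f p]], of n] by simp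
      show "integrable M (\<lambda>t. K * indicator A t + K powr (1 - p) * \<bar>f n t\<bar> powr p)"
        using int A by (auto intro: integrable_real_indicator simp: emeasure_eq_measure)
      show "indicator A t * \<bar>f n t\<bar> \<le> K * indicator A t + K powr (1 - p) * \<bar>f n t\<bar> powr p" for t
        using abs_le_add_powr[OF K p, of "f n t"] by (auto split: split_indicator)
    qed
    also have "\<dots> = K * measure M A + K powr (1 - p) * (\<integral>t. \<bar>f n t\<bar> powr p \<partial>M)"
      using int A by (subst Bochner_Integration.integral_add)
        (auto intro: integrable_real_indicator simp: emeasure_eq_measure)
    also have "\<dots> \<le> e / 2 + e / (2 * (B + 1)) * B"
      unfolding Kp using A K e B0 B[of n] by (intro add_mono mult_left_mono) (auto simp: field_simps)
    also have "\<dots> \<le> e" using e B0 by (simp add: field_simps)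
    finally show ?thesis .
  qed
  then show ?thesis using e K by (intro exI[of _ "e / (2 * K)"]) auto
qed

section \<open>Weak sequential compactness of bounded sets\<close>

text \<open>
  A diagonal subsequence makes the integrals converge over each set of the countable dense family. By
  uniform integrability, replacing an arbitrary measurable set by a nearby member of the family changes
  all these integrals by little.
\<close>

lemma (in finite_measure) setwise_convergent_subsequence:
  fixes f :: "nat \<Rightarrow> 'a \<Rightarrow> real"
  assumes D: "countable D" "D \<subseteq> sets M"
    and dense: "\<And>A e. A \<in> sets M \<Longrightarrow> e > 0 \<Longrightarrow> \<exists>F\<in>D. measure M ((A - F) \<union> (F - A)) < e"
    and f: "\<And>n. integrable M (f n)"
    and L1: "\<And>n. (\<integral>t. \<bar>f n t\<bar> \<partial>M) \<le> B"
    and ui: "\<And>e. e > 0 \<Longrightarrow>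
      \<exists>d>0. \<forall>A\<in>sets M. measure M A < d \<longrightarrow> (\<forall>n. (\<integral>t. indicator A t * \<bar>f n t\<bar> \<partial>M) \<le> e)"
  shows "\<exists>r :: nat \<Rightarrow> nat. strict_mono r \<and>
    (\<forall>A\<in>sets M. convergent (\<lambda>n. \<integral>t. indicator A t * f (r n) t \<partial>M))"
proof -
  have int: "integrable M (\<lambda>t. indicator A t * f n t)" "integrable M (\<lambda>t. indicator A t * \<bar>f n t\<bar>)"
    if "A \<in> sets M" for A n
    using integrable_mult_indicator[OF that f] integrable_mult_indicator[OF that integrable_abs[OF f]] by auto
  have bd: "\<bar>\<integral>t. indicator A t * f n t \<partial>M\<bar> \<le> B" if "A \<in> sets M" for A n
  proof -
    have "\<bar>\<integral>t. indicator A t * f n t \<partial>M\<bar> \<le> (\<integral>t. \<bar>f n t\<bar> \<partial>M)"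
      using int[OF that] f by (intro abs_integral_le) (auto split: split_indicator)
    with L1[of n] show ?thesis by simp
  qed
  have Dne: "D \<noteq> {}" using dense[of "{}" 1] by auto
  define F where "F = from_nat_into D"
  have F: "F k \<in> D" for k using Dne by (simp add: F_def from_nat_into)
  have F': "F k \<in> sets M" for k using F D(2) by auto
  interpret subseqs "\<lambda>k s. convergent (\<lambda>n. \<integral>t. indicator (F k) t * f (s n) t \<partial>M)"
  proof
    fix k and s :: "nat \<Rightarrow> nat"
    have "bounded (range (\<lambda>n. \<integral>t. indicator (F k) t * f (s n) t \<partial>M))"
      using bd[OF F'[of k]] by (auto simp: bounded_iff)
    from bounded_imp_convergent_subsequence[OF this]
    show "\<exists>r'. strict_mono r' \<and> convergent (\<lambda>n. \<integral>t. indicator (F k) t * f ((s \<circ> r') n) t \<partial>M)"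
      by (auto simp: convergent_def o_def)
  qed
  have convD: "convergent (\<lambda>n. \<integral>t. indicator (F k) t * f (diagseq n) t \<partial>M)" for k
  proof -
    have "convergent (\<lambda>n. \<integral>t. indicator (F k) t * f ((diagseq \<circ> (+) (Suc k)) n) t \<partial>M)"
    proof (rule diagseq_holds)
      fix r s :: "nat \<Rightarrow> nat" and n
      assume "strict_mono r" "convergent (\<lambda>i. \<integral>t. indicator (F n) t * f (s i) t \<partial>M)"
      then show "convergent (\<lambda>i. \<integral>t. indicator (F n) t * f ((s \<circ> r) i) t \<partial>M)"
        using convergent_subseq_convergent[of "\<lambda>i. \<integral>t. indicator (F n) t * f (s i) t \<partial>M" r]
        by (simp add: o_def)
    qed
    then show ?thesis
      using convergent_ignore_initial_segment[of "\<lambda>n. \<integral>t. indicator (F k) t * f (diagseq n) t \<partial>M" "Suc k"]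
      by (simp add: o_def add.commute)
  qed
  have "convergent (\<lambda>n. \<integral>t. indicator A t * f (diagseq n) t \<partial>M)" if A: "A \<in> sets M" for A
  proof (rule Cauchy_convergent, rule metric_CauchyI)
    fix e :: real assume e: "e > 0"
    obtain d where d: "d > 0"
      "\<And>A n. A \<in> sets M \<Longrightarrow> measure M A < d \<Longrightarrow> (\<integral>t. indicator A t * \<bar>f n t\<bar> \<partial>M) \<le> e/4"
      using ui[of "e/4"] e by auto
    obtain G where G: "G \<in> D" "measure M ((A - G) \<union> (G - A)) < d"
      using dense[OF A d(1)] by auto
    obtain k where k: "G = F k"
      using from_nat_into_surj[OF D(1) G(1)] unfolding F_def by metis
    have G': "G \<in> sets M" using G D by auto
    have close: "\<bar>(\<integral>t. indicator A t * f n t \<partial>M) - (\<integral>t. indicator G t * f n t \<partial>M)\<bar> \<le> e/4" for n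
    proof -
      have S: "(A - G) \<union> (G - A) \<in> sets M" using A G' by auto
      have "\<bar>(\<integral>t. indicator A t * f n t \<partial>M) - (\<integral>t. indicator G t * f n t \<partial>M)\<bar>
          = \<bar>\<integral>t. indicator A t * f n t - indicator G t * f n t \<partial>M\<bar>"
        using int[OF A] int[OF G'] by simp
      also have "\<dots> \<le> (\<integral>t. indicator ((A - G) \<union> (G - A)) t * \<bar>f n t\<bar> \<partial>M)"
        using int[OF A, of n] int[OF G', of n] int[OF S, of n]
        by (intro abs_integral_le Bochner_Integration.integrable_diff) (auto split: split_indicator)
      also have "\<dots> \<le> e/4" using d(2)[OF S G(2)] .
      finally show ?thesis .
    qed
    have "Cauchy (\<lambda>n. \<integral>t. indicator G t * f (diagseq n) t \<partial>M)"
      using convD[of k] k convergent_Cauchy by simp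
    then obtain n0 where n0: "\<And>m n. m \<ge> n0 \<Longrightarrow> n \<ge> n0 \<Longrightarrow>
        dist (\<integral>t. indicator G t * f (diagseq m) t \<partial>M) (\<integral>t. indicator G t * f (diagseq n) t \<partial>M) < e/4"
      using metric_CauchyD[of _ "e/4"] e by (meson divide_pos_pos zero_less_numeral)
    show "\<exists>n0. \<forall>m\<ge>n0. \<forall>n\<ge>n0.
        dist (\<integral>t. indicator A t * f (diagseq m) t \<partial>M) (\<integral>t. indicator A t * f (diagseq n) t \<partial>M) < e"
    proof (intro exI allI impI)
      fix m n assume "m \<ge> n0" "n \<ge> n0"
      from n0[OF this] close[of "diagseq m"] close[of "diagseq n"] e
      show "dist (\<integral>t. indicator A t * f (diagseq m) t \<partial>M) (\<integral>t. indicator A t * f (diagseq n) t \<partial>M) < e"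
        unfolding dist_real_def by linarith
    qed
  qed
  then show ?thesis using subseq_diagseq by blast
qed

text \<open>
  The limits form an additive set function; uniform integrability survives the limit and makes it
  absolutely continuous.
\<close>

lemma (in finite_measure) setwise_limit_density:
  fixes f :: "nat \<Rightarrow> 'a \<Rightarrow> real"
  assumes f: "\<And>n. integrable M (f n)"
    and L1: "\<And>n. (\<integral>t. \<bar>f n t\<bar> \<partial>M) \<le> B"
    and ui: "\<And>e. e > 0 \<Longrightarrow>
      \<exists>d>0. \<forall>A\<in>sets M. measure M A < d \<longrightarrow> (\<forall>n. (\<integral>t. indicator A t * \<bar>f n t\<bar> \<partial>M) \<le> e)"
    and conv: "\<And>A. A \<in> sets M \<Longrightarrow> convergent (\<lambda>n. \<integral>t. indicator A t * f n t \<partial>M)"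
  shows "\<exists>z. integrable M z \<and>
    (\<forall>A\<in>sets M. (\<lambda>n. \<integral>t. indicator A t * f n t \<partial>M) \<longlonglongrightarrow> (\<integral>t. indicator A t * z t \<partial>M))"
proof -
  have int: "integrable M (\<lambda>t. indicator A t * f n t)" "integrable M (\<lambda>t. indicator A t * \<bar>f n t\<bar>)"
    if "A \<in> sets M" for A n
    using integrable_mult_indicator[OF that f] integrable_mult_indicator[OF that integrable_abs[OF f]] by auto
  define \<nu> where "\<nu> A = lim (\<lambda>n. \<integral>t. indicator A t * f n t \<partial>M)" for A
  have lim: "(\<lambda>n. \<integral>t. indicator A t * f n t \<partial>M) \<longlonglongrightarrow> \<nu> A" if "A \<in> sets M" for A
    using conv[OF that] by (simp add: \<nu>_def convergent_LIMSEQ_iff)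
  have bd: "\<bar>\<integral>t. indicator A t * f n t \<partial>M\<bar> \<le> (\<integral>t. indicator A t * \<bar>f n t\<bar> \<partial>M)"
    if "A \<in> sets M" for A n
    using int[OF that] by (intro abs_integral_le) (auto split: split_indicator)
  have "\<exists>z. integrable M z \<and> (\<forall>A\<in>sets M. \<nu> A = (\<integral>t. indicator A t * z t \<partial>M))"
  proof (rule density_of_additive)
    fix A assume A: "A \<in> sets M"
    have "(\<integral>t. indicator A t * \<bar>f n t\<bar> \<partial>M) \<le> (\<integral>t. \<bar>f n t\<bar> \<partial>M)" for n
      using int[OF A] f by (intro integral_mono) (auto split: split_indicator)
    then have "\<bar>\<integral>t. indicator A t * f n t \<partial>M\<bar> \<le> B" for n
      using bd[OF A] L1 by (meson order_trans)
    then show "\<bar>\<nu> A\<bar> \<le> B"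
      by (intro LIMSEQ_le_const2[OF tendsto_rabs[OF lim[OF A]]]) auto
  next
    fix A A' assume A: "A \<in> sets M" "A' \<in> sets M" "A \<inter> A' = {}"
    have ind: "indicator (A \<union> A') t = (indicator A t + indicator A' t :: real)" for t
      using A(3) by (auto split: split_indicator)
    have "(\<integral>t. indicator (A \<union> A') t * f n t \<partial>M)
        = (\<integral>t. indicator A t * f n t \<partial>M) + (\<integral>t. indicator A' t * f n t \<partial>M)" for n
      unfolding ind distrib_right by (intro Bochner_Integration.integral_add int A)
    then have "(\<lambda>n. \<integral>t. indicator (A \<union> A') t * f n t \<partial>M) \<longlonglongrightarrow> \<nu> A + \<nu> A'"
      using tendsto_add[OF lim[OF A(1)] lim[OF A(2)]] by simp
    then show "\<nu> (A \<union> A') = \<nu> A + \<nu> A'"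
      using lim[of "A \<union> A'"] A LIMSEQ_unique by blast
  next
    fix e :: real assume "e > 0"
    then obtain d where d: "d > 0"
      "\<And>A n. A \<in> sets M \<Longrightarrow> measure M A < d \<Longrightarrow> (\<integral>t. indicator A t * \<bar>f n t\<bar> \<partial>M) \<le> e"
      using ui by meson
    have "\<bar>\<nu> A\<bar> \<le> e" if A: "A \<in> sets M" "measure M A < d" for A
      using bd[OF A(1)] d(2)[OF A]
      by (intro LIMSEQ_le_const2[OF tendsto_rabs[OF lim[OF A(1)]]]) (meson order_trans)
    with d(1) show "\<exists>d>0. \<forall>A\<in>sets M. measure M A < d \<longrightarrow> \<bar>\<nu> A\<bar> \<le> e" by blast
  qed
  then show ?thesis using lim by metis
qed

text \<open>
  A bounded function is a uniform limit of functions with finitely many values, and uniform errors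
  are controlled by the common \<open>L\<^sup>1\<close> bound.
\<close>

lemma (in finite_measure) setwise_limit_bounded_test:
  fixes f :: "nat \<Rightarrow> 'a \<Rightarrow> real"
  assumes f: "\<And>n. integrable M (f n)" and L1: "\<And>n. (\<integral>t. \<bar>f n t\<bar> \<partial>M) \<le> B"
    and z: "integrable M z"
    and lim: "\<And>A. A \<in> sets M \<Longrightarrow>
      (\<lambda>n. \<integral>t. indicator A t * f n t \<partial>M) \<longlonglongrightarrow> (\<integral>t. indicator A t * z t \<partial>M)"
    and h[measurable]: "h \<in> borel_measurable M" and h_bd: "\<And>t. t \<in> space M \<Longrightarrow> \<bar>h t\<bar> \<le> K"
  shows "(\<lambda>n. \<integral>t. h t * f n t \<partial>M) \<longlonglongrightarrow> (\<integral>t. h t * z t \<partial>M)"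
proof (rule tendstoI)
  fix e :: real assume e: "e > 0"
  define B' where "B' = max B (\<integral>t. \<bar>z t\<bar> \<partial>M)"
  have "0 \<le> (\<integral>t. \<bar>z t\<bar> \<partial>M)" by (intro integral_nonneg_AE AE_I2) simp
  then have B': "B' \<ge> 0" "\<And>n. (\<integral>t. \<bar>f n t\<bar> \<partial>M) \<le> B'" "(\<integral>t. \<bar>z t\<bar> \<partial>M) \<le> B'"
    using L1 by (auto simp: B'_def le_max_iff_disj)
  define d where "d = e / (4 * (B' + 1))"
  have d: "d > 0" using e B' by (simp add: d_def)
  have dB: "d * B' \<le> e / 4" using e B' by (simp add: d_def field_simps)
  \<comment> \<open>rounding \<open>h\<close> down to multiples of \<open>d\<close> costs at most \<open>d\<close> everywhere\<close>
  define s where "s t = d * of_int \<lfloor>h t / d\<rfloor>" for t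
  have [measurable]: "s \<in> borel_measurable M" unfolding s_def by measurable
  have hs: "\<bar>h t - s t\<bar> \<le> d" for t
  proof -
    have "h t = d * (h t / d)" using d by simp
    moreover have "d * of_int \<lfloor>h t / d\<rfloor> \<le> d * (h t / d)" "d * (h t / d) \<le> d * (of_int \<lfloor>h t / d\<rfloor> + 1)"
      using d by (intro mult_left_mono; linarith)+
    ultimately show ?thesis unfolding s_def by (simp add: algebra_simps)
  qed
  have s_bd: "\<bar>s t\<bar> \<le> K + d" if "t \<in> space M" for t
    using hs[of t] h_bd[OF that] by linarith
  have mult_int: "integrable M (\<lambda>t. k t * u t)"
    if "integrable M u" "k \<in> borel_measurable M" "\<And>t. t \<in> space M \<Longrightarrow> \<bar>k t\<bar> \<le> c"
    for k u :: "'a \<Rightarrow> real" and c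
  proof (rule Bochner_Integration.integrable_bound)
    show "integrable M (\<lambda>t. c * \<bar>u t\<bar>)" using that(1) by auto
    show "AE t in M. norm (k t * u t) \<le> norm (c * \<bar>u t\<bar>)"
    proof (rule AE_I2)
      fix t assume t: "t \<in> space M"
      have "\<bar>k t\<bar> * \<bar>u t\<bar> \<le> c * \<bar>u t\<bar>" by (intro mult_right_mono that(3)[OF t]) simp
      also have "\<dots> \<le> \<bar>c * \<bar>u t\<bar>\<bar>" by (rule abs_ge_self)
      finally show "norm (k t * u t) \<le> norm (c * \<bar>u t\<bar>)" by (simp add: abs_mult)
    qed
  qed (use that in auto)
  have h_int: "integrable M (\<lambda>t. h t * u t)" if "integrable M u" for u
    by (rule mult_int[OF that h h_bd])
  have s_int: "integrable M (\<lambda>t. s t * u t)" if "integrable M u" for u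
    by (rule mult_int[OF that _ s_bd]) auto
  have close: "\<bar>(\<integral>t. h t * u t \<partial>M) - (\<integral>t. s t * u t \<partial>M)\<bar> \<le> e / 4"
    if u: "integrable M u" and uB: "(\<integral>t. \<bar>u t\<bar> \<partial>M) \<le> B'" for u
  proof -
    have "\<bar>(\<integral>t. h t * u t \<partial>M) - (\<integral>t. s t * u t \<partial>M)\<bar> = \<bar>\<integral>t. h t * u t - s t * u t \<partial>M\<bar>"
      using h_int[OF u] s_int[OF u] by simp
    also have "\<dots> \<le> (\<integral>t. d * \<bar>u t\<bar> \<partial>M)"
    proof (rule abs_integral_le)
      show "\<bar>h t * u t - s t * u t\<bar> \<le> d * \<bar>u t\<bar>" for t
        using mult_right_mono[OF hs[of t] abs_ge_zero[of "u t"]]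
        by (simp add: abs_mult[symmetric] left_diff_distrib)
    qed (use h_int[OF u] s_int[OF u] u in auto)
    also have "\<dots> \<le> d * B'" using uB d by simp
    finally show ?thesis using dB by simp
  qed
  define m where "m = \<lceil>(K + d) / d\<rceil>"
  let ?E = "\<lambda>k. {t \<in> space M. \<lfloor>h t / d\<rfloor> = k}"
  have E: "?E k \<in> sets M" for k by measurable
  have s_sum: "s t = (\<Sum>k\<in>{-m..m}. d * of_int k * indicator (?E k) t)" if t: "t \<in> space M" for t
  proof -
    have "\<bar>of_int \<lfloor>h t / d\<rfloor>\<bar> \<le> (K + d) / d"
      using s_bd[OF t] d by (simp add: s_def abs_mult field_simps)
    then have "\<lfloor>h t / d\<rfloor> \<in> {-m..m}"
      unfolding m_def by (auto simp: abs_le_iff) linarith+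
    have "(\<Sum>k\<in>{-m..m}. d * of_int k * indicator (?E k) t)
        = (\<Sum>k\<in>{\<lfloor>h t / d\<rfloor>}. d * of_int k * indicator (?E k) t)"
      using \<open>\<lfloor>h t / d\<rfloor> \<in> {-m..m}\<close> by (intro sum.mono_neutral_right) (auto split: split_indicator)
    then show ?thesis using t by (simp add: s_def)
  qed
  have ind_int: "integrable M (\<lambda>t. indicator A t * u t)" if "A \<in> sets M" "integrable M u" for A and u :: "'a \<Rightarrow> real"
    using integrable_mult_indicator[OF that] by simp
  have s_integral: "(\<integral>t. s t * u t \<partial>M) = (\<Sum>k\<in>{-m..m}. d * of_int k * (\<integral>t. indicator (?E k) t * u t \<partial>M))"
    if u: "integrable M u" for u
  proof -
    have "(\<integral>t. s t * u t \<partial>M) = (\<integral>t. (\<Sum>k\<in>{-m..m}. d * of_int k * (indicator (?E k) t * u t)) \<partial>M)"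
      by (intro Bochner_Integration.integral_cong refl)
        (simp only: s_sum sum_distrib_right mult.assoc)
    also have "\<dots> = (\<Sum>k\<in>{-m..m}. \<integral>t. d * of_int k * (indicator (?E k) t * u t) \<partial>M)"
      by (intro Bochner_Integration.integral_sum integrable_mult_right ind_int E u)
    finally show ?thesis by simp
  qed
  have "(\<lambda>n. \<integral>t. s t * f n t \<partial>M) \<longlonglongrightarrow> (\<integral>t. s t * z t \<partial>M)"
    unfolding s_integral[OF f] s_integral[OF z]
    by (intro tendsto_sum tendsto_mult tendsto_const lim E)
  from tendstoD[OF this, of "e / 4"] e
  have "eventually (\<lambda>n. dist (\<integral>t. s t * f n t \<partial>M) (\<integral>t. s t * z t \<partial>M) < e / 4) sequentially" by simp
  then show "eventually (\<lambda>n. dist (\<integral>t. h t * f n t \<partial>M) (\<integral>t. h t * z t \<partial>M) < e) sequentially"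
  proof eventually_elim
    case (elim n)
    then show ?case
      using close[OF f[of n] B'(2)] close[OF z B'(3)] e unfolding dist_real_def by linarith
  qed
qed

text \<open>
  The graph of \<open>x \<mapsto> \<bar>x\<bar>\<^sup>p\<close> lies above its tangent at \<open>a\<close>.
\<close>

lemma powr_tangent_le:
  fixes a x :: real
  assumes "p > 1"
  shows "\<bar>a\<bar> powr p + p * (sgn a * \<bar>a\<bar> powr (p - 1) * x - \<bar>a\<bar> powr p) \<le> \<bar>x\<bar> powr p"
proof -
  define q where "q = p / (p - 1)"
  have q: "q > 1" "1 / p + 1 / q = 1" "(p - 1) * q = p" "p / q = p - 1"
    using assms by (auto simp: q_def field_simps)
  have "sgn a * \<bar>a\<bar> powr (p - 1) * x \<le> \<bar>sgn a * \<bar>a\<bar> powr (p - 1) * x\<bar>" by (rule abs_ge_self)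
  also have "\<dots> \<le> \<bar>x\<bar> * \<bar>a\<bar> powr (p - 1)"
    by (cases "a = 0") (auto simp: abs_mult abs_sgn_eq)
  also have "\<dots> \<le> \<bar>x\<bar> powr p / p + (\<bar>a\<bar> powr (p - 1)) powr q / q"
    using assms q by (intro Youngs_inequality) auto
  also have "\<dots> = \<bar>x\<bar> powr p / p + \<bar>a\<bar> powr p / q"
    by (simp add: powr_powr q(3))
  finally have "p * (sgn a * \<bar>a\<bar> powr (p - 1) * x) \<le> p * (\<bar>x\<bar> powr p / p + \<bar>a\<bar> powr p / q)"
    using assms by (intro mult_left_mono) auto
  also have "\<dots> = \<bar>x\<bar> powr p + p / q * \<bar>a\<bar> powr p"
    using assms by (simp add: distrib_left)
  also have "\<dots> = \<bar>x\<bar> powr p + p * \<bar>a\<bar> powr p - \<bar>a\<bar> powr p"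
    unfolding q(4) by (simp add: algebra_simps)
  finally show ?thesis by (simp add: algebra_simps)
qed

text \<open>
  Lower semicontinuity of the \<open>p\<close>-th moment. The tangent inequality at \<open>z\<close> bounds \<open>\<bar>f k\<bar>\<^sup>p\<close> from below by
  \<open>\<bar>z\<bar>\<^sup>p\<close> plus a multiple of \<open>h (f k - z)\<close>, where \<open>h = sgn z \<bar>z\<bar>\<^sup>p\<^sup>-\<^sup>1\<close> is admissible as a test function once it is
  truncated to where \<open>\<bar>z\<bar> \<le> n\<close>.
\<close>

lemma (in finite_measure) weak_limit_in_Lp:
  fixes f :: "nat \<Rightarrow> 'a \<Rightarrow> real"
  assumes p: "p > 1" and f: "\<And>n. f n \<in> Lp_space p M"
    and B: "\<And>n. (\<integral>t. \<bar>f n t\<bar> powr p \<partial>M) \<le> B"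
    and z: "integrable M z"
    and lim: "\<And>h K. h \<in> borel_measurable M \<Longrightarrow> (\<And>t. t \<in> space M \<Longrightarrow> \<bar>h t\<bar> \<le> K) \<Longrightarrow>
      (\<lambda>n. \<integral>t. h t * f n t \<partial>M) \<longlonglongrightarrow> (\<integral>t. h t * z t \<partial>M)"
  shows "z \<in> Lp_space p M"
proof (rule Lp_spaceI_truncated)
  show z_meas[measurable]: "z \<in> borel_measurable M" using z by auto
  fix n :: nat
  define E where "E t = (if \<bar>z t\<bar> \<le> real n then 1 else 0::real)" for t
  have [measurable]: "E \<in> borel_measurable M" unfolding E_def by measurable
  define h where "h t = E t * (sgn (z t) * \<bar>z t\<bar> powr (p - 1))" for t
  have h_meas[measurable]: "h \<in> borel_measurable M" unfolding h_def by measurable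
  have h_bd: "\<bar>h t\<bar> \<le> real n powr (p - 1)" for t
    using p by (auto simp: h_def E_def abs_mult sgn_if intro: powr_mono2)
  have hz: "h t * z t = E t * \<bar>z t\<bar> powr p" for t
  proof (cases "z t = 0")
    case False
    have "sgn (z t) * z t = \<bar>z t\<bar>" by (simp add: abs_sgn mult.commute)
    then have "h t * z t = E t * (\<bar>z t\<bar> powr (p - 1) * \<bar>z t\<bar> powr 1)"
      by (simp add: h_def mult_ac)
    also have "\<dots> = E t * \<bar>z t\<bar> powr p" by (simp only: powr_add[symmetric]) simp
    finally show ?thesis .
  qed (simp add: h_def)
  let ?I = "\<integral>t. E t * \<bar>z t\<bar> powr p \<partial>M"
  have int_h: "integrable M (\<lambda>t. h t * u t)" if "integrable M u" for u
  proof (rule Bochner_Integration.integrable_bound)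
    show "integrable M (\<lambda>t. real n powr (p - 1) * \<bar>u t\<bar>)" using that by auto
    show "AE t in M. norm (h t * u t) \<le> norm (real n powr (p - 1) * \<bar>u t\<bar>)"
      using mult_right_mono[OF h_bd abs_ge_zero] by (intro AE_I2) (simp add: abs_mult)
  qed (use that in measurable)
  have int_E: "integrable M (\<lambda>t. E t * \<bar>z t\<bar> powr p)"
    using int_h[OF z] by (simp only: hz)
  have le: "?I + p * ((\<integral>t. h t * f k t \<partial>M) - (\<integral>t. h t * z t \<partial>M)) \<le> B" for k
  proof -
    have fk: "integrable M (f k)" by (rule Lp_space_integrable[OF f p])
    have "?I + p * ((\<integral>t. h t * f k t \<partial>M) - (\<integral>t. h t * z t \<partial>M))
        = (\<integral>t. E t * \<bar>z t\<bar> powr p + p * (h t * f k t - h t * z t) \<partial>M)"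
      using int_E int_h[OF fk] int_h[OF z] by simp
    also have "\<dots> \<le> (\<integral>t. \<bar>f k t\<bar> powr p \<partial>M)"
    proof (rule integral_mono)
      show "E t * \<bar>z t\<bar> powr p + p * (h t * f k t - h t * z t) \<le> \<bar>f k t\<bar> powr p" for t
        using powr_tangent_le[OF p, of "z t" "f k t"]
        by (simp only: hz) (auto simp: E_def h_def)
    qed (use f int_E int_h[OF fk] int_h[OF z] in \<open>auto simp: Lp_space_def\<close>)
    finally show ?thesis using B[of k] by simp
  qed
  have "(\<lambda>k. ?I + p * ((\<integral>t. h t * f k t \<partial>M) - (\<integral>t. h t * z t \<partial>M))) \<longlonglongrightarrow>
      ?I + p * ((\<integral>t. h t * z t \<partial>M) - (\<integral>t. h t * z t \<partial>M))"
    by (intro tendsto_intros lim[OF h_meas h_bd])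
  then have "?I + p * ((\<integral>t. h t * z t \<partial>M) - (\<integral>t. h t * z t \<partial>M)) \<le> B"
    by (rule LIMSEQ_le_const2) (use le in auto)
  then show "(\<integral>t. (if \<bar>z t\<bar> \<le> real n then 1 else 0) * \<bar>z t\<bar> powr p \<partial>M) \<le> B"
    by (simp add: E_def)
qed (use p in auto)

text \<open>
  In the \<open>L\<^sup>p\<close> ball a functional is uniformly close to integration against a bounded function: cutting
  off the representing function \<open>g\<close> where \<open>\<bar>g\<bar>\<close> is large leaves a part with small \<open>q\<close>-th moment.
\<close>

lemma (in finite_measure) Lp_weakly_convergesI:
  fixes f :: "nat \<Rightarrow> 'a \<Rightarrow> real"
  assumes p: "p > 1" and f: "\<And>n. f n \<in> Lp_space p M"
    and B: "\<And>n. (\<integral>t. \<bar>f n t\<bar> powr p \<partial>M) \<le> B"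
    and z: "z \<in> Lp_space p M"
    and lim: "\<And>h K. h \<in> borel_measurable M \<Longrightarrow> (\<And>t. t \<in> space M \<Longrightarrow> \<bar>h t\<bar> \<le> K) \<Longrightarrow>
      (\<lambda>n. \<integral>t. h t * f n t \<partial>M) \<longlonglongrightarrow> (\<integral>t. h t * z t \<partial>M)"
  shows "Lp_weakly_converges p M f z"
  unfolding Lp_weakly_converges_def
proof (intro conjI allI ballI f z)
  fix \<phi> assume \<phi>: "\<phi> \<in> Lp_dual p M"
  define q where "q = p / (p - 1)"
  have q: "q > 1" using p by (simp add: q_def field_simps)
  obtain g where g: "g \<in> Lp_space q M"
    and rep: "\<And>f. f \<in> Lp_space p M \<Longrightarrow> integrable M (\<lambda>t. f t * g t) \<and> \<phi> f = (\<integral>t. f t * g t \<partial>M)"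
    using Lp_dual_representation[OF finite_measure_axioms p \<phi>] unfolding q_def by blast
  have g_meas[measurable]: "g \<in> borel_measurable M" and g_int: "integrable M (\<lambda>t. \<bar>g t\<bar> powr q)"
    using g by (auto simp: Lp_space_def)
  define E where "E n t = (if \<bar>g t\<bar> \<le> real n then 1 else 0::real)" for n t
  have [measurable]: "E n \<in> borel_measurable M" for n unfolding E_def by measurable
  define R where "R n = (\<integral>t. (1 - E n t) * \<bar>g t\<bar> powr q \<partial>M)" for n
  have R_int: "integrable M (\<lambda>t. (1 - E n t) * \<bar>g t\<bar> powr q)" for n
    by (rule Bochner_Integration.integrable_bound[OF g_int]) (auto simp: E_def)
  have "R \<longlonglongrightarrow> (\<integral>t. 0 \<partial>M)"
    unfolding R_def
  proof (rule integral_dominated_convergence[OF _ _ g_int])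
    show "AE t in M. (\<lambda>n. (1 - E n t) * \<bar>g t\<bar> powr q) \<longlonglongrightarrow> 0"
    proof (rule AE_I2)
      fix t
      have "eventually (\<lambda>n. \<bar>g t\<bar> \<le> real n) sequentially"
        using filterlim_real_sequentially by (simp add: filterlim_at_top)
      then have "eventually (\<lambda>n. (1 - E n t) * \<bar>g t\<bar> powr q = 0) sequentially"
        by eventually_elim (simp add: E_def)
      then show "(\<lambda>n. (1 - E n t) * \<bar>g t\<bar> powr q) \<longlonglongrightarrow> 0" by (rule tendsto_eventually)
    qed
  qed (auto simp: E_def)
  then have R0: "R \<longlonglongrightarrow> 0" by simp
  define B' where "B' = max B (\<integral>t. \<bar>z t\<bar> powr p \<partial>M)"
  have "0 \<le> (\<integral>t. \<bar>z t\<bar> powr p \<partial>M)" by (intro integral_nonneg_AE AE_I2) simp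
  then have B': "B' \<ge> 0" "\<And>n. (\<integral>t. \<bar>f n t\<bar> powr p \<partial>M) \<le> B'" "(\<integral>t. \<bar>z t\<bar> powr p \<partial>M) \<le> B'"
    using B by (auto simp: B'_def le_max_iff_disj)
  show "(\<lambda>n. \<phi> (f n)) \<longlonglongrightarrow> \<phi> z"
  proof (rule tendstoI)
    fix e :: real assume e: "e > 0"
    \<comment> \<open>the scaling in \<open>powr_product_le_add\<close>: the factor from the \<open>L\<^sup>p\<close> ball is multiplied by \<open>l\<close>, the tail of \<open>g\<close> divided by it\<close>
    define l where "l = (e / (8 * (B' + 1))) powr (1 / p)"
    have l: "l > 0" using e B' by (simp add: l_def)
    have lp: "l powr p = e / (8 * (B' + 1))" using e B' p by (simp add: l_def powr_powr)
    have lB: "l powr p * B' \<le> e / 8" unfolding lp using e B'(1) by (simp add: field_simps)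
    have "(\<lambda>n. l powr (-q) * R n) \<longlonglongrightarrow> 0" using R0 by (rule tendsto_mult_right_zero)
    from order_tendstoD(2)[OF this, of "e / 8"] e
    have "eventually (\<lambda>n. l powr (-q) * R n < e / 8) sequentially" by simp
    then obtain n0 where n0: "l powr (-q) * R n0 < e / 8"
      by (auto simp: eventually_sequentially)
    define h where "h t = E n0 t * g t" for t
    have h_meas: "h \<in> borel_measurable M" unfolding h_def by measurable
    have h_bd: "\<bar>h t\<bar> \<le> real n0" for t by (simp add: h_def E_def)
    have close: "\<bar>\<phi> u - (\<integral>t. h t * u t \<partial>M)\<bar> \<le> e / 4"
      if u: "u \<in> Lp_space p M" and uB: "(\<integral>t. \<bar>u t\<bar> powr p \<partial>M) \<le> B'" for u
    proof -
      have [measurable]: "u \<in> borel_measurable M" using u by (simp add: Lp_space_def)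
      have ug: "integrable M (\<lambda>t. u t * g t)" using rep[OF u] by simp
      have hu: "integrable M (\<lambda>t. h t * u t)"
        by (rule Bochner_Integration.integrable_bound[OF ug])
          (use h_meas in \<open>auto simp: h_def E_def abs_mult mult.commute\<close>)
      have up: "integrable M (\<lambda>t. \<bar>u t\<bar> powr p)" using u by (simp add: Lp_space_def)
      have "\<bar>\<phi> u - (\<integral>t. h t * u t \<partial>M)\<bar> = \<bar>\<integral>t. u t * g t - h t * u t \<partial>M\<bar>"
        using rep[OF u] ug hu by simp
      also have "\<dots> \<le> (\<integral>t. l powr p * \<bar>u t\<bar> powr p + l powr (-q) * ((1 - E n0 t) * \<bar>g t\<bar> powr q) \<partial>M)"
      proof (rule abs_integral_le)
        fix t
        have "\<bar>u t * g t - h t * u t\<bar> = (l * \<bar>u t\<bar>) * ((1 - E n0 t) * \<bar>g t\<bar> / l)"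
          using l by (simp add: h_def E_def abs_mult)
        also have "\<dots> \<le> (l * \<bar>u t\<bar>) powr p + ((1 - E n0 t) * \<bar>g t\<bar> / l) powr q"
          unfolding q_def using l p by (intro powr_product_le_add) (auto simp: E_def)
        also have "\<dots> = l powr p * \<bar>u t\<bar> powr p + l powr (-q) * ((1 - E n0 t) * \<bar>g t\<bar> powr q)"
          using l by (simp add: powr_mult powr_divide powr_minus E_def field_simps)
        finally show "\<bar>u t * g t - h t * u t\<bar>
            \<le> l powr p * \<bar>u t\<bar> powr p + l powr (-q) * ((1 - E n0 t) * \<bar>g t\<bar> powr q)" .
      qed (use ug hu up R_int in auto)
      also have "\<dots> = l powr p * (\<integral>t. \<bar>u t\<bar> powr p \<partial>M) + l powr (-q) * R n0"
        using up R_int[of n0] by (simp add: R_def)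
      also have "\<dots> \<le> l powr p * B' + l powr (-q) * R n0"
        using uB by (intro add_right_mono mult_left_mono) auto
      finally show ?thesis using lB n0 by simp
    qed
    from tendstoD[OF lim[OF h_meas h_bd], of "e / 4"] e
    have "eventually (\<lambda>n. dist (\<integral>t. h t * f n t \<partial>M) (\<integral>t. h t * z t \<partial>M) < e / 4) sequentially" by simp
    then show "eventually (\<lambda>n. dist (\<phi> (f n)) (\<phi> z) < e) sequentially"
    proof eventually_elim
      case (elim n)
      then show ?case
        using close[OF f[of n] B'(2)] close[OF z B'(3)] e unfolding dist_real_def by linarith
    qed
  qed
qed

text \<open>
  Convergence against bounded functions is part of the conclusion because it is what the proof
  produces and what integral operators with bounded kernels need pointwise.
\<close>

lemma (in finite_measure) Lp_weakly_convergent_subsequence: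
  fixes f :: "nat \<Rightarrow> 'a \<Rightarrow> real"
  assumes D: "countable D" "D \<subseteq> sets M"
    and dense: "\<And>A e. A \<in> sets M \<Longrightarrow> e > 0 \<Longrightarrow> \<exists>F\<in>D. measure M ((A - F) \<union> (F - A)) < e"
    and p: "p > 1" and bounded: "Lp_bounded p M f"
  shows "\<exists>r z. strict_mono r \<and> Lp_weakly_converges p M (f \<circ> r) z \<and> z \<in> Lp_space p M \<and>
    (\<forall>h K. h \<in> borel_measurable M \<longrightarrow> (\<forall>t\<in>space M. \<bar>h t\<bar> \<le> K) \<longrightarrow>
      (\<lambda>n. \<integral>t. h t * f (r n) t \<partial>M) \<longlonglongrightarrow> (\<integral>t. h t * z t \<partial>M))"
proof -
  obtain B where B: "\<And>n. f n \<in> Lp_space p M" "\<And>n. (\<integral>t. \<bar>f n t\<bar> powr p \<partial>M) \<le> B"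
    using Lp_bounded_moment[OF bounded] p by auto
  have int: "integrable M (f n)" for n by (rule Lp_space_integrable[OF B(1) p])
  have L1: "(\<integral>t. \<bar>f n t\<bar> \<partial>M) \<le> measure M (space M) + B" for n
  proof -
    have "(\<integral>t. \<bar>f n t\<bar> \<partial>M) \<le> (\<integral>t. 1 + \<bar>f n t\<bar> powr p \<partial>M)"
      using abs_le_add_powr[of 1 p] p int B(1) by (intro integral_mono) (auto simp: Lp_space_def)
    also have "\<dots> = measure M (space M) + (\<integral>t. \<bar>f n t\<bar> powr p \<partial>M)"
      using B(1) by (subst Bochner_Integration.integral_add) (auto simp: Lp_space_def)
    finally show ?thesis using B(2)[of n] by simp
  qed
  note ui = Lp_uniformly_integrable[OF p B]
  have "\<exists>r :: nat \<Rightarrow> nat. strict_mono r \<and>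
      (\<forall>A\<in>sets M. convergent (\<lambda>n. \<integral>t. indicator A t * f (r n) t \<partial>M))"
    by (rule setwise_convergent_subsequence[OF D dense int L1 ui])
  then obtain r :: "nat \<Rightarrow> nat" where r: "strict_mono r"
    and conv: "\<And>A. A \<in> sets M \<Longrightarrow> convergent (\<lambda>n. \<integral>t. indicator A t * f (r n) t \<partial>M)"
    by auto
  have ui_r: "\<exists>d>0. \<forall>A\<in>sets M. measure M A < d \<longrightarrow> (\<forall>n. (\<integral>t. indicator A t * \<bar>f (r n) t\<bar> \<partial>M) \<le> e)"
    if "e > 0" for e
    using ui[OF that] by meson
  have "\<exists>z. integrable M z \<and> (\<forall>A\<in>sets M.
      (\<lambda>n. \<integral>t. indicator A t * f (r n) t \<partial>M) \<longlonglongrightarrow> (\<integral>t. indicator A t * z t \<partial>M))"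
    by (rule setwise_limit_density[OF int L1 ui_r conv])
  then obtain z where z: "integrable M z"
    and lim: "\<And>A. A \<in> sets M \<Longrightarrow>
      (\<lambda>n. \<integral>t. indicator A t * f (r n) t \<partial>M) \<longlonglongrightarrow> (\<integral>t. indicator A t * z t \<partial>M)"
    by auto
  have test: "(\<lambda>n. \<integral>t. h t * f (r n) t \<partial>M) \<longlonglongrightarrow> (\<integral>t. h t * z t \<partial>M)"
    if "h \<in> borel_measurable M" "\<And>t. t \<in> space M \<Longrightarrow> \<bar>h t\<bar> \<le> K" for h K
    by (rule setwise_limit_bounded_test[OF int L1 z lim that])
  have zLp: "z \<in> Lp_space p M"
    by (rule weak_limit_in_Lp[OF p B z test])
  have "Lp_weakly_converges p M (f \<circ> r) z"
    unfolding o_def by (rule Lp_weakly_convergesI[OF p B zLp test])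
  with r zLp test show ?thesis by blast
qed

text \<open>
  The dense family consists of the finite unions of basic open sets: a measurable set is approximated
  from outside by an open set, and that set is the increasing union of such finite unions.
\<close>

lemma lebesgue_on_separable:
  fixes \<Omega> :: "'a::euclidean_space set"
  assumes \<Omega>: "\<Omega> \<in> lmeasurable"
  shows "\<exists>D. countable D \<and> D \<subseteq> sets (lebesgue_on \<Omega>) \<and>
    (\<forall>A\<in>sets (lebesgue_on \<Omega>). \<forall>e>0. \<exists>F\<in>D. measure (lebesgue_on \<Omega>) ((A - F) \<union> (F - A)) < e)"
proof -
  obtain \<B> :: "'a set set" where \<B>: "countable \<B>" "topological_basis \<B>"
    using ex_countable_basis by blast
  define D where "D = (\<lambda>F. \<Omega> \<inter> \<Union>F) ` {F. finite F \<and> F \<subseteq> \<B>}"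
  have \<B>_sets: "B \<in> sets lebesgue" if "B \<in> \<B>" for B
    using topological_basis_open[OF \<B>(2) that] by auto
  have \<Omega>_sets: "\<Omega> \<in> sets lebesgue" using \<Omega> by auto
  have D_sets: "D \<subseteq> sets (lebesgue_on \<Omega>)"
  proof
    fix G assume "G \<in> D"
    then obtain F where F: "finite F" "F \<subseteq> \<B>" "G = \<Omega> \<inter> \<Union>F" by (auto simp: D_def)
    have "\<Union>F \<in> sets lebesgue" using F \<B>_sets by (intro sets.finite_Union) auto
    then show "G \<in> sets (lebesgue_on \<Omega>)" unfolding F(3) sets_restrict_space by auto
  qed
  interpret finite_measure "lebesgue_on \<Omega>" by (rule finite_measure_lebesgue_on[OF \<Omega>])
  let ?\<mu> = "measure (lebesgue_on \<Omega>)"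
  have "\<exists>F\<in>D. ?\<mu> ((A - F) \<union> (F - A)) < e" if A: "A \<in> sets (lebesgue_on \<Omega>)" and e: "e > 0" for A and e :: real
  proof -
    have A': "A \<in> sets lebesgue" "A \<subseteq> \<Omega>" using A \<Omega>_sets by (auto simp: sets_restrict_space_iff)
    obtain U where U: "open U" "A \<subseteq> U" "U - A \<in> lmeasurable" "emeasure lebesgue (U - A) < ennreal (e / 2)"
      using sets_lebesgue_outer_open[OF A'(1), of "e / 2"] e by auto
    obtain \<C> where \<C>: "\<C> \<subseteq> \<B>" "\<Union>\<C> = U" using \<B>(2) U(1) unfolding topological_basis_def by blast
    have UA: "?\<mu> (\<Omega> \<inter> (U - A)) < e / 2"
    proof -
      have "?\<mu> (\<Omega> \<inter> (U - A)) = measure lebesgue (\<Omega> \<inter> (U - A))"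
        using \<Omega>_sets by (intro measure_restrict_space) auto
      also have "\<dots> \<le> measure lebesgue (U - A)"
        using U(3) \<Omega>_sets by (intro measure_mono_fmeasurable) auto
      also have "\<dots> < e / 2"
        using U(3,4) e by (simp add: emeasure_eq_measure2 ennreal_less_iff)
      finally show ?thesis .
    qed
    have "\<exists>F\<in>D. F \<subseteq> U \<and> ?\<mu> (\<Omega> \<inter> U - F) < e / 2"
    proof (cases "\<C> = {}")
      case True
      then have "{} \<in> D" unfolding D_def by (intro image_eqI[of _ _ "{}"]) auto
      then show ?thesis using True \<C>(2) e by (intro bexI[of _ "{}"]) auto
    next
      case False
      have "countable \<C>" using \<B>(1) \<C>(1) by (rule countable_subset[rotated])
      define V where "V n = \<Omega> \<inter> \<Union>(from_nat_into \<C> ` {..n})" for n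
      have V_D: "V n \<in> D" for n
        unfolding D_def V_def using \<C>(1) from_nat_into[OF False]
        by (intro image_eqI[of _ _ "from_nat_into \<C> ` {..n}"]) auto
      have V_sets: "V n \<in> sets (lebesgue_on \<Omega>)" for n
        using V_D D_sets by auto
      have V_U: "V n \<subseteq> U" for n
        unfolding V_def using \<C>(2) from_nat_into[OF False] by auto
      have V_union: "(\<Union>n. V n) = \<Omega> \<inter> U"
      proof -
        have "(\<Union>n. from_nat_into \<C> n) = U"
          using range_from_nat_into[OF False \<open>countable \<C>\<close>] \<C>(2) by auto
        then show ?thesis unfolding V_def by auto
      qed
      have U_sets: "\<Omega> \<inter> U \<in> sets (lebesgue_on \<Omega>)"
        using U(1) \<Omega>_sets by (auto simp: sets_restrict_space)
      have "(\<lambda>n. ?\<mu> (V n)) \<longlonglongrightarrow> ?\<mu> (\<Union>n. V n)"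
      proof (rule finite_Lim_measure_incseq)
        show "incseq V" unfolding V_def incseq_def by force
      qed (use V_sets in auto)
      then have "(\<lambda>n. ?\<mu> (V n)) \<longlonglongrightarrow> ?\<mu> (\<Omega> \<inter> U)" unfolding V_union .
      from order_tendstoD(1)[OF this, of "?\<mu> (\<Omega> \<inter> U) - e / 2"] e
      obtain n where n: "?\<mu> (\<Omega> \<inter> U) - e / 2 < ?\<mu> (V n)"
        by (auto simp: eventually_sequentially)
      have "?\<mu> (\<Omega> \<inter> U - V n) = ?\<mu> (\<Omega> \<inter> U) - ?\<mu> (V n)"
        using V_U[of n] V_def by (intro finite_measure_Diff U_sets V_sets) auto
      then show ?thesis using V_D[of n] V_U[of n] n by (intro bexI[of _ "V n"]) auto
    qed
    then obtain F where F: "F \<in> D" "F \<subseteq> U" "?\<mu> (\<Omega> \<inter> U - F) < e / 2" by auto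
    have F_sets: "F \<in> sets (lebesgue_on \<Omega>)" using F(1) D_sets by auto
    then have F_sub: "F \<subseteq> \<Omega>" using sets.sets_into_space by fastforce
    have sets1: "\<Omega> \<inter> U - F \<in> sets (lebesgue_on \<Omega>)" "\<Omega> \<inter> (U - A) \<in> sets (lebesgue_on \<Omega>)"
    proof -
      have "U \<in> sets lebesgue" using U(1) by auto
      then show "\<Omega> \<inter> U - F \<in> sets (lebesgue_on \<Omega>)" "\<Omega> \<inter> (U - A) \<in> sets (lebesgue_on \<Omega>)"
        using F_sets A'(1) \<Omega>_sets by (auto simp: sets_restrict_space_iff intro!: sets.Diff sets.Int)
    qed
    have "?\<mu> ((A - F) \<union> (F - A)) \<le> ?\<mu> ((\<Omega> \<inter> U - F) \<union> (\<Omega> \<inter> (U - A)))"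
      using A' U(2) F(2) F_sub sets1 by (intro finite_measure_mono) auto
    also have "\<dots> \<le> ?\<mu> (\<Omega> \<inter> U - F) + ?\<mu> (\<Omega> \<inter> (U - A))"
      using sets1 by (intro measure_Un_le)
    also have "\<dots> < e" using F(3) UA by simp
    finally show ?thesis using F(1) by blast
  qed
  moreover have "countable D"
    unfolding D_def using \<B>(1) by (intro countable_image countable_Collect_finite_subset)
  ultimately show ?thesis using D_sets by blast
qed

section \<open>The Kullback--Leibler integrand\<close>

definition kl :: "real \<Rightarrow> real \<Rightarrow> real" where
  "kl v u = v * ln (v / u) - v + u"

lemma kl_measurable[measurable]:
  assumes "f \<in> borel_measurable M" "g \<in> borel_measurable M"
  shows "(\<lambda>t. kl (f t) (g t)) \<in> borel_measurable M"
  using assms unfolding kl_def by measurable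

text \<open>
  This is \<open>ln r \<le> r - 1\<close> for \<open>r = \<surd>(u / v)\<close>.
\<close>

lemma sqrt_diff_square_le_kl:
  assumes "v \<ge> 0" "u > 0"
  shows "(sqrt v - sqrt u)\<^sup>2 \<le> kl v u"
proof (cases "v = 0")
  case False
  then have v: "v > 0" using assms by simp
  have "ln (u / v) = 2 * ln (sqrt (u / v))"
    using v assms(2) by (simp add: ln_sqrt)
  also have "\<dots> \<le> 2 * (sqrt (u / v) - 1)"
    using ln_le_minus_one[of "sqrt (u / v)"] v assms(2) by simp
  finally have "v * ln (u / v) \<le> v * (2 * (sqrt (u / v) - 1))"
    using v by (intro mult_left_mono) auto
  also have "\<dots> = 2 * (sqrt v * sqrt u) - 2 * v"
  proof -
    have "v * sqrt (u / v) = sqrt v * sqrt u"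
      using v by (simp add: real_sqrt_divide real_div_sqrt field_simps)
    then show ?thesis by (simp add: algebra_simps)
  qed
  finally have "v * ln (u / v) \<le> 2 * (sqrt v * sqrt u) - 2 * v" .
  moreover have "ln (v / u) = - ln (u / v)"
    using v assms(2) by (simp add: ln_div)
  ultimately show ?thesis
    using v assms(2) by (simp add: kl_def power2_eq_square algebra_simps)
qed (use assms in \<open>simp add: kl_def\<close>)

lemma kl_nonneg:
  assumes "v \<ge> 0" "u \<ge> 0" "u = 0 \<Longrightarrow> v = 0"
  shows "0 \<le> kl v u"
  using sqrt_diff_square_le_kl[of v u] assms
  by (cases "u = 0") (auto simp: kl_def intro: order_trans[rotated])

lemma kl_le:
  assumes "v \<ge> 0" "u > 0"
  shows "kl v u \<le> (v - u)\<^sup>2 / u"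
proof (cases "v = 0")
  case False
  then have v: "v > 0" using assms by simp
  have "v * ln (v / u) \<le> v * (v / u - 1)"
    using v assms(2) by (intro mult_left_mono ln_le_minus_one) auto
  then show ?thesis
    using assms(2) by (simp add: kl_def power2_eq_square field_simps)
qed (use assms in \<open>simp add: kl_def power2_eq_square\<close>)

lemma square_diff_le_kl:
  assumes "0 \<le> v" "v \<le> C" "0 < u" "u \<le> C"
  shows "(v - u)\<^sup>2 \<le> 4 * C * kl v u"
proof -
  have "v - u = (sqrt v - sqrt u) * (sqrt v + sqrt u)"
    using assms by (simp add: algebra_simps)
  then have "(v - u)\<^sup>2 = (sqrt v + sqrt u)\<^sup>2 * (sqrt v - sqrt u)\<^sup>2"
    by (simp add: power_mult_distrib)
  also have "(sqrt v + sqrt u)\<^sup>2 \<le> (2 * sqrt C)\<^sup>2"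
    using assms by (intro power_mono) (auto intro: add_mono[of _ "sqrt C" _ "sqrt C", simplified])
  then have "(sqrt v + sqrt u)\<^sup>2 * (sqrt v - sqrt u)\<^sup>2 \<le> (2 * sqrt C)\<^sup>2 * kl v u"
    using assms by (intro mult_mono sqrt_diff_square_le_kl) auto
  finally show ?thesis using assms by (simp add: power_mult_distrib)
qed

text \<open>
  A substitute for Pinsker's inequality: integrated over two probability densities it bounds their
  \<open>L\<^sup>1\<close> distance by \<open>d(v, u) / e + 2 e\<close>, and \<open>e\<close> can be chosen small.
\<close>

lemma abs_diff_le_kl:
  assumes "0 \<le> v" "0 \<le> u" "u = 0 \<Longrightarrow> v = 0" "e > 0"
  shows "\<bar>v - u\<bar> \<le> kl v u / e + e * (v + u)"
proof (cases "u = 0")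
  case False
  define p q where "p = \<bar>sqrt v - sqrt u\<bar>" and "q = sqrt v + sqrt u"
  have "v - u = (sqrt v - sqrt u) * (sqrt v + sqrt u)"
    using assms by (simp add: algebra_simps)
  then have "\<bar>v - u\<bar> = p * q"
    using assms by (simp add: p_def q_def abs_mult)
  also have "\<dots> \<le> (p\<^sup>2 / e + e * q\<^sup>2) / 2"
  proof -
    have "0 \<le> (p - e * q)\<^sup>2 / e" using assms by simp
    also have "(p - e * q)\<^sup>2 / e = p\<^sup>2 / e + e * q\<^sup>2 - 2 * (p * q)"
      using assms by (simp add: power2_eq_square field_simps)
    finally show ?thesis by simp
  qed
  also have "\<dots> \<le> p\<^sup>2 / e + e * (v + u)"
  proof -
    have "q\<^sup>2 \<le> 2 * (v + u)"
      using assms sum_squares_bound[of "sqrt v" "sqrt u"] by (simp add: q_def power2_sum)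
    then have "e * q\<^sup>2 \<le> e * (2 * (v + u))" using assms by (intro mult_left_mono) auto
    moreover have "0 \<le> p\<^sup>2 / e" using assms by simp
    ultimately show ?thesis by (simp add: field_simps)
  qed
  also have "\<dots> \<le> kl v u / e + e * (v + u)"
    using sqrt_diff_square_le_kl[of v u] assms False
    by (intro add_right_mono divide_right_mono) (auto simp: p_def)
  finally show ?thesis .
qed (use assms in \<open>simp add: kl_def\<close>)

lemma KL_integrand_eq_kl:
  assumes "u = 0 \<Longrightarrow> v \<le> 0"
  shows "KL_integrand v u = ennreal (kl v u)"
  using assms by (auto simp: KL_integrand_def kl_def)

lemma KL_dist_eq_integral:
  assumes int: "integrable M (\<lambda>t. kl (v t) (u t))"
    and AE: "AE t in M. 0 \<le> v t \<and> 0 \<le> u t \<and> (u t = 0 \<longrightarrow> v t = 0)"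
  shows "KL_dist M v u = ennreal (\<integral>t. kl (v t) (u t) \<partial>M)" "0 \<le> (\<integral>t. kl (v t) (u t) \<partial>M)"
proof -
  have nonneg: "AE t in M. 0 \<le> kl (v t) (u t)"
    using AE by eventually_elim (auto intro: kl_nonneg)
  have "KL_dist M v u = (\<integral>\<^sup>+t. ennreal (kl (v t) (u t)) \<partial>M)"
    unfolding KL_dist_def
    using AE by (intro nn_integral_cong_AE, eventually_elim) (auto intro: KL_integrand_eq_kl)
  also have "\<dots> = ennreal (\<integral>t. kl (v t) (u t) \<partial>M)"
    by (rule nn_integral_eq_integral[OF int nonneg])
  finally show "KL_dist M v u = ennreal (\<integral>t. kl (v t) (u t) \<partial>M)" .
  show "0 \<le> (\<integral>t. kl (v t) (u t) \<partial>M)" using nonneg by (rule integral_nonneg_AE)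
qed

lemma KL_dist_finiteD:
  assumes [measurable]: "v \<in> borel_measurable M" "u \<in> borel_measurable M"
    and AE: "AE t in M. 0 \<le> v t \<and> 0 \<le> u t" and fin: "KL_dist M v u < \<infinity>"
  shows "AE t in M. u t = 0 \<longrightarrow> v t = 0" "integrable M (\<lambda>t. kl (v t) (u t))"
proof -
  have "AE t in M. KL_integrand (v t) (u t) \<noteq> \<infinity>"
    using fin unfolding KL_dist_def
    by (intro nn_integral_PInf_AE) (auto simp: KL_integrand_def[abs_def])
  with AE show zero: "AE t in M. u t = 0 \<longrightarrow> v t = 0"
    by eventually_elim (auto simp: KL_integrand_def split: if_splits)
  show "integrable M (\<lambda>t. kl (v t) (u t))"
  proof (rule integrableI_nonneg)
    show "AE t in M. 0 \<le> kl (v t) (u t)"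
      using AE zero by eventually_elim (auto intro: kl_nonneg)
    have "(\<integral>\<^sup>+t. ennreal (kl (v t) (u t)) \<partial>M) = KL_dist M v u"
      unfolding KL_dist_def
      using AE zero by (intro nn_integral_cong_AE, eventually_elim) (auto intro: KL_integrand_eq_kl[symmetric])
    then show "(\<integral>\<^sup>+t. ennreal (kl (v t) (u t)) \<partial>M) < \<infinity>" using fin by simp
  qed measurable
qed

lemma KL_dist_cong_AE:
  assumes "AE t in M. v t = v' t" "AE t in M. u t = u' t"
  shows "KL_dist M v u = KL_dist M v' u'"
  unfolding KL_dist_def using assms by (intro nn_integral_cong_AE) (auto elim: eventually_elim2)

section \<open>Integral operators with bounded kernels\<close>

definition kernel_op :: "'t measure \<Rightarrow> ('s \<Rightarrow> 't \<Rightarrow> real) \<Rightarrow> ('t \<Rightarrow> real) \<Rightarrow> 's \<Rightarrow> real" where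
  "kernel_op T b x s = (\<integral>t. b s t * x t \<partial>T)"

definition is_density :: "'t measure \<Rightarrow> ('t \<Rightarrow> real) \<Rightarrow> bool" where
  "is_density T x \<longleftrightarrow> integrable T x \<and> (AE t in T. 0 \<le> x t) \<and> (\<integral>t. x t \<partial>T) = 1"

text \<open>
  The bounds hold at every point rather than almost everywhere, so that each section of the kernel is
  bounded and no exceptional sets appear in pointwise estimates.
\<close>

locale bounded_kernel = S: finite_measure S + T: finite_measure T
  for S :: "'s measure" and T :: "'t measure" +
  fixes b :: "'s \<Rightarrow> 't \<Rightarrow> real" and m M :: real
  assumes kernel_meas: "case_prod b \<in> borel_measurable (S \<Otimes>\<^sub>M T)"
    and m_pos: "0 < m" and lower: "m \<le> b s t" and upper: "b s t \<le> M"
begin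

sublocale pair_sigma_finite S T ..

abbreviation A where "A \<equiv> kernel_op T b"
abbreviation A' where "A' \<equiv> kernel_op S (\<lambda>t s. b s t)"

lemma M_pos: "0 < M" using m_pos lower upper by (meson less_le_trans)

lemma kernel_pos: "0 < b s t" using m_pos lower by (meson less_le_trans)

lemma abs_kernel_mult_le: "\<bar>b s t * c\<bar> \<le> M * \<bar>c\<bar>"
  by (simp add: abs_mult abs_of_pos[OF kernel_pos] mult_right_mono upper)

lemma section_meas:
  "s \<in> space S \<Longrightarrow> (\<lambda>t. b s t) \<in> borel_measurable T"
  "t \<in> space T \<Longrightarrow> (\<lambda>s. b s t) \<in> borel_measurable S"
proof -
  note [measurable] = kernel_meas
  show "s \<in> space S \<Longrightarrow> (\<lambda>t. b s t) \<in> borel_measurable T"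
    using measurable_compose[OF _ kernel_meas, of "\<lambda>t. (s, t)" T] by simp
  show "t \<in> space T \<Longrightarrow> (\<lambda>s. b s t) \<in> borel_measurable S"
    using measurable_compose[OF _ kernel_meas, of "\<lambda>s. (s, t)" S] by simp
qed

lemma integrable_section:
  assumes x: "integrable T x" and s: "s \<in> space S"
  shows "integrable T (\<lambda>t. b s t * x t)"
proof (rule Bochner_Integration.integrable_bound)
  show "integrable T (\<lambda>t. M * x t)" using x by simp
  show "AE t in T. norm (b s t * x t) \<le> norm (M * x t)"
    using abs_kernel_mult_le M_pos by (intro AE_I2) (simp add: abs_mult[of M])
  show "(\<lambda>t. b s t * x t) \<in> borel_measurable T"
    using section_meas(1)[OF s] x by auto
qed

lemma integrable_cosection:
  assumes g: "integrable S g" and t: "t \<in> space T"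
  shows "integrable S (\<lambda>s. b s t * g s)"
proof (rule Bochner_Integration.integrable_bound)
  show "integrable S (\<lambda>s. M * g s)" using g by simp
  show "AE s in S. norm (b s t * g s) \<le> norm (M * g s)"
    using abs_kernel_mult_le M_pos by (intro AE_I2) (simp add: abs_mult[of M])
  show "(\<lambda>s. b s t * g s) \<in> borel_measurable S"
    using section_meas(2)[OF t] g by auto
qed

lemma A_meas:
  assumes [measurable]: "x \<in> borel_measurable T"
  shows "A x \<in> borel_measurable S"
proof -
  note [measurable] = kernel_meas
  show ?thesis unfolding kernel_op_def[abs_def] by measurable
qed

lemma A'_meas:
  assumes [measurable]: "g \<in> borel_measurable S"
  shows "A' g \<in> borel_measurable T"
proof -
  note [measurable] = kernel_meas
  show ?thesis unfolding kernel_op_def[abs_def] by measurable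
qed

text \<open>
  Fubini's theorem for the product of \<open>b\<close> with the two integrable functions \<open>g\<close> and \<open>x\<close>.
\<close>

lemma adjoint:
  assumes g: "integrable S g" and x: "integrable T x"
  shows "integrable S (\<lambda>s. g s * A x s)" "integrable T (\<lambda>t. A' g t * x t)"
    "(\<integral>s. g s * A x s \<partial>S) = (\<integral>t. A' g t * x t \<partial>T)"
proof -
  note [measurable] = kernel_meas
  have [measurable]: "g \<in> borel_measurable S" "x \<in> borel_measurable T" using g x by auto
  have int: "integrable (S \<Otimes>\<^sub>M T) (\<lambda>(s, t). g s * (b s t * x t))"
  proof (rule Fubini_integrable)
    show "AE s in S. integrable T (\<lambda>t. case (s, t) of (s, t) \<Rightarrow> g s * (b s t * x t))"
      using x by (intro AE_I2) (auto intro: integrable_section)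
    show "integrable S (\<lambda>s. \<integral>t. norm (case (s, t) of (s, t) \<Rightarrow> g s * (b s t * x t)) \<partial>T)"
    proof (rule Bochner_Integration.integrable_bound)
      show "integrable S (\<lambda>s. (M * (\<integral>t. \<bar>x t\<bar> \<partial>T)) * \<bar>g s\<bar>)" using g by auto
      show "AE s in S. norm (\<integral>t. norm (case (s, t) of (s, t) \<Rightarrow> g s * (b s t * x t)) \<partial>T)
          \<le> norm ((M * (\<integral>t. \<bar>x t\<bar> \<partial>T)) * \<bar>g s\<bar>)"
      proof (rule AE_I2)
        fix s assume s: "s \<in> space S"
        have "(\<integral>t. \<bar>g s * (b s t * x t)\<bar> \<partial>T) \<le> (\<integral>t. \<bar>g s\<bar> * (M * \<bar>x t\<bar>) \<partial>T)"
        proof (rule integral_mono)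
          show "integrable T (\<lambda>t. \<bar>g s * (b s t * x t)\<bar>)"
            using integrable_section[OF x s] by auto
          show "\<bar>g s * (b s t * x t)\<bar> \<le> \<bar>g s\<bar> * (M * \<bar>x t\<bar>)" for t
            using upper[of s t] kernel_pos[of s t]
            by (simp add: abs_mult mult_left_mono mult_right_mono)
        qed (use x in auto)
        moreover have "0 \<le> (\<integral>t. \<bar>g s * (b s t * x t)\<bar> \<partial>T)" by (intro integral_nonneg_AE) simp
        moreover have "0 \<le> (\<integral>t. \<bar>x t\<bar> \<partial>T)" by (intro integral_nonneg_AE) simp
        ultimately show "norm (\<integral>t. norm (case (s, t) of (s, t) \<Rightarrow> g s * (b s t * x t)) \<partial>T)
            \<le> norm ((M * (\<integral>t. \<bar>x t\<bar> \<partial>T)) * \<bar>g s\<bar>)"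
          using M_pos by (simp add: abs_mult mult_ac)
      qed
    qed measurable
  qed measurable
  have eqS: "(\<integral>t. g s * (b s t * x t) \<partial>T) = g s * A x s" for s
    by (simp add: kernel_op_def)
  have eqT: "(\<integral>s. g s * (b s t * x t) \<partial>S) = A' g t * x t" for t
  proof -
    have "(\<integral>s. g s * (b s t * x t) \<partial>S) = (\<integral>s. (b s t * g s) * x t \<partial>S)"
      by (simp add: mult_ac)
    also have "\<dots> = A' g t * x t"
      unfolding kernel_op_def by (rule Bochner_Integration.integral_mult_left_zero)
    finally show ?thesis .
  qed
  show "integrable S (\<lambda>s. g s * A x s)"
    using integrable_fst[OF int] by (simp only: eqS)
  show "integrable T (\<lambda>t. A' g t * x t)"
    using integrable_snd[OF int] by (simp only: eqT)
  show "(\<integral>s. g s * A x s \<partial>S) = (\<integral>t. A' g t * x t \<partial>T)"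
    using Fubini_integral[OF int] by (simp only: eqS eqT)
qed

lemma A_bounds:
  assumes "is_density T x" "s \<in> space S"
  shows "m \<le> A x s" "A x s \<le> M"
proof -
  have x: "integrable T x" "AE t in T. 0 \<le> x t" "(\<integral>t. x t \<partial>T) = 1"
    using assms(1) by (auto simp: is_density_def)
  have "(\<integral>t. m * x t \<partial>T) \<le> A x s" unfolding kernel_op_def
    using x(2) by (intro integral_mono_AE integrable_section assms(2))
      (use x in \<open>auto intro: mult_right_mono lower elim!: eventually_mono\<close>)
  then show "m \<le> A x s" using x by simp
  have "A x s \<le> (\<integral>t. M * x t \<partial>T)" unfolding kernel_op_def
    using x(2) by (intro integral_mono_AE integrable_section assms(2))
      (use x in \<open>auto intro: mult_right_mono upper elim!: eventually_mono\<close>)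
  then show "A x s \<le> M" using x by simp
qed

lemma A_diff_le:
  assumes "integrable T x" "integrable T x'" "s \<in> space S"
  shows "\<bar>A x s - A x' s\<bar> \<le> M * (\<integral>t. \<bar>x t - x' t\<bar> \<partial>T)"
proof -
  have "A x s - A x' s = (\<integral>t. b s t * (x t - x' t) \<partial>T)"
    using integrable_section[OF _ assms(3)] assms(1,2) by (simp add: kernel_op_def right_diff_distrib)
  also have "\<bar>\<dots>\<bar> \<le> (\<integral>t. \<bar>b s t * (x t - x' t)\<bar> \<partial>T)" by (rule integral_abs_bound)
  also have "\<dots> \<le> (\<integral>t. M * \<bar>x t - x' t\<bar> \<partial>T)"
  proof (rule integral_mono)
    show "integrable T (\<lambda>t. \<bar>b s t * (x t - x' t)\<bar>)"
      by (intro integrable_abs integrable_section Bochner_Integration.integrable_diff assms)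
    show "\<bar>b s t * (x t - x' t)\<bar> \<le> M * \<bar>x t - x' t\<bar>" for t
      using upper[of s t] kernel_pos[of s t] by (simp add: abs_mult mult_right_mono)
  qed (use assms in auto)
  finally show ?thesis by simp
qed

lemma A_cong_AE:
  assumes "x \<in> borel_measurable T" "x' \<in> borel_measurable T" "AE t in T. x t = x' t" "s \<in> space S"
  shows "A x s = A x' s"
  unfolding kernel_op_def
  using section_meas(1)[OF assms(4)] assms by (intro integral_cong_AE) (auto elim!: eventually_mono)

end

section \<open>One step of the EM iteration\<close>

text \<open>
  The factor \<open>w = A\<^sup>*(y / A x)\<close> by which an EM step multiplies \<open>x\<close>.
\<close>

definition em_factor ::
  "'s measure \<Rightarrow> 't measure \<Rightarrow> ('s \<Rightarrow> 't \<Rightarrow> real) \<Rightarrow> ('s \<Rightarrow> real) \<Rightarrow> ('t \<Rightarrow> real) \<Rightarrow> 't \<Rightarrow> real" where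
  "em_factor S T b y x = kernel_op S (\<lambda>t s. b s t) (\<lambda>s. y s / kernel_op T b x s)"

locale em_problem = bounded_kernel +
  fixes y and C :: real
  assumes normalized: "AE t in T. (\<integral>s. b s t \<partial>S) = 1"
    and y_dens: "is_density S y"
    and y_le: "AE s in S. y s \<le> C"
begin

lemma y_props: "integrable S y" "AE s in S. 0 \<le> y s" "(\<integral>s. y s \<partial>S) = 1" "y \<in> borel_measurable S"
  using y_dens by (auto simp: is_density_def)

lemma A_integral:
  assumes "integrable T x"
  shows "integrable S (A x)" "(\<integral>s. A x s \<partial>S) = (\<integral>t. x t \<partial>T)"
proof -
  have 1: "integrable S (\<lambda>s. 1::real)" by simp
  note adj = adjoint[OF 1 assms]
  show "integrable S (A x)" using adj(1) by simp
  have "(\<integral>s. A x s \<partial>S) = (\<integral>t. A' (\<lambda>s. 1) t * x t \<partial>T)" using adj(3) by simp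
  also have "\<dots> = (\<integral>t. x t \<partial>T)"
  proof (rule integral_cong_AE)
    show "AE t in T. A' (\<lambda>s. 1) t * x t = x t"
      using normalized by eventually_elim (simp add: kernel_op_def)
  qed (use assms A'_meas[of "\<lambda>s. 1"] in auto)
  finally show "(\<integral>s. A x s \<partial>S) = (\<integral>t. x t \<partial>T)" .
qed

text \<open>
  Data and image are bounded, and the image is bounded away from \<open>0\<close>, so the integrand is bounded.
\<close>

lemma kl_residual:
  assumes "is_density T x"
  shows "integrable S (\<lambda>s. kl (y s) (A x s))"
    "KL_dist S y (A x) = ennreal (\<integral>s. kl (y s) (A x s) \<partial>S)"
    "0 \<le> (\<integral>s. kl (y s) (A x s) \<partial>S)"
proof -
  have [measurable]: "x \<in> borel_measurable T" using assms by (auto simp: is_density_def)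
  note [measurable] = y_props(4) A_meas
  note bounds = A_bounds[OF assms]
  show int: "integrable S (\<lambda>s. kl (y s) (A x s))"
  proof (rule S.integrable_const_bound)
    show "AE s in S. norm (kl (y s) (A x s)) \<le> (C + M)\<^sup>2 / m"
      using y_props(2) y_le AE_space
    proof eventually_elim
      case (elim s)
      have pos: "0 < A x s" using bounds(1)[OF elim(3)] m_pos by simp
      have "kl (y s) (A x s) \<le> (y s - A x s)\<^sup>2 / A x s"
        using elim pos by (intro kl_le)
      also have "\<dots> \<le> (C + M)\<^sup>2 / m"
      proof (rule frac_le)
        have "\<bar>y s - A x s\<bar> \<le> \<bar>C + M\<bar>" using elim bounds[OF elim(3)] pos by simp
        then show "(y s - A x s)\<^sup>2 \<le> (C + M)\<^sup>2" by (simp add: abs_le_square_iff)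
      qed (use bounds[OF elim(3)] m_pos in auto)
      finally show ?case using kl_nonneg[of "y s" "A x s"] elim pos by simp
    qed
  qed measurable
  have AE: "AE s in S. 0 \<le> y s \<and> 0 \<le> A x s \<and> (A x s = 0 \<longrightarrow> y s = 0)"
    using y_props(2) AE_space
  proof eventually_elim
    case (elim s)
    then show ?case using bounds(1)[OF elim(2)] m_pos by simp
  qed
  from KL_dist_eq_integral[OF int AE]
  show "KL_dist S y (A x) = ennreal (\<integral>s. kl (y s) (A x s) \<partial>S)"
    "0 \<le> (\<integral>s. kl (y s) (A x s) \<partial>S)" .
qed

end

locale em_step = em_problem +
  fixes x x'
  assumes x_dens: "is_density T x"
    and x'_meas: "x' \<in> borel_measurable T"
    and step: "AE t in T. x' t = x t * em_factor S T b y x t"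
begin

abbreviation w where "w \<equiv> em_factor S T b y x"

lemma x_props: "integrable T x" "AE t in T. 0 \<le> x t" "(\<integral>t. x t \<partial>T) = 1" "x \<in> borel_measurable T"
  using x_dens by (auto simp: is_density_def)

lemma Ax: "s \<in> space S \<Longrightarrow> m \<le> A x s" "s \<in> space S \<Longrightarrow> A x s \<le> M" "s \<in> space S \<Longrightarrow> 0 < A x s"
  using A_bounds[OF x_dens] m_pos by (auto intro: less_le_trans)

lemma ratio: "integrable S (\<lambda>s. y s / A x s)" "AE s in S. 0 \<le> y s / A x s"
  "1 / M \<le> (\<integral>s. y s / A x s \<partial>S)" "(\<integral>s. y s / A x s \<partial>S) \<le> 1 / m"
proof -
  note [measurable] = y_props(4) A_meas[OF x_props(4)]
  show nonneg: "AE s in S. 0 \<le> y s / A x s"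
    using y_props(2) AE_space by eventually_elim (auto simp: Ax less_imp_le)
  have up: "AE s in S. y s / A x s \<le> y s / m"
    using y_props(2) AE_space
    by eventually_elim (use Ax m_pos in \<open>auto intro!: divide_left_mono mult_pos_pos\<close>)
  have low: "AE s in S. y s / M \<le> y s / A x s"
    using y_props(2) AE_space
    by eventually_elim (use Ax M_pos in \<open>auto intro!: divide_left_mono mult_pos_pos\<close>)
  show int: "integrable S (\<lambda>s. y s / A x s)"
  proof (rule Bochner_Integration.integrable_bound)
    show "integrable S (\<lambda>s. y s / m)" using y_props by simp
    show "AE s in S. norm (y s / A x s) \<le> norm (y s / m)"
      using nonneg up by eventually_elim (metis abs_of_nonneg order_trans real_norm_def)
  qed measurable
  have "(\<integral>s. y s / M \<partial>S) \<le> (\<integral>s. y s / A x s \<partial>S)"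
    by (rule integral_mono_AE) (use y_props int low in auto)
  then show "1 / M \<le> (\<integral>s. y s / A x s \<partial>S)" using y_props by simp
  have "(\<integral>s. y s / A x s \<partial>S) \<le> (\<integral>s. y s / m \<partial>S)"
    by (rule integral_mono_AE) (use y_props int up in auto)
  then show "(\<integral>s. y s / A x s \<partial>S) \<le> 1 / m" using y_props by simp
qed

lemma w_meas: "w \<in> borel_measurable T"
  unfolding em_factor_def using ratio(1) by (intro A'_meas) auto

text \<open>
  \<open>w\<close> integrates the kernel against the weight \<open>y / A x\<close>, whose total mass lies between \<open>1 / M\<close> and \<open>1 / m\<close>.
  These bounds make \<open>ln w\<close> bounded, which gives integrability in all the computations below.
\<close>

lemma w_bounds:
  assumes "t \<in> space T"
  shows "m / M \<le> w t" "w t \<le> M / m"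
proof -
  have "(\<integral>s. m * (y s / A x s) \<partial>S) \<le> w t" unfolding em_factor_def kernel_op_def[of S]
    using ratio(2) integrable_cosection[OF ratio(1) assms] ratio(1)
    by (intro integral_mono_AE) (auto intro: mult_right_mono lower elim!: eventually_mono simp del: times_divide_eq_right)
  moreover have "m * (1 / M) \<le> m * (\<integral>s. y s / A x s \<partial>S)"
    using ratio(3) m_pos by (intro mult_left_mono) auto
  ultimately show "m / M \<le> w t"
    by (simp only: Bochner_Integration.integral_mult_right_zero) simp
  have "w t \<le> (\<integral>s. M * (y s / A x s) \<partial>S)" unfolding em_factor_def kernel_op_def[of S]
    using ratio(2) integrable_cosection[OF ratio(1) assms] ratio(1)
    by (intro integral_mono_AE) (auto intro: mult_right_mono upper elim!: eventually_mono simp del: times_divide_eq_right)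
  moreover have "M * (\<integral>s. y s / A x s \<partial>S) \<le> M * (1 / m)"
    using ratio(4) M_pos by (intro mult_left_mono) auto
  ultimately show "w t \<le> M / m"
    by (simp only: Bochner_Integration.integral_mult_right_zero) simp
qed

lemma w_pos: "t \<in> space T \<Longrightarrow> 0 < w t"
  using w_bounds(1)[of t] divide_pos_pos[OF m_pos M_pos] by simp

lemma ln_w_bound: "t \<in> space T \<Longrightarrow> \<bar>ln (w t)\<bar> \<le> ln (M / m)"
proof -
  assume t: "t \<in> space T"
  have "ln (w t) \<le> ln (M / m)" using w_bounds(2)[OF t] w_pos[OF t] by simp
  moreover have "ln (m / M) \<le> ln (w t)"
    using w_bounds(1)[OF t] w_pos[OF t] m_pos M_pos by simp
  moreover have "ln (m / M) = - ln (M / m)" using m_pos M_pos by (simp add: ln_div)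
  ultimately show ?thesis by linarith
qed

lemma integrable_mult_ln_w:
  assumes "integrable T u"
  shows "integrable T (\<lambda>t. u t * ln (w t))"
proof (rule Bochner_Integration.integrable_bound)
  show "integrable T (\<lambda>t. ln (M / m) * u t)" using assms by simp
  show "AE t in T. norm (u t * ln (w t)) \<le> norm (ln (M / m) * u t)"
  proof (rule AE_I2)
    fix t assume "t \<in> space T"
    from mult_left_mono[OF ln_w_bound[OF this] abs_ge_zero[of "u t"]]
    have "\<bar>u t\<bar> * \<bar>ln (w t)\<bar> \<le> \<bar>u t\<bar> * \<bar>ln (M / m)\<bar>"
      by (rule order_trans) (intro mult_left_mono, auto)
    then show "norm (u t * ln (w t)) \<le> norm (ln (M / m) * u t)" by (simp add: abs_mult mult_ac)
  qed
  note [measurable] = w_meas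
  show "(\<lambda>t. u t * ln (w t)) \<in> borel_measurable T" using assms by measurable
qed

lemma ratio_mult: "s \<in> space S \<Longrightarrow> y s / A x s * A x s = y s"
  using Ax(3)[of s] by auto

lemma xw: "integrable T (\<lambda>t. x t * w t)" "(\<integral>t. x t * w t \<partial>T) = 1"
proof -
  note adj = adjoint[OF ratio(1) x_props(1)]
  show "integrable T (\<lambda>t. x t * w t)" using adj(2) by (simp add: em_factor_def mult.commute)
  have "(\<integral>t. x t * w t \<partial>T) = (\<integral>s. y s / A x s * A x s \<partial>S)"
    using adj(3) by (simp add: em_factor_def mult.commute)
  also have "\<dots> = (\<integral>s. y s \<partial>S)"
    by (intro Bochner_Integration.integral_cong refl ratio_mult)
  finally show "(\<integral>t. x t * w t \<partial>T) = 1" using y_props by simp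
qed

lemma x'_dens: "is_density T x'"
  unfolding is_density_def
proof (intro conjI)
  note [measurable] = w_meas x_props(4) x'_meas
  show "integrable T x'"
    by (rule integrable_cong_AE_imp[OF xw(1)]) (use step in \<open>auto elim!: eventually_mono\<close>)
  show "AE t in T. 0 \<le> x' t"
    using step x_props(2) AE_space by eventually_elim (auto intro!: mult_nonneg_nonneg simp: w_pos less_imp_le)
  have "(\<integral>t. x' t \<partial>T) = (\<integral>t. x t * w t \<partial>T)"
    using step by (intro integral_cong_AE) auto
  then show "(\<integral>t. x' t \<partial>T) = 1" using xw by simp
qed

text \<open>
  Let \<open>c = A x' / A x\<close>. The difference of the two residuals is the integral of \<open>y ln c\<close>, and \<open>d(x', x)\<close>
  is the integral of \<open>x' ln w\<close>. Jensen's inequality gives \<open>A (x ln w) \<le> A x ln c\<close> pointwise; multiplying by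
  \<open>y / A x\<close> and moving the kernel to the other side by \<open>adjoint\<close> compares the two integrals.
\<close>

lemma descent: "KL_dist S y (A x') + KL_dist T x' x \<le> KL_dist S y (A x)"
proof -
  note [measurable] = w_meas x_props(4) x'_meas y_props(4) A_meas
  define c where "c s = A x' s / A x s" for s
  have [measurable]: "c \<in> borel_measurable S" unfolding c_def by measurable
  note Ax' = A_bounds[OF x'_dens]
  have c_pos: "0 < c s" if "s \<in> space S" for s
    using Ax(3)[OF that] Ax'(1)[OF that] m_pos by (simp add: c_def)
  have Ax'_eq: "A x' s = (\<integral>t. b s t * (x t * w t) \<partial>T)" if "s \<in> space S" for s
    using A_cong_AE[OF x'_meas _ step that] by (simp add: kernel_op_def)
  \<comment> \<open>Jensen's inequality via the tangent of \<open>ln\<close> at \<open>c s\<close>, the mean of \<open>w\<close>\<close>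
  have jensen: "A (\<lambda>t. x t * ln (w t)) s \<le> A x s * ln (c s)" if s: "s \<in> space S" for s
  proof -
    have "A (\<lambda>t. x t * ln (w t)) s
        \<le> (\<integral>t. (ln (c s) - 1) * (b s t * x t) + (b s t * (x t * w t)) / c s \<partial>T)"
      unfolding kernel_op_def
    proof (rule integral_mono_AE)
      show "AE t in T. b s t * (x t * ln (w t))
          \<le> (ln (c s) - 1) * (b s t * x t) + (b s t * (x t * w t)) / c s"
        using x_props(2) AE_space
      proof eventually_elim
        case (elim t)
        have "ln (w t / c s) \<le> w t / c s - 1"
          using w_pos[OF elim(2)] c_pos[OF s] by (intro ln_le_minus_one) simp
        then have "ln (w t) \<le> ln (c s) - 1 + w t / c s"
          using w_pos[OF elim(2)] c_pos[OF s] by (simp add: ln_div)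
        then have "(b s t * x t) * ln (w t) \<le> (b s t * x t) * (ln (c s) - 1 + w t / c s)"
          using elim kernel_pos[of s t] by (intro mult_left_mono) auto
        then show ?case by (simp add: algebra_simps)
      qed
    qed (use integrable_section[OF x_props(1) s] integrable_section[OF xw(1) s]
        integrable_section[OF integrable_mult_ln_w[OF x_props(1)] s] in auto)
    also have "\<dots> = (ln (c s) - 1) * A x s + A x' s / c s"
      using integrable_section[OF x_props(1) s] integrable_section[OF xw(1) s] Ax'_eq[OF s]
      by (simp add: kernel_op_def)
    also have "A x' s / c s = A x s"
      using Ax(3)[OF s] Ax'(1)[OF s] m_pos by (simp add: c_def)
    finally show ?thesis by (simp add: algebra_simps)
  qed
  have kl_split: "kl (y s) (A x s) = kl (y s) (A x' s) + y s * ln (c s) + A x s - A x' s"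
    if "s \<in> space S" "0 \<le> y s" for s
    using that Ax(3)[OF that(1)] Ax'(1)[OF that(1)] m_pos
    by (cases "y s = 0") (auto simp: kl_def c_def ln_div algebra_simps)
  have A_int: "integrable S (A x)" "integrable S (A x')"
    "(\<integral>s. A x s \<partial>S) = 1" "(\<integral>s. A x' s \<partial>S) = 1"
    using A_integral[of x] A_integral[of x'] x_dens x'_dens by (auto simp: is_density_def)
  note F = kl_residual[OF x_dens] and F' = kl_residual[OF x'_dens]
  have yc_AE: "AE s in S. y s * ln (c s) = kl (y s) (A x s) - kl (y s) (A x' s) - A x s + A x' s"
    using y_props(2) AE_space by eventually_elim (use kl_split in auto)
  have yc_int: "integrable S (\<lambda>s. y s * ln (c s))"
    by (rule integrable_cong_AE_imp[of _ "\<lambda>s. kl (y s) (A x s) - kl (y s) (A x' s) - A x s + A x' s"])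
      (use F(1) F'(1) A_int yc_AE in auto)
  have "(\<integral>s. y s * ln (c s) \<partial>S) = (\<integral>s. kl (y s) (A x s) - kl (y s) (A x' s) - A x s + A x' s \<partial>S)"
    by (rule integral_cong_AE) (use yc_AE in auto)
  also have "\<dots> = (\<integral>s. kl (y s) (A x s) \<partial>S) - (\<integral>s. kl (y s) (A x' s) \<partial>S)"
    using F(1) F'(1) A_int by simp
  finally have yc: "(\<integral>s. y s * ln (c s) \<partial>S) = (\<integral>s. kl (y s) (A x s) \<partial>S) - (\<integral>s. kl (y s) (A x' s) \<partial>S)" .
  note adj = adjoint[OF ratio(1) integrable_mult_ln_w[OF x_props(1)]]
  have "(\<integral>t. w t * (x t * ln (w t)) \<partial>T) = (\<integral>s. y s / A x s * A (\<lambda>t. x t * ln (w t)) s \<partial>S)"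
    using adj(3) by (simp add: em_factor_def)
  also have "\<dots> \<le> (\<integral>s. y s * ln (c s) \<partial>S)"
  proof (rule integral_mono_AE[OF adj(1) yc_int])
    show "AE s in S. y s / A x s * A (\<lambda>t. x t * ln (w t)) s \<le> y s * ln (c s)"
      using ratio(2) AE_space
    proof eventually_elim
      case (elim s)
      have "y s / A x s * A (\<lambda>t. x t * ln (w t)) s \<le> y s / A x s * (A x s * ln (c s))"
        using elim jensen by (intro mult_left_mono)
      also have "\<dots> = y s * ln (c s)" using ratio_mult[OF elim(2)] by (simp only: mult.assoc[symmetric])
      finally show ?case .
    qed
  qed
  finally have main: "(\<integral>t. w t * (x t * ln (w t)) \<partial>T)
      \<le> (\<integral>s. kl (y s) (A x s) \<partial>S) - (\<integral>s. kl (y s) (A x' s) \<partial>S)" unfolding yc .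
  have wxl_int: "integrable T (\<lambda>t. w t * (x t * ln (w t)))"
    using adj(2) by (simp add: em_factor_def)
  have klT: "AE t in T. kl (x' t) (x t) = w t * (x t * ln (w t)) - x' t + x t"
    using step x_props(2) AE_space
    by eventually_elim (auto simp: kl_def)
  have x'_int: "integrable T x'" "(\<integral>t. x' t \<partial>T) = 1" using x'_dens by (auto simp: is_density_def)
  have klT_int: "integrable T (\<lambda>t. kl (x' t) (x t))"
    by (rule integrable_cong_AE_imp[of _ "\<lambda>t. w t * (x t * ln (w t)) - x' t + x t"])
      (use wxl_int x_props x'_int klT in auto)
  have "(\<integral>t. kl (x' t) (x t) \<partial>T) = (\<integral>t. w t * (x t * ln (w t)) - x' t + x t \<partial>T)"
    by (rule integral_cong_AE) (use klT in auto)
  also have "\<dots> = (\<integral>t. w t * (x t * ln (w t)) \<partial>T)"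
    using wxl_int x_props x'_int by simp
  finally have D: "(\<integral>t. kl (x' t) (x t) \<partial>T) = (\<integral>t. w t * (x t * ln (w t)) \<partial>T)" .
  have "AE t in T. 0 \<le> x' t \<and> 0 \<le> x t \<and> (x t = 0 \<longrightarrow> x' t = 0)"
    using step x_props(2) x'_dens unfolding is_density_def
    by (elim conjE) (auto elim: eventually_elim2 simp: eventually_conj_iff)
  from KL_dist_eq_integral[OF klT_int this]
  show ?thesis
    using F(2) F'(2) F'(3) main unfolding D
    by (auto simp: ennreal_plus[symmetric] simp del: ennreal_plus intro!: ennreal_leI)
qed

text \<open>
  The difference of the two distances is the integral of \<open>xs ln w\<close>. Jensen's inequality gives
  \<open>ln w \<ge> A\<^sup>*(ln (y / A x))\<close>, and integrating against \<open>xs\<close> turns the right-hand side into the integral of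
  \<open>ln (y / A x) A xs = ln (y / A x) y\<close>, which is the residual. A solution forces \<open>y \<ge> m\<close> almost everywhere,
  so the logarithm of \<open>y / A x\<close> is bounded.
\<close>

lemma solution_descent:
  assumes xs_int: "integrable T xs" and xs_nonneg: "AE t in T. 0 \<le> xs t"
    and sol: "AE s in S. A xs s = y s"
  shows "KL_dist T xs x' + KL_dist S y (A x) \<le> KL_dist T xs x"
proof (cases "KL_dist T xs x < \<infinity>")
  case False
  then show ?thesis by (simp add: not_less top_unique)
next
  case True
  note [measurable] = w_meas x_props(4) x'_meas y_props(4) A_meas
  have [measurable]: "xs \<in> borel_measurable T" using xs_int by auto
  have "(\<integral>t. xs t \<partial>T) = (\<integral>s. y s \<partial>S)"
    unfolding A_integral(2)[OF xs_int, symmetric] by (rule integral_cong_AE) (use sol in auto)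
  then have xs_dens: "is_density T xs"
    using xs_int xs_nonneg y_props by (simp add: is_density_def)
  have y_bounds: "AE s in S. m \<le> y s \<and> y s \<le> M"
    using sol AE_space by eventually_elim (use A_bounds[OF xs_dens] in metis)
  define g where "g s = y s / A x s" for s
  define r where "r s = ln (g s)" for s
  have [measurable]: "r \<in> borel_measurable S" unfolding r_def g_def by measurable
  have r_int: "integrable S r"
  proof (rule S.integrable_const_bound)
    show "AE s in S. norm (r s) \<le> ln (M / m)"
      using y_bounds AE_space
    proof eventually_elim
      case (elim s)
      have ys_pos: "0 < y s" using elim m_pos by simp
      have "y s / A x s \<le> M / m" "m / M \<le> y s / A x s"
        using elim Ax[OF elim(2)] m_pos M_pos ys_pos by (auto intro!: frac_le)
      then have "ln (y s / A x s) \<le> ln (M / m)" "ln (m / M) \<le> ln (y s / A x s)"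
        using ys_pos Ax[OF elim(2)] m_pos M_pos by (auto intro!: ln_mono simp del: ln_le_cancel_iff)
      moreover have "ln (m / M) = - ln (M / m)" using m_pos M_pos by (simp add: ln_div)
      ultimately show ?case by (simp add: r_def g_def)
    qed
  qed measurable
  have g_int: "integrable S g" using ratio(1) by (simp add: g_def[abs_def])
  have w_eq: "w t = (\<integral>s. b s t * g s \<partial>S)" for t
    by (simp add: em_factor_def kernel_op_def[of S] g_def)
  \<comment> \<open>Jensen's inequality via the tangent of \<open>ln\<close> at \<open>w t\<close>, the mean of \<open>g\<close>\<close>
  have jensen: "AE t in T. A' r t \<le> ln (w t)"
    using normalized AE_space
  proof eventually_elim
    case (elim t)
    note t = elim(2)
    have b_int: "integrable S (\<lambda>s. b s t)" using integrable_cosection[of "\<lambda>s. 1", OF _ t] by simp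
    have "A' r t \<le> (\<integral>s. (ln (w t) - 1) * b s t + (b s t * g s) / w t \<partial>S)"
      unfolding kernel_op_def[of S]
    proof (rule integral_mono_AE)
      show "AE s in S. b s t * r s \<le> (ln (w t) - 1) * b s t + (b s t * g s) / w t"
        using y_bounds AE_space
      proof eventually_elim
        case (elim s)
        have pos: "0 < g s" using elim m_pos Ax(3) by (simp add: g_def)
        have "ln (g s / w t) \<le> g s / w t - 1"
          using divide_pos_pos[OF pos w_pos[OF t]] by (rule ln_le_minus_one)
        moreover have "ln (g s / w t) = r s - ln (w t)"
          unfolding r_def by (rule ln_divide_pos[OF pos w_pos[OF t]])
        ultimately have "r s \<le> ln (w t) - 1 + g s / w t" by simp
        then have "b s t * r s \<le> b s t * (ln (w t) - 1 + g s / w t)"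
          using kernel_pos[of s t] by (intro mult_left_mono) auto
        then show ?case by (simp add: algebra_simps)
      qed
    qed (use integrable_cosection[OF r_int t] integrable_cosection[OF g_int t] b_int in auto)
    also have "\<dots> = (ln (w t) - 1) * (\<integral>s. b s t \<partial>S) + w t / w t"
      using integrable_cosection[OF g_int t] b_int by (simp add: w_eq)
    also have "\<dots> = ln (w t)" using elim(1) w_pos[OF t] by simp
    finally show ?case .
  qed
  note adj = adjoint[OF r_int xs_int]
  have "(\<integral>s. kl (y s) (A x s) \<partial>S) = (\<integral>s. r s * A xs s - y s + A x s \<partial>S)"
    by (rule integral_cong_AE) (use sol in \<open>auto elim!: eventually_mono simp: kl_def r_def g_def\<close>)
  also have "\<dots> = (\<integral>s. r s * A xs s \<partial>S)"
    using adj(1) y_props A_integral[OF x_props(1)] x_props by simp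
  also have "\<dots> = (\<integral>t. A' r t * xs t \<partial>T)" by (rule adj(3))
  also have "\<dots> \<le> (\<integral>t. xs t * ln (w t) \<partial>T)"
  proof (rule integral_mono_AE[OF adj(2) integrable_mult_ln_w[OF xs_int]])
    show "AE t in T. A' r t * xs t \<le> xs t * ln (w t)"
      using jensen xs_nonneg by eventually_elim (simp add: mult.commute mult_left_mono)
  qed
  finally have main: "(\<integral>s. kl (y s) (A x s) \<partial>S) \<le> (\<integral>t. xs t * ln (w t) \<partial>T)" .
  have nonneg: "AE t in T. 0 \<le> xs t \<and> 0 \<le> x t"
    using xs_nonneg x_props(2) by eventually_elim simp
  note fin = KL_dist_finiteD[OF _ _ nonneg True]
  have zero: "AE t in T. x t = 0 \<longrightarrow> xs t = 0" by (rule fin(1)) measurable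
  have kl_int: "integrable T (\<lambda>t. kl (xs t) (x t))" by (rule fin(2)) measurable
  have AE1: "AE t in T. 0 \<le> xs t \<and> 0 \<le> x t \<and> (x t = 0 \<longrightarrow> xs t = 0)"
    using nonneg zero by eventually_elim simp
  have AE2: "AE t in T. 0 \<le> xs t \<and> 0 \<le> x' t \<and> (x' t = 0 \<longrightarrow> xs t = 0)"
    using AE1 step AE_space
  proof eventually_elim
    case (elim t)
    then show ?case using w_pos[OF elim(3)] by (auto intro: mult_nonneg_nonneg less_imp_le)
  qed
  have kl_eq: "AE t in T. kl (xs t) (x' t) = kl (xs t) (x t) - xs t * ln (w t) + x' t - x t"
    using AE1 step AE_space
  proof eventually_elim
    case (elim t)
    show ?case
    proof (cases "xs t = 0")
      case False
      then have pos: "0 < xs t" "0 < x t" using elim by (auto simp: less_le)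
      then have eq: "ln (xs t / (x t * w t)) = ln (xs t / x t) - ln (w t)"
        using w_pos[OF elim(3)] by (simp add: ln_div ln_mult)
      show ?thesis unfolding kl_def elim(2) eq by (simp add: right_diff_distrib)
    qed (simp add: kl_def)
  qed
  have x'_int: "integrable T x'" "(\<integral>t. x' t \<partial>T) = 1" using x'_dens by (auto simp: is_density_def)
  have kl'_int: "integrable T (\<lambda>t. kl (xs t) (x' t))"
    by (rule integrable_cong_AE_imp[of _ "\<lambda>t. kl (xs t) (x t) - xs t * ln (w t) + x' t - x t"])
      (use kl_int integrable_mult_ln_w[OF xs_int] x_props x'_int kl_eq in auto)
  have "(\<integral>t. kl (xs t) (x' t) \<partial>T) = (\<integral>t. kl (xs t) (x t) - xs t * ln (w t) + x' t - x t \<partial>T)"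
    by (rule integral_cong_AE) (use kl_eq in auto)
  also have "\<dots> = (\<integral>t. kl (xs t) (x t) \<partial>T) - (\<integral>t. xs t * ln (w t) \<partial>T)"
    using kl_int integrable_mult_ln_w[OF xs_int] x_props x'_int by simp
  finally have "(\<integral>t. kl (xs t) (x' t) \<partial>T) + (\<integral>s. kl (y s) (A x s) \<partial>S) \<le> (\<integral>t. kl (xs t) (x t) \<partial>T)"
    using main by simp
  then show ?thesis
    using KL_dist_eq_integral[OF kl_int AE1] KL_dist_eq_integral[OF kl'_int AE2] kl_residual[OF x_dens]
    by (auto simp: ennreal_plus[symmetric] simp del: ennreal_plus intro!: ennreal_leI)
qed

end

section \<open>The cyclic iteration\<close>

text \<open>
  The partial sums of \<open>f\<close> are bounded by \<open>d 0\<close>.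
\<close>

lemma ennreal_telescoping_tendsto_zero:
  fixes d f :: "nat \<Rightarrow> ennreal"
  assumes le: "\<And>k. d (Suc k) + f k \<le> d k" and fin: "d 0 < \<infinity>"
  shows "f \<longlonglongrightarrow> 0"
proof -
  have sum_le: "(\<Sum>k<n. f k) + d n \<le> d 0" for n
  proof (induction n)
    case (Suc n)
    have "(\<Sum>k<Suc n. f k) + d (Suc n) = (\<Sum>k<n. f k) + (d (Suc n) + f n)" by (simp add: ac_simps)
    also have "\<dots> \<le> (\<Sum>k<n. f k) + d n" by (intro add_left_mono le)
    also have "\<dots> \<le> d 0" by (rule Suc.IH)
    finally show ?case .
  qed simp
  have sum_le': "(\<Sum>k<n. f k) \<le> d 0" for n
    using sum_le[of n] by (meson add_increasing2 order_refl order_trans zero_le)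
  have fin_f: "f k < \<infinity>" for k
  proof -
    have "f k \<le> (\<Sum>k<Suc k. f k)" by (simp add: add_increasing)
    also have "\<dots> \<le> d 0" by (rule sum_le')
    finally show ?thesis using fin by simp
  qed
  have "(\<Sum>k<n. enn2real (f k)) \<le> enn2real (d 0)" for n
  proof -
    have "ennreal (\<Sum>k<n. enn2real (f k)) = (\<Sum>k<n. f k)"
      using fin_f by (simp add: sum_ennreal[symmetric])
    then show ?thesis using sum_le'[of n] fin
      by (metis enn2real_ennreal enn2real_mono enn2real_nonneg infinity_ennreal_def sum_nonneg)
  qed
  then have "summable (\<lambda>k. enn2real (f k))"
    by (intro summableI_nonneg_bounded[where x = "enn2real (d 0)"]) auto
  then have "(\<lambda>k. enn2real (f k)) \<longlonglongrightarrow> 0" by (rule summable_LIMSEQ_zero)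
  from tendsto_ennrealI[OF this] show ?thesis using fin_f by simp
qed

lemma tendsto_KL_imp_tendsto_L1:
  assumes v: "\<And>n. is_density M (v n)" and u: "\<And>n. is_density M (u n)"
    and lim: "(\<lambda>n. KL_dist M (v n) (u n)) \<longlonglongrightarrow> 0"
  shows "(\<lambda>n. \<integral>t. \<bar>v n t - u n t\<bar> \<partial>M) \<longlonglongrightarrow> 0"
proof (rule tendstoI)
  fix e :: real assume e: "e > 0"
  have "0 < ennreal (e\<^sup>2 / 8)" using e by simp
  from order_tendstoD(2)[OF lim this]
  show "eventually (\<lambda>n. dist (\<integral>t. \<bar>v n t - u n t\<bar> \<partial>M) 0 < e) sequentially"
  proof eventually_elim
    case (elim n)
    have int: "integrable M (v n)" "integrable M (u n)" and one: "(\<integral>t. v n t \<partial>M) = 1" "(\<integral>t. u n t \<partial>M) = 1"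
      and nonneg: "AE t in M. 0 \<le> v n t \<and> 0 \<le> u n t"
      using v[of n] u[of n] by (auto simp: is_density_def)
    have meas: "v n \<in> borel_measurable M" "u n \<in> borel_measurable M" using int by auto
    have fin: "KL_dist M (v n) (u n) < \<infinity>" using elim by (simp add: order.strict_trans)
    note zero = KL_dist_finiteD(1)[OF meas nonneg fin] and kl_int = KL_dist_finiteD(2)[OF meas nonneg fin]
    have AE: "AE t in M. 0 \<le> v n t \<and> 0 \<le> u n t \<and> (u n t = 0 \<longrightarrow> v n t = 0)"
      using nonneg zero by eventually_elim simp
    let ?K = "\<integral>t. kl (v n t) (u n t) \<partial>M"
    have K: "?K < e\<^sup>2 / 8"
      using KL_dist_eq_integral[OF kl_int AE] elim e by (simp add: ennreal_less_iff)
    have "(\<integral>t. \<bar>v n t - u n t\<bar> \<partial>M)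
        \<le> (\<integral>t. kl (v n t) (u n t) / (e / 4) + e / 4 * (v n t + u n t) \<partial>M)"
    proof (rule integral_mono_AE)
      show "AE t in M. \<bar>v n t - u n t\<bar> \<le> kl (v n t) (u n t) / (e / 4) + e / 4 * (v n t + u n t)"
        using AE by eventually_elim (use e in \<open>intro abs_diff_le_kl, auto\<close>)
    qed (use int kl_int in auto)
    also have "\<dots> = ?K / (e / 4) + e / 4 * 2"
      using int kl_int one by simp
    also have "\<dots> < e" using K e by (simp add: field_simps power2_eq_square)
    finally show ?case by (simp add: dist_real_def)
  qed
qed

text \<open>
  For every \<open>d > 0\<close> a function bounded by \<open>C\<close> satisfies \<open>\<bar>h\<bar>\<^sup>p \<le> d\<^sup>p + (C\<^sup>p / d\<^sup>2) h\<^sup>2\<close>, whether \<open>p\<close> is smaller or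
  larger than \<open>2\<close>.
\<close>

lemma (in finite_measure) bounded_L2_tendsto_imp_Lp_tendsto:
  fixes h :: "nat \<Rightarrow> 'a \<Rightarrow> real"
  assumes [measurable]: "\<And>n. h n \<in> borel_measurable M"
    and C: "C \<ge> 0" "\<And>n. AE t in M. \<bar>h n t\<bar> \<le> C"
    and lim: "(\<lambda>n. \<integral>t. (h n t)\<^sup>2 \<partial>M) \<longlonglongrightarrow> 0" and p: "p > 0"
  shows "(\<lambda>n. \<integral>t. \<bar>h n t\<bar> powr p \<partial>M) \<longlonglongrightarrow> 0"
proof (rule tendstoI)
  fix e :: real assume e: "e > 0"
  let ?\<mu> = "measure M (space M)"
  define c where "c = e / (2 * (?\<mu> + 1))"
  have c: "c > 0" using e unfolding c_def by (intro divide_pos_pos mult_pos_pos add_nonneg_pos) auto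
  have "c * ?\<mu> \<le> c * (?\<mu> + 1)" using c by simp
  also have "\<dots> = e / 2" using add_nonneg_pos[OF measure_nonneg[of M "space M"], of 1] by (simp add: c_def field_simps)
  finally have c\<mu>: "c * ?\<mu> \<le> e / 2" .
  define d where "d = c powr (1 / p)"
  have d: "d > 0" and dp: "d powr p = c" using c p by (simp_all add: d_def powr_powr)
  define K where "K = C powr p / d\<^sup>2"
  have K: "K \<ge> 0" by (simp add: K_def)
  have "(\<lambda>n. K * (\<integral>t. (h n t)\<^sup>2 \<partial>M)) \<longlonglongrightarrow> 0" using lim by (rule tendsto_mult_right_zero)
  from order_tendstoD(2)[OF this, of "e / 2"] e
  have "eventually (\<lambda>n. K * (\<integral>t. (h n t)\<^sup>2 \<partial>M) < e / 2) sequentially" by simp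
  then show "eventually (\<lambda>n. dist (\<integral>t. \<bar>h n t\<bar> powr p \<partial>M) 0 < e) sequentially"
  proof eventually_elim
    case (elim n)
    have int2: "integrable M (\<lambda>t. (h n t)\<^sup>2)"
      by (rule integrable_const_bound[of _ "C\<^sup>2"])
        (use C in \<open>auto elim!: eventually_mono simp: abs_le_square_iff[symmetric]\<close>)
    have intp: "integrable M (\<lambda>t. \<bar>h n t\<bar> powr p)"
    proof (rule integrable_const_bound[of _ "C powr p"])
      show "AE t in M. norm (\<bar>h n t\<bar> powr p) \<le> C powr p"
        using C(2)[of n] by eventually_elim (use p in \<open>auto intro: powr_mono2\<close>)
    qed measurable
    have "(\<integral>t. \<bar>h n t\<bar> powr p \<partial>M) \<le> (\<integral>t. d powr p + K * (h n t)\<^sup>2 \<partial>M)"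
    proof (rule integral_mono_AE)
      show "AE t in M. \<bar>h n t\<bar> powr p \<le> d powr p + K * (h n t)\<^sup>2"
        using C(2)[of n]
      proof eventually_elim
        case (elim t)
        show ?case
        proof (cases "\<bar>h n t\<bar> \<le> d")
          case True
          then have "\<bar>h n t\<bar> powr p \<le> d powr p" using p by (intro powr_mono2) auto
          then show ?thesis using K by (simp add: add_increasing2)
        next
          case False
          have "\<bar>h n t\<bar> powr p \<le> C powr p * 1" using elim p by (auto intro: powr_mono2)
          also have "\<dots> \<le> C powr p * ((h n t)\<^sup>2 / d\<^sup>2)"
            using False d by (intro mult_left_mono) (auto simp: abs_le_square_iff[symmetric])
          finally show ?thesis by (simp add: K_def add_increasing)
        qed
      qed
    qed (use int2 intp in auto)
    also have "\<dots> = d powr p * ?\<mu> + K * (\<integral>t. (h n t)\<^sup>2 \<partial>M)"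
      using int2 by (simp add: mult.commute)
    also have "\<dots> < e" using elim c\<mu> unfolding dp by linarith
    finally have "(\<integral>t. \<bar>h n t\<bar> powr p \<partial>M) < e" .
    moreover have "0 \<le> (\<integral>t. \<bar>h n t\<bar> powr p \<partial>M)" by (intro integral_nonneg_AE) simp
    ultimately show ?case by (simp add: dist_real_def)
  qed
qed

locale os_em = S: finite_measure S + T: finite_measure T
  for S :: "'s measure" and T :: "'t measure" +
  fixes N :: nat and b :: "nat \<Rightarrow> 's \<Rightarrow> 't \<Rightarrow> real" and m M C :: real
    and y :: "nat \<Rightarrow> 's \<Rightarrow> real" and x :: "nat \<Rightarrow> 't \<Rightarrow> real"
  assumes N_pos: "N \<ge> 1"
    and problem: "j < N \<Longrightarrow> em_problem S T (b j) m M (y j) C"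
    and x_meas: "x k \<in> borel_measurable T"
    and x0_dens: "is_density T (x 0)"
    and iter: "AE t in T. x (Suc k) t = x k t * em_factor S T (b (k mod N)) (y (k mod N)) (x k) t"
begin

lemma mod_less: "k mod N < N" using N_pos by simp

lemma em_stepI:
  assumes "is_density T (x k)"
  shows "em_step S T (b (k mod N)) m M (y (k mod N)) C (x k) (x (Suc k))"
proof -
  interpret em_problem S T "b (k mod N)" m M "y (k mod N)" C by (rule problem[OF mod_less])
  show ?thesis by unfold_locales (use assms x_meas iter in auto)
qed

lemma x_dens: "is_density T (x k)"
proof (induction k)
  case (Suc k)
  then show ?case by (rule em_step.x'_dens[OF em_stepI])
qed (rule x0_dens)

lemma x_int: "integrable T (x k)" using x_dens by (auto simp: is_density_def)

lemma em_step: "em_step S T (b (k mod N)) m M (y (k mod N)) C (x k) (x (Suc k))"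
  by (rule em_stepI[OF x_dens])

abbreviation residual where "residual k u \<equiv> KL_dist S (y (k mod N)) (kernel_op T (b (k mod N)) u)"

lemma residual_descent:
  "residual k (x (Suc k)) + KL_dist T (x (Suc k)) (x k) \<le> residual k (x k)"
  by (rule em_step.descent[OF em_step])

lemma residual_mono: "residual k (x (Suc k)) \<le> residual k (x k)"
  using residual_descent[of k] by (meson add_increasing2 order_refl order_trans zero_le)

lemma image_diff_bound:
  assumes j: "j < N"
  shows "AE s in S. \<bar>kernel_op T (b j) (x k) s - y j s\<bar> \<le> max C M"
    "(\<lambda>s. kernel_op T (b j) (x k) s - y j s) \<in> borel_measurable S"
proof -
  interpret em_problem S T "b j" m M "y j" C by (rule problem[OF j])
  show "AE s in S. \<bar>kernel_op T (b j) (x k) s - y j s\<bar> \<le> max C M"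
    using y_props(2) y_le AE_space
  proof eventually_elim
    case (elim s)
    then show ?case using A_bounds[OF x_dens[of k] elim(3)] m_pos by linarith
  qed
  show "(\<lambda>s. kernel_op T (b j) (x k) s - y j s) \<in> borel_measurable S"
    using A_meas[OF x_meas] y_props(4) by measurable
qed

end

locale os_em_solution = os_em +
  fixes xs
  assumes xs_int: "integrable T xs" and xs_nonneg: "AE t in T. 0 \<le> xs t"
    and sol: "j < N \<Longrightarrow> AE s in S. kernel_op T (b j) xs s = y j s"
    and fin: "KL_dist T xs (x 0) < \<infinity>"
begin

lemma dist_descent: "KL_dist T xs (x (Suc k)) + residual k (x k) \<le> KL_dist T xs (x k)"
  by (rule em_step.solution_descent[OF em_step xs_int xs_nonneg sol[OF mod_less]])

lemma dist_decseq: "decseq (\<lambda>k. KL_dist T xs (x k))"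
  by (rule decseq_SucI) (use dist_descent in \<open>meson add_increasing2 order_refl order_trans zero_le\<close>)

lemma residual_tendsto: "(\<lambda>k. residual k (x k)) \<longlonglongrightarrow> 0"
  by (rule ennreal_telescoping_tendsto_zero[OF dist_descent fin])

lemma step_tendsto: "(\<lambda>k. KL_dist T (x (Suc k)) (x k)) \<longlonglongrightarrow> 0"
proof (rule tendsto_sandwich[OF _ _ tendsto_const residual_tendsto])
  show "eventually (\<lambda>k. KL_dist T (x (Suc k)) (x k) \<le> residual k (x k)) sequentially"
    using residual_descent by (intro always_eventually allI) (meson add_increasing order_refl order_trans zero_le)
qed simp

lemma step_L1_tendsto: "(\<lambda>k. \<integral>t. \<bar>x (Suc k) t - x k t\<bar> \<partial>T) \<longlonglongrightarrow> 0"
  by (rule tendsto_KL_imp_tendsto_L1[OF x_dens x_dens step_tendsto])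

lemma image_tendsto:
  assumes j: "j < N" and p: "p > 0"
  shows "(\<lambda>l. \<integral>s. \<bar>kernel_op T (b j) (x (j + l * N)) s - y j s\<bar> powr p \<partial>S) \<longlonglongrightarrow> 0"
proof (rule S.bounded_L2_tendsto_imp_Lp_tendsto[of _ "max C M"])
  interpret em_problem S T "b j" m M "y j" C by (rule problem[OF j])
  show "0 \<le> max C M" using M_pos by simp
  have "(\<lambda>l. residual (j + l * N) (x (j + l * N))) \<longlonglongrightarrow> 0"
  proof (rule filterlim_compose[OF residual_tendsto])
    show "filterlim (\<lambda>l. j + l * N) sequentially sequentially"
      using N_pos by (intro filterlim_subseq strict_monoI) simp
  qed
  then have "(\<lambda>l. KL_dist S (y j) (A (x (j + l * N)))) \<longlonglongrightarrow> 0" using j by simp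
  then have "(\<lambda>l. ennreal (\<integral>s. kl (y j s) (A (x (j + l * N)) s) \<partial>S)) \<longlonglongrightarrow> ennreal 0"
    using kl_residual(2)[OF x_dens] by simp
  then have lim: "(\<lambda>l. \<integral>s. kl (y j s) (A (x (j + l * N)) s) \<partial>S) \<longlonglongrightarrow> 0"
    by (rule tendsto_ennrealD) (use kl_residual(3)[OF x_dens] in auto)
  show "(\<lambda>l. \<integral>s. (A (x (j + l * N)) s - y j s)\<^sup>2 \<partial>S) \<longlonglongrightarrow> 0"
  proof (rule tendsto_sandwich[OF _ _ tendsto_const tendsto_mult_right_zero[OF lim]])
    show "eventually (\<lambda>l. (\<integral>s. (A (x (j + l * N)) s - y j s)\<^sup>2 \<partial>S)
        \<le> 4 * max C M * (\<integral>s. kl (y j s) (A (x (j + l * N)) s) \<partial>S)) sequentially"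
    proof (intro always_eventually allI)
      fix l
      let ?u = "x (j + l * N)"
      have "(\<integral>s. (A ?u s - y j s)\<^sup>2 \<partial>S) \<le> (\<integral>s. 4 * max C M * kl (y j s) (A ?u s) \<partial>S)"
      proof (rule integral_mono_AE)
        show "integrable S (\<lambda>s. (A ?u s - y j s)\<^sup>2)"
        proof (rule S.integrable_const_bound[of _ "(max C M)\<^sup>2"])
          show "AE s in S. norm ((A ?u s - y j s)\<^sup>2) \<le> (max C M)\<^sup>2"
            using image_diff_bound(1)[OF j, of "j + l * N"] M_pos
            by (auto elim!: eventually_mono simp: abs_le_square_iff[symmetric])
          show "(\<lambda>s. (A ?u s - y j s)\<^sup>2) \<in> borel_measurable S"
            using image_diff_bound(2)[OF j] by measurable
        qed
        show "AE s in S. (A ?u s - y j s)\<^sup>2 \<le> 4 * max C M * kl (y j s) (A ?u s)"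
          using y_props(2) y_le AE_space
        proof eventually_elim
          case (elim s)
          then show ?case
            using square_diff_le_kl[of "y j s" "max C M" "A ?u s"] A_bounds[OF x_dens elim(3), of "j + l * N"] m_pos
            by (simp add: power2_commute)
        qed
      qed (use kl_residual(1)[OF x_dens] in auto)
      then show "(\<integral>s. (A ?u s - y j s)\<^sup>2 \<partial>S) \<le> 4 * max C M * (\<integral>s. kl (y j s) (A ?u s) \<partial>S)" by simp
    qed
  qed (auto intro!: always_eventually integral_nonneg_AE)
qed (use image_diff_bound[OF j] p in auto)

lemma cycle_L1_tendsto: "(\<lambda>l. \<integral>t. \<bar>x (l * N) t - x (i + l * N) t\<bar> \<partial>T) \<longlonglongrightarrow> 0"
proof (induction i)
  case (Suc i)
  have "(\<lambda>l. \<integral>t. \<bar>x (Suc (i + l * N)) t - x (i + l * N) t\<bar> \<partial>T) \<longlonglongrightarrow> 0"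
  proof (rule filterlim_compose[OF step_L1_tendsto])
    show "filterlim (\<lambda>l. i + l * N) sequentially sequentially"
      using N_pos by (intro filterlim_subseq strict_monoI) simp
  qed
  from tendsto_add[OF Suc.IH this]
  have lim: "(\<lambda>l. (\<integral>t. \<bar>x (l * N) t - x (i + l * N) t\<bar> \<partial>T)
      + (\<integral>t. \<bar>x (Suc (i + l * N)) t - x (i + l * N) t\<bar> \<partial>T)) \<longlonglongrightarrow> 0" by simp
  show ?case
  proof (rule tendsto_sandwich[OF _ _ tendsto_const lim])
    show "eventually (\<lambda>l. (\<integral>t. \<bar>x (l * N) t - x (Suc i + l * N) t\<bar> \<partial>T)
        \<le> (\<integral>t. \<bar>x (l * N) t - x (i + l * N) t\<bar> \<partial>T)
          + (\<integral>t. \<bar>x (Suc (i + l * N)) t - x (i + l * N) t\<bar> \<partial>T)) sequentially"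
    proof (intro always_eventually allI)
      fix l
      have int: "integrable T (\<lambda>t. \<bar>x k t - x k' t\<bar>)" for k k' using x_int by auto
      have "(\<integral>t. \<bar>x (l * N) t - x (Suc i + l * N) t\<bar> \<partial>T)
          \<le> (\<integral>t. \<bar>x (l * N) t - x (i + l * N) t\<bar> + \<bar>x (Suc (i + l * N)) t - x (i + l * N) t\<bar> \<partial>T)"
        by (rule integral_mono) (use int in auto)
      also have "\<dots> = (\<integral>t. \<bar>x (l * N) t - x (i + l * N) t\<bar> \<partial>T)
          + (\<integral>t. \<bar>x (Suc (i + l * N)) t - x (i + l * N) t\<bar> \<partial>T)"
        by (rule Bochner_Integration.integral_add[OF int int])
      finally show "(\<integral>t. \<bar>x (l * N) t - x (Suc i + l * N) t\<bar> \<partial>T)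
          \<le> (\<integral>t. \<bar>x (l * N) t - x (i + l * N) t\<bar> \<partial>T)
            + (\<integral>t. \<bar>x (Suc (i + l * N)) t - x (i + l * N) t\<bar> \<partial>T)" .
    qed
  qed (auto intro!: always_eventually integral_nonneg_AE)
qed simp

text \<open>
  Convergence at the indices \<open>j + l N\<close> is carried over to the indices \<open>l N\<close>: the two iterates are at most
  \<open>N\<close> steps apart, so their \<open>L\<^sup>1\<close> distance tends to \<open>0\<close>, and the operator maps \<open>L\<^sup>1\<close> boundedly into the
  bounded functions.
\<close>

lemma cycle_image_tendsto:
  assumes j: "j < N"
  shows "(\<lambda>l. \<integral>s. \<bar>kernel_op T (b j) (x (l * N)) s - y j s\<bar> \<partial>S) \<longlonglongrightarrow> 0"
proof -
  interpret em_problem S T "b j" m M "y j" C by (rule problem[OF j])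
  let ?d = "\<lambda>l. \<integral>t. \<bar>x (l * N) t - x (j + l * N) t\<bar> \<partial>T"
  have 1: "(\<lambda>l. \<integral>s. \<bar>A (x (j + l * N)) s - y j s\<bar> \<partial>S) \<longlonglongrightarrow> 0"
    using image_tendsto[OF j, of 1] by simp
  have 2: "(\<lambda>l. M * measure S (space S) * ?d l) \<longlonglongrightarrow> 0"
    by (rule tendsto_mult_right_zero[OF cycle_L1_tendsto])
  have lim: "(\<lambda>l. (\<integral>s. \<bar>A (x (j + l * N)) s - y j s\<bar> \<partial>S) + M * measure S (space S) * ?d l) \<longlonglongrightarrow> 0"
    using tendsto_add[OF 1 2] by simp
  show ?thesis
  proof (rule tendsto_sandwich[OF _ _ tendsto_const lim])
    show "eventually (\<lambda>l. (\<integral>s. \<bar>A (x (l * N)) s - y j s\<bar> \<partial>S)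
        \<le> (\<integral>s. \<bar>A (x (j + l * N)) s - y j s\<bar> \<partial>S) + M * measure S (space S) * ?d l) sequentially"
    proof (intro always_eventually allI)
      fix l
      have int: "integrable S (\<lambda>s. \<bar>A (x k) s - y j s\<bar>)" for k
        using A_integral(1)[OF x_int] y_props by auto
      have "(\<integral>s. \<bar>A (x (l * N)) s - y j s\<bar> \<partial>S) \<le> (\<integral>s. \<bar>A (x (j + l * N)) s - y j s\<bar> + M * ?d l \<partial>S)"
      proof (rule integral_mono)
        fix s assume "s \<in> space S"
        from A_diff_le[OF x_int x_int this, of "l * N" "j + l * N"]
        show "\<bar>A (x (l * N)) s - y j s\<bar> \<le> \<bar>A (x (j + l * N)) s - y j s\<bar> + M * ?d l" by linarith
      qed (use int in auto)
      also have "\<dots> = (\<integral>s. \<bar>A (x (j + l * N)) s - y j s\<bar> \<partial>S) + M * measure S (space S) * ?d l"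
        using int by (simp add: mult_ac)
      finally show "(\<integral>s. \<bar>A (x (l * N)) s - y j s\<bar> \<partial>S)
          \<le> (\<integral>s. \<bar>A (x (j + l * N)) s - y j s\<bar> \<partial>S) + M * measure S (space S) * ?d l" .
    qed
  qed (auto intro!: always_eventually integral_nonneg_AE)
qed

text \<open>
  The subsequence is taken among the full cycles \<open>l N\<close>, where all \<open>N\<close> images converge to the data. The
  images of the weak limit are the pointwise limits of the images, so they agree with the data.
\<close>

lemma weak_cluster_point:
  assumes D: "countable D" "D \<subseteq> sets T"
    and dense: "\<And>A e. A \<in> sets T \<Longrightarrow> e > 0 \<Longrightarrow> \<exists>F\<in>D. measure T ((A - F) \<union> (F - A)) < e"
    and p: "p > 1" and bounded: "Lp_bounded p T x"
  shows "\<exists>r z. strict_mono r \<and> Lp_weakly_converges p T (x \<circ> r) z \<and> integrable T z \<and>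
    (\<forall>j<N. AE s in S. kernel_op T (b j) z s = y j s)"
proof -
  have "Lp_bounded p T (\<lambda>l. x (l * N))" using bounded unfolding Lp_bounded_def by blast
  note T.Lp_weakly_convergent_subsequence[OF D dense p this]
  then obtain r z where r: "strict_mono r" and weak: "Lp_weakly_converges p T ((\<lambda>l. x (l * N)) \<circ> r) z"
    and zLp: "z \<in> Lp_space p T"
    and test: "\<And>h K. h \<in> borel_measurable T \<Longrightarrow> (\<forall>t\<in>space T. \<bar>h t\<bar> \<le> K) \<Longrightarrow>
      (\<lambda>n. \<integral>t. h t * x (r n * N) t \<partial>T) \<longlonglongrightarrow> (\<integral>t. h t * z t \<partial>T)"
    by blast
  have z: "integrable T z" by (rule T.Lp_space_integrable[OF zLp p])
  have "AE s in S. kernel_op T (b j) z s = y j s" if j: "j < N" for j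
  proof -
    interpret em_problem S T "b j" m M "y j" C by (rule problem[OF j])
    have pointwise: "(\<lambda>n. A (x (r n * N)) s) \<longlonglongrightarrow> A z s" if "s \<in> space S" for s
      unfolding kernel_op_def
      by (rule test[OF section_meas(1)[OF that], of M]) (use upper kernel_pos in \<open>auto simp: abs_of_pos\<close>)
    have "(\<lambda>n. \<integral>s. \<bar>A (x (r n * N)) s - y j s\<bar> \<partial>S) \<longlonglongrightarrow> (\<integral>s. \<bar>A z s - y j s\<bar> \<partial>S)"
    proof (rule integral_dominated_convergence[where w = "\<lambda>s. max C M"])
      show "AE s in S. (\<lambda>n. \<bar>A (x (r n * N)) s - y j s\<bar>) \<longlonglongrightarrow> \<bar>A z s - y j s\<bar>"
        by (intro AE_I2 tendsto_intros pointwise)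
      show "AE s in S. norm \<bar>A (x (r n * N)) s - y j s\<bar> \<le> max C M" for n
        using image_diff_bound(1)[OF j] by simp
      show "(\<lambda>s. \<bar>A (x (r n * N)) s - y j s\<bar>) \<in> borel_measurable S" for n
        using image_diff_bound(2)[OF j] by measurable
      show "(\<lambda>s. \<bar>A z s - y j s\<bar>) \<in> borel_measurable S"
        using A_integral(1)[OF z] y_props(1) by measurable
    qed simp
    moreover have "(\<lambda>n. \<integral>s. \<bar>A (x (r n * N)) s - y j s\<bar> \<partial>S) \<longlonglongrightarrow> 0"
      using filterlim_compose[OF cycle_image_tendsto[OF j] filterlim_subseq[OF r]] .
    ultimately have "(\<integral>s. \<bar>A z s - y j s\<bar> \<partial>S) = 0" by (rule LIMSEQ_unique)
    then have "AE s in S. \<bar>A z s - y j s\<bar> = 0"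
      using A_integral(1)[OF z] y_props(1) by (subst (asm) integral_nonneg_eq_0_iff_AE) auto
    then show ?thesis by eventually_elim simp
  qed
  moreover have "strict_mono (\<lambda>n. r n * N)"
    using r N_pos by (auto simp: strict_mono_def)
  moreover have "(\<lambda>l. x (l * N)) \<circ> r = x \<circ> (\<lambda>n. r n * N)" by auto
  ultimately show ?thesis using weak z by (intro exI[of _ "\<lambda>n. r n * N"] exI[of _ z]) auto
qed

end

section \<open>Kernels that are only Lebesgue measurable\<close>

lemma (in complete_measure) borel_measurable_cong_AE:
  fixes f g :: "'a \<Rightarrow> real"
  assumes g: "g \<in> borel_measurable M" and AE: "AE x in M. f x = g x"
  shows "f \<in> borel_measurable M"
proof (rule measurableI)
  fix B :: "real set" assume B: "B \<in> sets borel"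
  show "f -` B \<inter> space M \<in> sets M"
  proof (rule in_sets_AE)
    show "g -` B \<inter> space M \<in> sets M" using g B by (rule measurable_sets)
    show "AE x in M. x \<in> g -` B \<inter> space M \<longleftrightarrow> x \<in> f -` B \<inter> space M"
      using AE by eventually_elim auto
  qed auto
qed simp

text \<open>
  Completeness is what makes functions measurable that are only almost everywhere equal to measurable
  ones, such as the sections of the given kernels and the iterates.
\<close>

lemma complete_measure_lebesgue_on:
  assumes "S \<in> sets lebesgue"
  shows "complete_measure (lebesgue_on S)"
proof
  fix A B assume "B \<subseteq> A" "A \<in> null_sets (lebesgue_on S)"
  then have "A \<subseteq> S" "A \<in> null_sets lebesgue"
    using assms by (auto simp: null_sets_restrict_space)
  then show "B \<in> sets (lebesgue_on S)"
    using \<open>B \<subseteq> A\<close> assms completion.complete2[of B A lborel]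
    by (auto simp: sets_restrict_space_iff null_sets_def)
qed

text \<open>
  Lebesgue measure on the product is the completion of the product of the Borel measures, so the
  exceptional set is covered by a Borel null set, to which Fubini's theorem applies.
\<close>

lemma AE_lebesgue_on_Times:
  fixes \<Sigma> :: "'a::euclidean_space set" and \<Omega> :: "'b::euclidean_space set"
  assumes S: "\<Sigma> \<in> sets borel" and O: "\<Omega> \<in> sets borel"
    and AE: "AE p in lebesgue_on (\<Sigma> \<times> \<Omega>). P p"
  shows "AE s in lebesgue_on \<Sigma>. AE t in lebesgue_on \<Omega>. P (s, t)"
    "AE t in lebesgue_on \<Omega>. AE s in lebesgue_on \<Sigma>. P (s, t)"
proof -
  have "\<Sigma> \<times> \<Omega> \<in> sets borel" using S O by (rule borel_Times)
  then have "AE p in lborel. p \<in> \<Sigma> \<times> \<Omega> \<longrightarrow> P p"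
    using AE by (simp add: AE_restrict_space_iff AE_completion_iff)
  then obtain Z where Z: "{p \<in> space lborel. \<not> (p \<in> \<Sigma> \<times> \<Omega> \<longrightarrow> P p)} \<subseteq> Z" "emeasure lborel Z = 0" "Z \<in> sets lborel"
    by (rule AE_E)
  then have "AE p in (lborel \<Otimes>\<^sub>M lborel :: ('a \<times> 'b) measure). p \<notin> Z"
    unfolding lborel_prod by (intro AE_not_in null_setsI)
  from lborel_pair.AE_pair[OF this] have 1: "AE s in (lborel :: 'a measure). AE t in (lborel :: 'b measure). (s, t) \<notin> Z" .
  have "{p \<in> space ((lborel :: 'a measure) \<Otimes>\<^sub>M (lborel :: 'b measure)). (fst p, snd p) \<notin> Z}
      \<in> sets ((lborel :: 'a measure) \<Otimes>\<^sub>M (lborel :: 'b measure))"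
    unfolding lborel_prod using Z(3) by (simp add: Collect_neg_eq)
  from lborel_pair.AE_commute[OF this] 1
  have 2: "AE t in (lborel :: 'b measure). AE s in (lborel :: 'a measure). (s, t) \<notin> Z" by simp
  have P: "(s, t) \<notin> Z \<Longrightarrow> s \<in> \<Sigma> \<Longrightarrow> t \<in> \<Omega> \<Longrightarrow> P (s, t)" for s t using Z(1) by auto
  show "AE s in lebesgue_on \<Sigma>. AE t in lebesgue_on \<Omega>. P (s, t)"
    using 1 S O
    by (simp add: AE_restrict_space_iff AE_completion_iff) (auto elim!: eventually_mono intro: P)
  show "AE t in lebesgue_on \<Omega>. AE s in lebesgue_on \<Sigma>. P (s, t)"
    using 2 S O
    by (simp add: AE_restrict_space_iff AE_completion_iff) (auto elim!: eventually_mono intro: P)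
qed

text \<open>
  A Lebesgue measurable function agrees almost everywhere with a Borel function; clipping the latter
  to \<open>[m, M]\<close> does not affect it where it agrees with \<open>a\<close>, and makes the bounds hold everywhere.
\<close>

lemma Borel_clipped_kernel:
  fixes a :: "'a::euclidean_space \<Rightarrow> 'b::euclidean_space \<Rightarrow> real"
  assumes S: "\<Sigma> \<in> sets borel" and O: "\<Omega> \<in> sets borel"
    and meas: "(\<lambda>(s, t). a s t) \<in> borel_measurable (lebesgue_on (\<Sigma> \<times> \<Omega>))"
    and bounds: "AE (s, t) in lebesgue_on (\<Sigma> \<times> \<Omega>). m \<le> a s t \<and> a s t \<le> M" and mM: "m \<le> M"
  shows "\<exists>b. case_prod b \<in> borel_measurable (lebesgue_on \<Sigma> \<Otimes>\<^sub>M lebesgue_on \<Omega>) \<and>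
    (\<forall>s t. m \<le> b s t \<and> b s t \<le> M) \<and>
    (AE s in lebesgue_on \<Sigma>. AE t in lebesgue_on \<Omega>. a s t = b s t) \<and>
    (AE t in lebesgue_on \<Omega>. AE s in lebesgue_on \<Sigma>. a s t = b s t)"
proof -
  have SO: "\<Sigma> \<times> \<Omega> \<in> sets borel" using S O by (rule borel_Times)
  then have "(\<lambda>p. if p \<in> \<Sigma> \<times> \<Omega> then case_prod a p else 0) \<in> borel_measurable lebesgue"
    using meas by (subst borel_measurable_if) auto
  from completion_ex_borel_measurable_real[OF this]
  obtain c where c[measurable]: "c \<in> borel_measurable lborel"
    and AE_c: "AE p in lborel. (if p \<in> \<Sigma> \<times> \<Omega> then case_prod a p else 0) = c p" by auto
  define b where "b s t = max m (min M (c (s, t)))" for s t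
  have AE: "AE p in lebesgue_on (\<Sigma> \<times> \<Omega>). a (fst p) (snd p) = b (fst p) (snd p)"
  proof -
    have "AE p in lebesgue_on (\<Sigma> \<times> \<Omega>). case_prod a p = c p"
      using AE_c SO by (simp add: AE_restrict_space_iff AE_completion_iff) (auto elim!: eventually_mono)
    with bounds show ?thesis
      by eventually_elim (auto simp: b_def)
  qed
  show ?thesis
  proof (intro exI[of _ b] conjI allI)
    have "(\<lambda>p. (fst p, snd p)) \<in> (lebesgue_on \<Sigma> \<Otimes>\<^sub>M lebesgue_on \<Omega>) \<rightarrow>\<^sub>M (borel \<Otimes>\<^sub>M borel)"
    proof (rule measurable_Pair)
      have "(\<lambda>s. s) \<in> lebesgue_on \<Sigma> \<rightarrow>\<^sub>M borel" "(\<lambda>t. t) \<in> lebesgue_on \<Omega> \<rightarrow>\<^sub>M borel"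
        by (auto intro!: measurable_restrict_space1 measurable_completion)
      then show "fst \<in> (lebesgue_on \<Sigma> \<Otimes>\<^sub>M lebesgue_on \<Omega>) \<rightarrow>\<^sub>M borel"
        "snd \<in> (lebesgue_on \<Sigma> \<Otimes>\<^sub>M lebesgue_on \<Omega>) \<rightarrow>\<^sub>M borel"
        using measurable_compose[OF measurable_fst] measurable_compose[OF measurable_snd] by auto
    qed
    then have "c \<in> borel_measurable (lebesgue_on \<Sigma> \<Otimes>\<^sub>M lebesgue_on \<Omega>)"
      using measurable_compose[of "\<lambda>p. (fst p, snd p)" _ "borel \<Otimes>\<^sub>M borel" c borel] c
      by (simp add: borel_prod)
    then show "case_prod b \<in> borel_measurable (lebesgue_on \<Sigma> \<Otimes>\<^sub>M lebesgue_on \<Omega>)"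
      unfolding b_def by (simp add: case_prod_beta)
    show "m \<le> b s t" "b s t \<le> M" for s t using mM by (auto simp: b_def)
    show "AE s in lebesgue_on \<Sigma>. AE t in lebesgue_on \<Omega>. a s t = b s t"
      "AE t in lebesgue_on \<Omega>. AE s in lebesgue_on \<Sigma>. a s t = b s t"
      using AE_lebesgue_on_Times[OF S O AE] by simp_all
  qed
qed

context bounded_kernel
begin

text \<open>
  Together with the next lemma this transfers the operators of the given kernel to its Borel
  replacement.
\<close>

lemma kernel_op_cong_AE:
  assumes complete: "complete_measure T" and eq: "AE s in S. AE t in T. a s t = b s t"
    and u: "u \<in> borel_measurable T"
  shows "AE s in S. kernel_op T a u s = A u s"
  using eq AE_space
proof eventually_elim
  case (elim s)
  have meas: "(\<lambda>t. b s t * u t) \<in> borel_measurable T"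
    using section_meas(1)[OF elim(2)] u by measurable
  have AE: "AE t in T. a s t * u t = b s t * u t"
    using elim(1) by eventually_elim simp
  show ?case
    unfolding kernel_op_def
    by (rule integral_cong_AE[OF complete_measure.borel_measurable_cong_AE[OF complete meas AE] meas AE])
qed

lemma adjoint_cong_AE:
  assumes complete: "complete_measure S" and eq: "AE t in T. AE s in S. a s t = b s t"
    and g: "g \<in> borel_measurable S" and g_eq: "AE s in S. g' s = g s"
  shows "AE t in T. (\<integral>s. a s t * g' s \<partial>S) = A' g t"
  using eq AE_space
proof eventually_elim
  case (elim t)
  have meas: "(\<lambda>s. b s t * g s) \<in> borel_measurable S"
    using section_meas(2)[OF elim(2)] g by measurable
  have AE: "AE s in S. a s t * g' s = b s t * g s"
    using elim(1) g_eq by eventually_elim simp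
  show ?case
    unfolding kernel_op_def
    by (rule integral_cong_AE[OF complete_measure.borel_measurable_cong_AE[OF complete meas AE] meas AE])
qed

end

section \<open>Convergence of the OS-EM iteration\<close>

theorem theorem3p3:
  fixes \<Omega> \<Sigma> :: "'a::euclidean_space set"
    and N :: nat
    and a :: "nat \<Rightarrow> 'a \<Rightarrow> 'a \<Rightarrow> real"
    and y x :: "nat \<Rightarrow> 'a \<Rightarrow> real"
    and x\<^sub>0 :: "'a \<Rightarrow> real"
  assumes "open \<Omega>" "bounded \<Omega>" "open \<Sigma>" "bounded \<Sigma>"
    and "N \<ge> 1"
    and "\<forall>j<N. (\<lambda>(s, t). a j s t) \<in> borel_measurable (lebesgue_on (\<Sigma> \<times> \<Omega>))"
    and "\<forall>j<N. integrable (lebesgue_on \<Sigma>) (y j) \<and> (AE s in lebesgue_on \<Sigma>. y j s \<ge> 0)"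
    and A1: "\<forall>j<N. AE t in lebesgue_on \<Omega>. (\<integral>s. a j s t \<partial>lebesgue_on \<Sigma>) = 1"
    and A2: "\<exists>m M. 0 < m \<and> 0 < M \<and>
      (\<forall>j<N. AE (s, t) in lebesgue_on (\<Sigma> \<times> \<Omega>). m \<le> a j s t \<and> a j s t \<le> M)"
    and A3: "\<forall>j<N. (\<integral>s. y j s \<partial>lebesgue_on \<Sigma>) = 1"
      "\<exists>M'>0. \<forall>j<N. AE s in lebesgue_on \<Sigma>. y j s \<le> M'"
    and "x\<^sub>0 \<in> prob_densities \<Omega>"
    and "x 0 = x\<^sub>0"
    and "\<forall>k. AE t in lebesgue_on \<Omega>.
      x (Suc k) t = EM_step \<Omega> \<Sigma> (a (k mod N)) (y (k mod N)) (x k) t"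
  shows "(\<forall>k. KL_residual \<Omega> \<Sigma> (a (k mod N)) (y (k mod N)) (x (Suc k))
              \<le> KL_residual \<Omega> \<Sigma> (a (k mod N)) (y (k mod N)) (x k)) \<and>
    (\<forall>xs. solves_system \<Omega> \<Sigma> N a y xs \<and>
          (AE t in lebesgue_on \<Omega>. xs t \<ge> 0) \<and>
          \<not> (AE t in lebesgue_on \<Omega>. xs t = 0) \<and>
          KL_dist (lebesgue_on \<Omega>) xs x\<^sub>0 < \<infinity> \<longrightarrow>
      decseq (\<lambda>k. KL_dist (lebesgue_on \<Omega>) xs (x k)) \<and>
      (\<lambda>k. KL_residual \<Omega> \<Sigma> (a (k mod N)) (y (k mod N)) (x k)) \<longlonglongrightarrow> 0 \<and>
      (\<lambda>k. KL_dist (lebesgue_on \<Omega>) (x (Suc k)) (x k)) \<longlonglongrightarrow> 0 \<and>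
      (\<forall>j<N. \<forall>p\<ge>1.
        (\<forall>l. (\<lambda>s. integral_op \<Omega> (a j) (x (j + l * N)) s - y j s)
               \<in> Lp_space p (lebesgue_on \<Sigma>)) \<and>
        (\<lambda>l. Lp_norm p (lebesgue_on \<Sigma>)
               (\<lambda>s. integral_op \<Omega> (a j) (x (j + l * N)) s - y j s)) \<longlonglongrightarrow> 0) \<and>
      (\<forall>p>1. Lp_bounded p (lebesgue_on \<Omega>) x \<longrightarrow>
        (\<exists>r z. strict_mono r \<and> Lp_weakly_converges p (lebesgue_on \<Omega>) (x \<circ> r) z \<and>
               solves_system \<Omega> \<Sigma> N a y z)))"
proof -
  define S T where "S = lebesgue_on \<Sigma>" and "T = lebesgue_on \<Omega>"
  have lm: "\<Sigma> \<in> lmeasurable" "\<Omega> \<in> lmeasurable"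
    using assms(1-4) by (auto intro: lmeasurable_open)
  have borel: "\<Sigma> \<in> sets borel" "\<Omega> \<in> sets borel" using assms(1,3) by auto
  have complete: "complete_measure S" "complete_measure T"
    unfolding S_def T_def using lm by (auto intro: complete_measure_lebesgue_on)
  interpret S: finite_measure S unfolding S_def by (rule finite_measure_lebesgue_on[OF lm(1)])
  interpret T: finite_measure T unfolding T_def by (rule finite_measure_lebesgue_on[OF lm(2)])
  obtain m M0 where m: "0 < m"
    and bounds: "\<And>j. j < N \<Longrightarrow> AE (s, t) in lebesgue_on (\<Sigma> \<times> \<Omega>). m \<le> a j s t \<and> a j s t \<le> M0"
    using A2 by blast
  \<comment> \<open>clipping needs \<open>m \<le> M\<close>, and bounds that hold almost everywhere on a null set do not imply it\<close>
  define M where "M = max m M0"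
  obtain C where C: "\<And>j. j < N \<Longrightarrow> AE s in S. y j s \<le> C"
    using A3(2) unfolding S_def by blast
  have "\<exists>b. j < N \<longrightarrow> case_prod b \<in> borel_measurable (S \<Otimes>\<^sub>M T) \<and>
      (\<forall>s t. m \<le> b s t \<and> b s t \<le> M) \<and>
      (AE s in S. AE t in T. a j s t = b s t) \<and> (AE t in T. AE s in S. a j s t = b s t)" for j
  proof (cases "j < N")
    case True
    have meas: "(\<lambda>(s, t). a j s t) \<in> borel_measurable (lebesgue_on (\<Sigma> \<times> \<Omega>))"
      using assms(6) True by blast
    have bnd: "AE (s, t) in lebesgue_on (\<Sigma> \<times> \<Omega>). m \<le> a j s t \<and> a j s t \<le> M"
      using bounds[OF True] by eventually_elim (auto simp: M_def)
    have "m \<le> M" by (simp add: M_def)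
    from Borel_clipped_kernel[OF borel meas bnd this] show ?thesis unfolding S_def T_def by blast
  qed auto
  then obtain b where "\<And>j. j < N \<longrightarrow> case_prod (b j) \<in> borel_measurable (S \<Otimes>\<^sub>M T) \<and>
      (\<forall>s t. m \<le> b j s t \<and> b j s t \<le> M) \<and>
      (AE s in S. AE t in T. a j s t = b j s t) \<and> (AE t in T. AE s in S. a j s t = b j s t)"
    using choice[of "\<lambda>j b. j < N \<longrightarrow> case_prod b \<in> borel_measurable (S \<Otimes>\<^sub>M T) \<and>
      (\<forall>s t. m \<le> b s t \<and> b s t \<le> M) \<and>
      (AE s in S. AE t in T. a j s t = b s t) \<and> (AE t in T. AE s in S. a j s t = b s t)"] by blast
  then have b: "\<And>j. j < N \<Longrightarrow> case_prod (b j) \<in> borel_measurable (S \<Otimes>\<^sub>M T)"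
      "\<And>j s t. j < N \<Longrightarrow> m \<le> b j s t" "\<And>j s t. j < N \<Longrightarrow> b j s t \<le> M"
      "\<And>j. j < N \<Longrightarrow> AE s in S. AE t in T. a j s t = b j s t"
      "\<And>j. j < N \<Longrightarrow> AE t in T. AE s in S. a j s t = b j s t"
    by blast+
  have kernel: "bounded_kernel S T (b j) m M" if "j < N" for j
    by unfold_locales (use b[OF that] m in auto)
  have op_eq: "AE s in S. integral_op \<Omega> (a j) u s = kernel_op T (b j) u s"
    if "j < N" "u \<in> borel_measurable T" for j u
    using bounded_kernel.kernel_op_cong_AE[OF kernel[OF that(1)] complete(2) b(4)[OF that(1)] that(2)]
    by (simp add: integral_op_def kernel_op_def T_def)
  have residual_eq: "KL_residual \<Omega> \<Sigma> (a j) (y j) u = KL_dist S (y j) (kernel_op T (b j) u)"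
    if "j < N" "u \<in> borel_measurable T" for j u
    unfolding KL_residual_def S_def[symmetric] using op_eq[OF that] by (intro KL_dist_cong_AE) auto
  have problem: "em_problem S T (b j) m M (y j) C" if j: "j < N" for j
  proof -
    interpret bounded_kernel S T "b j" m M by (rule kernel[OF j])
    have "AE t in T. (\<integral>s. a j s t * 1 \<partial>S) = kernel_op S (\<lambda>t s. b j s t) (\<lambda>s. 1) t"
      by (rule adjoint_cong_AE[OF complete(1) b(5)[OF j]]) auto
    moreover have "AE t in T. (\<integral>s. a j s t \<partial>S) = 1" using A1 j unfolding S_def T_def by blast
    ultimately have "AE t in T. (\<integral>s. b j s t \<partial>S) = 1"
      by eventually_elim (simp add: kernel_op_def)
    then show ?thesis
      using assms(7) A3(1) C[OF j] j
      by unfold_locales (auto simp: is_density_def S_def)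
  qed
  have step_eq: "AE t in T. EM_step \<Omega> \<Sigma> (a j) (y j) u t = u t * em_factor S T (b j) (y j) u t"
    if j: "j < N" and u: "u \<in> borel_measurable T" for j u
  proof -
    interpret em_problem S T "b j" m M "y j" C by (rule problem[OF j])
    have "AE t in T. (\<integral>s. a j s t * (y j s / integral_op \<Omega> (a j) u s) \<partial>S)
        = A' (\<lambda>s. y j s / A u s) t"
      using op_eq[OF j u] A_meas[OF u] y_props(4)
      by (intro adjoint_cong_AE complete(1) b(5)[OF j]) (auto elim: eventually_mono)
    then show ?thesis
      by eventually_elim (simp add: EM_step_def em_factor_def S_def)
  qed
  have less: "k mod N < N" for k using assms(5) by simp
  have iter: "AE t in T. x (Suc k) t = x k t * em_factor S T (b (k mod N)) (y (k mod N)) (x k) t"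
    if "x k \<in> borel_measurable T" for k
  proof -
    have "AE t in T. x (Suc k) t = EM_step \<Omega> \<Sigma> (a (k mod N)) (y (k mod N)) (x k) t"
      using assms(14) unfolding T_def by blast
    with step_eq[OF less that] show ?thesis by eventually_elim simp
  qed
  have x0: "is_density T (x 0)"
    using assms(12,13) by (auto simp: prob_densities_def is_density_def T_def)
  have x_meas: "x k \<in> borel_measurable T" for k
  proof (induction k)
    case 0
    then show ?case using x0 by (auto simp: is_density_def)
  next
    case (Suc k)
    interpret em_problem S T "b (k mod N)" m M "y (k mod N)" C by (rule problem[OF less])
    have "(\<lambda>t. x k t * em_factor S T (b (k mod N)) (y (k mod N)) (x k) t) \<in> borel_measurable T"
      unfolding em_factor_def
      by (intro borel_measurable_times Suc A'_meas borel_measurable_divide A_meas y_props(4))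
    from complete_measure.borel_measurable_cong_AE[OF complete(2) this iter[OF Suc]]
    show ?case .
  qed
  interpret os_em S T N b m M C y x
    by (intro os_em.intro os_em_axioms.intro S.finite_measure_axioms T.finite_measure_axioms
      assms(5) problem x_meas x0 iter)
  have solves_iff: "solves_system \<Omega> \<Sigma> N a y u \<longleftrightarrow>
      integrable T u \<and> (\<forall>j<N. AE s in S. integral_op \<Omega> (a j) u s = y j s)" for u
    unfolding solves_system_def S_def T_def ..
  have part1: "KL_residual \<Omega> \<Sigma> (a (k mod N)) (y (k mod N)) (x (Suc k))
      \<le> KL_residual \<Omega> \<Sigma> (a (k mod N)) (y (k mod N)) (x k)" for k
    unfolding residual_eq[OF less x_meas] by (rule residual_mono)
  have part2: "decseq (\<lambda>k. KL_dist T xs (x k)) \<and>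
      (\<lambda>k. KL_residual \<Omega> \<Sigma> (a (k mod N)) (y (k mod N)) (x k)) \<longlonglongrightarrow> 0 \<and>
      (\<lambda>k. KL_dist T (x (Suc k)) (x k)) \<longlonglongrightarrow> 0 \<and>
      (\<forall>j<N. \<forall>p\<ge>1.
        (\<forall>l. (\<lambda>s. integral_op \<Omega> (a j) (x (j + l * N)) s - y j s) \<in> Lp_space p S) \<and>
        (\<lambda>l. Lp_norm p S (\<lambda>s. integral_op \<Omega> (a j) (x (j + l * N)) s - y j s)) \<longlonglongrightarrow> 0) \<and>
      (\<forall>p>1. Lp_bounded p T x \<longrightarrow>
        (\<exists>r z. strict_mono r \<and> Lp_weakly_converges p T (x \<circ> r) z \<and> solves_system \<Omega> \<Sigma> N a y z))"
    if sol: "solves_system \<Omega> \<Sigma> N a y xs" and nonneg: "AE t in T. xs t \<ge> 0"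
      and fin: "KL_dist T xs x\<^sub>0 < \<infinity>" for xs
  proof -
    have xs_int: "integrable T xs" using sol by (simp add: solves_iff)
    have xs_sol: "AE s in S. kernel_op T (b j) xs s = y j s" if j: "j < N" for j
    proof -
      have "AE s in S. integral_op \<Omega> (a j) xs s = y j s"
        using sol j by (simp add: solves_iff)
      moreover have "AE s in S. integral_op \<Omega> (a j) xs s = kernel_op T (b j) xs s"
        using op_eq[OF j] xs_int by auto
      ultimately show ?thesis by eventually_elim simp
    qed
    have fin': "KL_dist T xs (x 0) < \<infinity>" using fin assms(13) by simp
    interpret os_em_solution S T N b m M C y x xs
      by (intro os_em_solution.intro os_em_solution_axioms.intro os_em_axioms xs_int nonneg xs_sol fin')
    have part_v: "(\<lambda>s. integral_op \<Omega> (a j) (x (j + l * N)) s - y j s) \<in> Lp_space p S"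
        "(\<lambda>l. Lp_norm p S (\<lambda>s. integral_op \<Omega> (a j) (x (j + l * N)) s - y j s)) \<longlonglongrightarrow> 0"
      if j: "j < N" and p: "p \<ge> 1" for j p l
    proof -
      let ?h = "\<lambda>l s. integral_op \<Omega> (a j) (x (j + l * N)) s - y j s"
      let ?g = "\<lambda>l s. kernel_op T (b j) (x (j + l * N)) s - y j s"
      have eq: "AE s in S. ?h l s = ?g l s" for l
        using op_eq[OF j x_meas] by (auto elim: eventually_mono)
      note g = image_diff_bound[OF j]
      have h_meas: "?h l \<in> borel_measurable S" for l
        by (rule complete_measure.borel_measurable_cong_AE[OF complete(1) g(2) eq])
      show "?h l \<in> Lp_space p S"
      proof (rule Lp_spaceI_bounded[OF S.finite_measure_axioms h_meas])
        show "AE s in S. \<bar>?h l s\<bar> \<le> max C M"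
          using eq[of l] g(1)[of "j + l * N"] by eventually_elim simp
      qed (use p in auto)
      have "(\<integral>s. \<bar>?h l s\<bar> powr p \<partial>S) = (\<integral>s. \<bar>?g l s\<bar> powr p \<partial>S)" for l
      proof (rule integral_cong_AE)
        show "(\<lambda>s. \<bar>?h l s\<bar> powr p) \<in> borel_measurable S" using h_meas[of l] by measurable
        show "(\<lambda>s. \<bar>?g l s\<bar> powr p) \<in> borel_measurable S" using g(2) by measurable
        show "AE s in S. \<bar>?h l s\<bar> powr p = \<bar>?g l s\<bar> powr p" using eq[of l] by eventually_elim simp
      qed
      then have "(\<lambda>l. \<integral>s. \<bar>?h l s\<bar> powr p \<partial>S) \<longlonglongrightarrow> 0"
        using image_tendsto[OF j, of p] p by simp
      from tendsto_powr'[OF this tendsto_const[of "1 / p"]] p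
      show "(\<lambda>l. Lp_norm p S (?h l)) \<longlonglongrightarrow> 0" by (simp add: Lp_norm_def)
    qed
    have part_vi: "\<exists>r z. strict_mono r \<and> Lp_weakly_converges p T (x \<circ> r) z \<and> solves_system \<Omega> \<Sigma> N a y z"
      if p: "p > 1" and bounded: "Lp_bounded p T x" for p
    proof -
      obtain D where D: "countable D" "D \<subseteq> sets T"
        and dense: "\<forall>A\<in>sets T. \<forall>e>0. \<exists>F\<in>D. measure T ((A - F) \<union> (F - A)) < e"
        using lebesgue_on_separable[OF lm(2), folded T_def] by (elim exE conjE)
      have "\<exists>r z. strict_mono r \<and> Lp_weakly_converges p T (x \<circ> r) z \<and> integrable T z \<and>
          (\<forall>j<N. AE s in S. kernel_op T (b j) z s = y j s)"
        by (rule weak_cluster_point[OF D _ p bounded]) (use dense in simp)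
      then obtain r z where r: "strict_mono r" "Lp_weakly_converges p T (x \<circ> r) z" "integrable T z"
        and z: "\<And>j. j < N \<Longrightarrow> AE s in S. kernel_op T (b j) z s = y j s" by blast
      have "AE s in S. integral_op \<Omega> (a j) z s = y j s" if j: "j < N" for j
      proof -
        have "AE s in S. integral_op \<Omega> (a j) z s = kernel_op T (b j) z s"
          using op_eq[OF j] r(3) by auto
        with z[OF j] show ?thesis by eventually_elim simp
      qed
      with r(3) have "solves_system \<Omega> \<Sigma> N a y z" by (simp add: solves_iff)
      with r show ?thesis by blast
    qed
    show ?thesis
      unfolding residual_eq[OF less x_meas]
      by (intro conjI allI impI dist_decseq residual_tendsto step_tendsto part_v part_vi)
  qed
  show ?thesis
    unfolding S_def[symmetric] T_def[symmetric]
    by (intro conjI[OF allI[OF part1]] allI impI, elim conjE, rule part2)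
qed

end
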